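(* Let $n\in\{1,2,3,4\}$ and let $(k,l,\beta)$ be a generalized functional invariant appearing together with $M_n$ in the list below, next to a pair $(p,q)$. For the twisted family of Jacobian elliptic Calabi-Yau threefolds with generalized functional invariant $(k,l,\beta)$ of the family of $M_n$-lattice polarized K3 surfaces (see context), the period integrals are annihilated by the Picard-Fuchs operator $${}_1L^{(4)}_t(p,q)=\theta^4-t\,(\theta+p)(\theta+q)(\theta+1-q)(\theta+1-p).$$ In particular, the period over $\Sigma_3(t)$ is holomorphic at $t=0$ and given by $$\omega=(2\pi i)^3\;{}_4F_3\!\left(p,q,1-q,1-p;1,1,1\,\big|\,t\right).$$ List of $(p,q)$ and realizations $M_n:(k,l,\beta)$: - $(\frac12,\frac12)$: $M_4:(1,1,1)$. - $(\frac13,\frac12)$: $M_4:(2,1,1)$; $M_3:(1,1,1)$. - $(\frac13,\frac13)$: $M_3:(2,1,1)$. - $(\frac14,\frac12)$: $M_4:(2,2,1)$; $M_3:(3,1,1)$; $M_2:(1,1,1)$; $M_4:(1,1,\frac12)$. - $(\frac14,\frac13)$: $M_3:(2,2,1)$; $M_2:(2,1,1)$; $M_3:(1,1,\frac12)$. - $(\frac14,\frac14)$: $M_2:(2,2,1)$; $M_2:(1,1,\frac12)$. - $(\frac16,\frac12)$: $M_3:(3,3,1)$; $M_1:(1,1,1)$; $M_4:(2,1,\frac12)$; $M_2:(1,2,\frac12)$. - $(\frac16,\frac13)$: $M_2:(4,2,1)$; $M_1:(2,1,1)$; $M_3:(2,1,\frac12)$. - $(\frac16,\frac14)$: $M_1:(2,2,1)$;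 $M_2:(2,1,\frac12)$; $M_1:(1,1,\frac12)$. - $(\frac16,\frac16)$: $M_1:(2,1,\frac12)$. - $(\frac15,\frac25)$: $M_3:(3,2,1)$; $M_2:(4,1,1)$. - $(\frac18,\frac38)$: $M_2:(4,4,1)$; $M_3:(3,1,\frac12)$; $M_2:(2,2,\frac12)$; $M_1:(1,3,\frac12)$. - $(\frac1{10},\frac3{10})$: $M_2:(4,1,\frac12)$; $M_1:(2,3,\frac12)$. - $(\frac1{12},\frac5{12})$: $M_2:(4,2,\frac12)$.
   Context: $\theta=t\frac{d}{dt}$. For $n=1,2,3,4$ let $\mu=\frac16,\frac14,\frac13,\frac12$ and let $g_2(t),g_3(t)$ be, respectively: ($n=1$) $g_2=3$, $g_3=-1+2t$; ($n=2$) $g_2=\frac{16}3-4t$, $g_3=-\frac{64}{27}+\frac83t$; ($n=3$) $g_2=27-24t$, $g_3=27-36t+8t^2$; ($n=4$) $g_2=\frac13(4t^2-64t+64)$, $g_3=\frac8{27}(2-t)(32-32t-t^2)$. The family of $M_n$-lattice polarized K3 surfaces ($M_n=H\oplus E_8\oplus E_8\oplus\langle-2n\rangle$) is $Y^2=4X^3-g_2(t,u)X-g_3(t,u)$ with $g_2(t,u)=g_2(-\frac{t}{4u(u+1)})(u(u+1))^4$, $g_3(t,u)=g_3(-\frac{t}{4u(u+1)})(u(u+1))^6$. Its twisted family with generalized functional invariant $(k,l,\beta)$, where $1\le k\le1/\mu$, $1\le l\le\beta/\mu$, $\beta\in\{\frac12,1\}$, is, with $c_{kl}=(-1)^kk^kl^l/(k+l)^{k+l}$,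 $$Y^2=4X^3-g_2\!\left(\tfrac{c_{kl}t}{v^k(v+1)^l},u\right)v^4(v+1)^{4\beta}X-g_3\!\left(\tfrac{c_{kl}t}{v^k(v+1)^l},u\right)v^6(v+1)^{6\beta},$$ a family of elliptic Calabi-Yau threefolds over $\mathbb{P}^1\times\mathbb{P}^1\ni(u,v)$ with holomorphic three-form $dv\wedge du\wedge dX/Y$; its periods are $\oint_C\frac{dv}{v(v+1)^\beta}\,\omega_2\big(\frac{c_{kl}t}{v^k(v+1)^l}\big)$ with $\omega_2$ a period of the K3 family. Cycles: $\Sigma_1(t)$ is the A-cycle (vanishing at $t=0$) of $y^2=4x^3-g_2(t)x-g_3(t)$; $\Sigma_2(t)$ is the warped product of the circle $|u|=\frac12$ with the cycles $\Sigma_1(-\frac{t}{4u(u+1)})$ rescaled by $(X,Y)\mapsto(u^2(u+1)^2X,u^3(u+1)^3Y)$; $\Sigma_3(t)$ is the warped product of the circle $|v|=\frac12$ with the cycles $\Sigma_2(\frac{c_{kl}t}{v^k(v+1)^l})$ rescaled by $(u,X,Y)\mapsto(u,v^2(v+1)^{2\beta}X,v^3(v+1)^{3\beta}Y)$, for $|t|$ small. The holomorphic form is normalized by a constant so that the period of the underlying elliptic curves over $\Sigma_1(t)$ is $(2\pi i)\,{}_2F_1(\mu,1-\mu;1|t)$. *)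

theory Defs
  imports "HOL-Complex_Analysis.Complex_Analysis"
begin

section \<open>The Weierstrass families\<close>

definition mu :: "nat \<Rightarrow> complex" where
  "mu n = (if n = 1 then 1/6 else if n = 2 then 1/4 else if n = 3 then 1/3 else 1/2)"

definition g2 :: "nat \<Rightarrow> complex \<Rightarrow> complex" where
  "g2 n t = (if n = 1 then 3
             else if n = 2 then 16/3 - 4 * t
             else if n = 3 then 27 - 24 * t
             else 1/3 * (4 * t^2 - 64 * t + 64))"

definition g3 :: "nat \<Rightarrow> complex \<Rightarrow> complex" where
  "g3 n t = (if n = 1 then -1 + 2 * t
             else if n = 2 then -64/27 + 8/3 * t
             else if n = 3 then 27 - 36 * t + 8 * t^2
             else 8/27 * (2 - t) * (32 - 32 * t - t^2))"

definition g2_K3 :: "nat \<Rightarrow> complex \<Rightarrow> complex \<Rightarrow> complex" where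
  "g2_K3 n t u = g2 n (- t / (4 * u * (u + 1))) * (u * (u + 1))^4"

definition g3_K3 :: "nat \<Rightarrow> complex \<Rightarrow> complex \<Rightarrow> complex" where
  "g3_K3 n t u = g3 n (- t / (4 * u * (u + 1))) * (u * (u + 1))^6"

definition c_kl :: "nat \<Rightarrow> nat \<Rightarrow> complex" where
  "c_kl k l = (-1)^k * of_nat k^k * of_nat l^l / of_nat (k + l)^(k + l)"

definition K3_param :: "nat \<Rightarrow> nat \<Rightarrow> complex \<Rightarrow> complex \<Rightarrow> complex" where
  "K3_param k l t v = c_kl k l * t / (v^k * (v + 1)^l)"

text \<open>Since \<open>\<beta>\<close> is 1/2 or 1, the exponents \<open>4\<beta>\<close> and \<open>6\<beta>\<close> are integers and the powers below are
  single-valued polynomials in \<open>v\<close>.\<close>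

definition g2_CY :: "nat \<Rightarrow> nat \<Rightarrow> nat \<Rightarrow> complex \<Rightarrow> complex \<Rightarrow> complex \<Rightarrow> complex \<Rightarrow> complex" where
  "g2_CY n k l \<beta> t v u = g2_K3 n (K3_param k l t v) u * v^4 * (v + 1) powr (4 * \<beta>)"

definition g3_CY :: "nat \<Rightarrow> nat \<Rightarrow> nat \<Rightarrow> complex \<Rightarrow> complex \<Rightarrow> complex \<Rightarrow> complex \<Rightarrow> complex" where
  "g3_CY n k l \<beta> t v u = g3_K3 n (K3_param k l t v) u * v^6 * (v + 1) powr (6 * \<beta>)"


section \<open>The cycles \<open>\<Sigma>\<^sub>1, \<Sigma>\<^sub>2, \<Sigma>\<^sub>3\<close>\<close>

text \<open>At \<open>t = 0\<close> the cubic \<open>4 x^3 - g2 x - g3\<close> becomes \<open>4 (x - e)^2 (x + 2 e)\<close> with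
  \<open>e = node n\<close>. For small \<open>t\<close> exactly the two roots that collide in \<open>e\<close> lie inside the circle
  \<open>\<bar>x - e\<bar> = \<bar>e\<bar> / 2\<close>, so the A-cycle, which vanishes at \<open>t = 0\<close>, is a lift of this circle to the
  elliptic curve. On the circle \<open>(4 x^3 - g2 x - g3) / (12 e (x - e)^2)\<close> is close to 1, hence the
  branch of \<open>y\<close> below is continuous, closes up, and depends holomorphically on \<open>t\<close>.\<close>

definition node :: "nat \<Rightarrow> complex" where
  "node n = (if n = 1 then 1/2 else if n = 2 then 2/3 else if n = 3 then -3/2 else -4/3)"

definition Sigma1 :: "nat \<Rightarrow> complex \<Rightarrow> real \<Rightarrow> complex \<times> complex" where
  "Sigma1 n t c =
    (let e = node n;
         w = of_real (cmod e / 2) * exp (2 * of_real pi * \<i> * of_real c);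
         x = e + w;
         f = 4 * x^3 - g2 n t * x - g3 n t
     in (x, csqrt (12 * e) * w * csqrt (f / (12 * e * w^2))))"

definition Sigma2 :: "nat \<Rightarrow> complex \<Rightarrow> real \<times> real \<Rightarrow> complex \<times> complex \<times> complex" where
  "Sigma2 n t = (\<lambda>(b, c).
    let u = 1/2 * exp (2 * of_real pi * \<i> * of_real b);
        (x, y) = Sigma1 n (- t / (4 * u * (u + 1))) c
    in (u, u^2 * (u + 1)^2 * x, u^3 * (u + 1)^3 * y))"

text \<open>Points of the threefold are written \<open>(v, u, X, Y)\<close>. On \<open>\<bar>v\<bar> = 1/2\<close> the principal branch of
  \<open>(v + 1) powr (3 * \<beta>)\<close> is continuous.\<close>

definition Sigma3 :: "nat \<Rightarrow> nat \<Rightarrow> nat \<Rightarrow> complex \<Rightarrow> complex \<Rightarrow> real \<times> real \<times> real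
    \<Rightarrow> complex \<times> complex \<times> complex \<times> complex" where
  "Sigma3 n k l \<beta> t = (\<lambda>(a, b, c).
    let v = 1/2 * exp (2 * of_real pi * \<i> * of_real a);
        (u, x, y) = Sigma2 n (K3_param k l t v) (b, c)
    in (v, u, v^2 * (v + 1) powr (2 * \<beta>) * x, v^3 * (v + 1) powr (3 * \<beta>) * y))"


section \<open>Integrals of the holomorphic forms over parametrized cycles\<close>

definition one_form_integral :: "(real \<Rightarrow> complex \<times> complex) \<Rightarrow> complex" where
  "one_form_integral S =
     integral {0..1} (\<lambda>c. vector_derivative (\<lambda>c. fst (S c)) (at c) / snd (S c))"

definition pd1 :: "(real \<times> real \<times> real \<Rightarrow> complex) \<Rightarrow> real \<times> real \<times> real \<Rightarrow> complex" where
  "pd1 f = (\<lambda>(a, b, c). vector_derivative (\<lambda>x. f (x, b, c)) (at a))"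

definition pd2 :: "(real \<times> real \<times> real \<Rightarrow> complex) \<Rightarrow> real \<times> real \<times> real \<Rightarrow> complex" where
  "pd2 f = (\<lambda>(a, b, c). vector_derivative (\<lambda>x. f (a, x, c)) (at b))"

definition pd3 :: "(real \<times> real \<times> real \<Rightarrow> complex) \<Rightarrow> real \<times> real \<times> real \<Rightarrow> complex" where
  "pd3 f = (\<lambda>(a, b, c). vector_derivative (\<lambda>x. f (a, b, x)) (at c))"

text \<open>The integral of \<open>dv \<and> du \<and> dX / Y\<close> over a parametrized singular 3-cube.\<close>

definition three_form_integral ::
    "(real \<times> real \<times> real \<Rightarrow> complex \<times> complex \<times> complex \<times> complex) \<Rightarrow> complex" where
  "three_form_integral S =
    (let v = (\<lambda>p. fst (S p)); u = (\<lambda>p. fst (snd (S p)));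
         X = (\<lambda>p. fst (snd (snd (S p)))); Y = (\<lambda>p. snd (snd (snd (S p))))
     in integral (cbox (0, 0, 0) (1, 1, 1))
          (\<lambda>p. det (vector [vector [pd1 v p, pd2 v p, pd3 v p],
                            vector [pd1 u p, pd2 u p, pd3 u p],
                            vector [pd1 X p, pd2 X p, pd3 X p]] :: complex^3^3) / Y p))"

definition F21 :: "complex \<Rightarrow> complex \<Rightarrow> complex \<Rightarrow> complex \<Rightarrow> complex" where
  "F21 a b c t = eval_fps (fps_hypergeo [a, b] [c] 1) t"

definition F43 :: "complex \<Rightarrow> complex \<Rightarrow> complex \<Rightarrow> complex \<Rightarrow> complex \<Rightarrow> complex \<Rightarrow> complex
    \<Rightarrow> complex \<Rightarrow> complex" where
  "F43 a b c d e f g t = eval_fps (fps_hypergeo [a, b, c, d] [e, f, g] 1) t"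

text \<open>The constant by which the holomorphic form is multiplied; it is determined by the resulting
  period over \<open>\<Sigma>\<^sub>1\<close>.\<close>

definition form_const :: "nat \<Rightarrow> complex" where
  "form_const n = (THE N. \<forall>\<^sub>F t in nhds 0.
      N * one_form_integral (Sigma1 n t) = 2 * of_real pi * \<i> * F21 (mu n) (1 - mu n) 1 t)"

definition Sigma3_period :: "nat \<Rightarrow> nat \<Rightarrow> nat \<Rightarrow> complex \<Rightarrow> complex \<Rightarrow> complex" where
  "Sigma3_period n k l \<beta> t = form_const n * three_form_integral (Sigma3 n k l \<beta> t)"


section \<open>Period integrals over arbitrary families of cycles\<close>

text \<open>The function \<open>P\<close> on \<open>N\<close> is a period of the family of elliptic curves
  \<open>Y^2 = 4 X^3 - G2 z X - G3 z\<close>, \<open>z \<in> N\<close>: locally on \<open>N\<close>, it is the integral of \<open>dX / Y\<close>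
  over a locally constant family of closed loops on smooth members of the family. Every class in the
  first homology of a smooth curve is represented by a loop avoiding the zeros of \<open>Y\<close>, and
  the projection of such a loop to the \<open>X\<close>-plane can be kept fixed when \<open>z\<close> varies a little.\<close>

definition curve_period :: "('z::topological_space \<Rightarrow> complex) \<Rightarrow> ('z \<Rightarrow> complex) \<Rightarrow> 'z set
    \<Rightarrow> ('z \<Rightarrow> complex) \<Rightarrow> bool" where
  "curve_period G2 G3 N P \<longleftrightarrow>
    (\<forall>z0\<in>N. \<exists>N0 \<gamma> Y.
       openin (top_of_set N) N0 \<and> z0 \<in> N0 \<and>
       (\<forall>z\<in>N0. G2 z^3 - 27 * G3 z^2 \<noteq> 0) \<and>
       valid_path \<gamma> \<and> pathfinish \<gamma> = pathstart \<gamma> \<and>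
       continuous_on ({0..1} \<times> N0) (\<lambda>(s, z). Y s z) \<and>
       (\<forall>s\<in>{0..1}. \<forall>z\<in>N0. Y s z \<noteq> 0 \<and> Y s z^2 = 4 * \<gamma> s^3 - G2 z * \<gamma> s - G3 z) \<and>
       (\<forall>z\<in>N0. Y 1 z = Y 0 z) \<and>
       (\<forall>z\<in>N0. P z = integral {0..1} (\<lambda>s. vector_derivative \<gamma> (at s within {0..1}) / Y s z)))"

text \<open>A cycle in the total space of a fibration over a (punctured) line is a finite sum of warped
  products of a path \<open>c j\<close> in the base with a locally constant family of cycles in the fibres over
  \<open>c j\<close>, such that over every point \<open>x\<close> of the base the boundary contributions cancel; a closed
  contour with a family of fibre cycles that is invariant along the contour is the case \<open>m = 1\<close>.
  Here \<open>fibre c M h\<close> says that \<open>h (z, s)\<close>, for \<open>(z, s) \<in> M\<close>, is the period of the fibre over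
  \<open>c s\<close> over such a family of cycles. The family of paths may be kept fixed for \<open>z\<close> in small open
  sets. Cancellation of boundaries is expressed through the periods of the fibre cycles, as functions
  of \<open>z\<close>.\<close>

definition warped_period ::
    "((real \<Rightarrow> complex) \<Rightarrow> ('z::topological_space \<times> real) set \<Rightarrow> ('z \<times> real \<Rightarrow> complex) \<Rightarrow> bool)
     \<Rightarrow> 'z set \<Rightarrow> ('z \<Rightarrow> complex) \<Rightarrow> bool" where
  "warped_period fibre N P \<longleftrightarrow>
    (\<forall>z0\<in>N. \<exists>N0 (m::nat) c h.
       openin (top_of_set N) N0 \<and> z0 \<in> N0 \<and>
       (\<forall>j<m. valid_path (c j) \<and> fibre (c j) (N0 \<times> {0..1}) (h j)) \<and>
       (\<forall>z\<in>N0. \<forall>x. (\<Sum>j<m. if pathfinish (c j) = x then h j (z, 1) else 0)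
                   = (\<Sum>j<m. if pathstart (c j) = x then h j (z, 0) else 0)) \<and>
       (\<forall>z\<in>N0. P z = (\<Sum>j<m. integral {0..1}
                  (\<lambda>s. h j (z, s) * vector_derivative (c j) (at s within {0..1})))))"

text \<open>Periods of \<open>du \<and> dX / Y\<close> for a family, parametrized by \<open>z\<close>, of elliptic surfaces
  \<open>Y^2 = 4 X^3 - G2 z u X - G3 z u\<close>. Paths avoid \<open>u = 0\<close>, \<open>u = -1\<close> (and \<open>v = 0\<close>,
  \<open>v = -1\<close> below): by the convention \<open>x / 0 = 0\<close> and the factors \<open>u (u + 1)\<close>, \<open>v\<close>, \<open>v + 1\<close>, the
  coefficients \<open>G2\<close>, \<open>G3\<close> take the value 0 there, whereas the fibres are required to be smooth.\<close>

definition surface_period :: "('z::topological_space \<Rightarrow> complex \<Rightarrow> complex)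
    \<Rightarrow> ('z \<Rightarrow> complex \<Rightarrow> complex) \<Rightarrow> 'z set \<Rightarrow> ('z \<Rightarrow> complex) \<Rightarrow> bool" where
  "surface_period G2 G3 =
     warped_period (\<lambda>c. curve_period (\<lambda>(z, s). G2 z (c s)) (\<lambda>(z, s). G3 z (c s)))"

text \<open>\<open>P\<close> is a (possibly local) period function, defined on \<open>W\<close>, of the normalized form
  \<open>dv \<and> du \<and> dX / Y\<close> on the twisted family of threefolds.\<close>

definition threefold_period :: "nat \<Rightarrow> nat \<Rightarrow> nat \<Rightarrow> complex \<Rightarrow> complex set
    \<Rightarrow> (complex \<Rightarrow> complex) \<Rightarrow> bool" where
  "threefold_period n k l \<beta> W P \<longleftrightarrow>
    (\<exists>Q. warped_period
           (\<lambda>c. surface_period (\<lambda>(t, s). g2_CY n k l \<beta> t (c s)) (\<lambda>(t, s). g3_CY n k l \<beta> t (c s))) W Q \<and>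
         (\<forall>t\<in>W. P t = form_const n * Q t))"


section \<open>The Picard-Fuchs operator and the list of realizations\<close>

definition theta :: "(complex \<Rightarrow> complex) \<Rightarrow> complex \<Rightarrow> complex" where
  "theta f t = t * deriv f t"

definition theta_plus :: "complex \<Rightarrow> (complex \<Rightarrow> complex) \<Rightarrow> complex \<Rightarrow> complex" where
  "theta_plus a f t = theta f t + a * f t"

definition PF :: "complex \<Rightarrow> complex \<Rightarrow> (complex \<Rightarrow> complex) \<Rightarrow> complex \<Rightarrow> complex" where
  "PF p q f t = (theta ^^ 4) f t
     - t * theta_plus p (theta_plus q (theta_plus (1 - q) (theta_plus (1 - p) f))) t"

text \<open>Entries \<open>((p, q), (n, k, l, \<beta>))\<close>.\<close>

definition realizations :: "((complex \<times> complex) \<times> (nat \<times> nat \<times> nat \<times> complex)) set" where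
  "realizations =
     {(1/2, 1/2)} \<times> {(4,1,1,1)} \<union>
     {(1/3, 1/2)} \<times> {(4,2,1,1), (3,1,1,1)} \<union>
     {(1/3, 1/3)} \<times> {(3,2,1,1)} \<union>
     {(1/4, 1/2)} \<times> {(4,2,2,1), (3,3,1,1), (2,1,1,1), (4,1,1,1/2)} \<union>
     {(1/4, 1/3)} \<times> {(3,2,2,1), (2,2,1,1), (3,1,1,1/2)} \<union>
     {(1/4, 1/4)} \<times> {(2,2,2,1), (2,1,1,1/2)} \<union>
     {(1/6, 1/2)} \<times> {(3,3,3,1), (1,1,1,1), (4,2,1,1/2), (2,1,2,1/2)} \<union>
     {(1/6, 1/3)} \<times> {(2,4,2,1), (1,2,1,1), (3,2,1,1/2)} \<union>
     {(1/6, 1/4)} \<times> {(1,2,2,1), (2,2,1,1/2), (1,1,1,1/2)} \<union>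
     {(1/6, 1/6)} \<times> {(1,2,1,1/2)} \<union>
     {(1/5, 2/5)} \<times> {(3,3,2,1), (2,4,1,1)} \<union>
     {(1/8, 3/8)} \<times> {(2,4,4,1), (3,3,1,1/2), (2,2,2,1/2), (1,1,3,1/2)} \<union>
     {(1/10, 3/10)} \<times> {(2,4,1,1/2), (1,2,3,1/2)} \<union>
     {(1/12, 5/12)} \<times> {(2,4,2,1/2)}"

end

theory Submission
  imports Defs
begin

text \<open>
  Let \<open>\<theta> = t d/dt\<close>. Up to an exact form \<open>d (q / Y\<^sup>3)\<close>, the form \<open>dX / Y\<close> on the curves with
  coefficients \<open>g2 n t\<close>, \<open>g3 n t\<close> is annihilated by a hypergeometric operator of order two, and the exact
  form \<open>d (X / Y)\<close> shows that a rescaling of \<open>X\<close> and \<open>Y\<close> only multiplies the periods by a factor.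
  Hence the fibre periods over a point \<open>v\<close> of the base are locally of the form
  \<open>r v \<cdot> \<phi> (C t / (v\<^sup>k (v + 1)\<^sup>l))\<close>, where \<open>r\<close> is a branch of \<open>1 / (v (v + 1) powr \<beta>)\<close> and \<open>\<phi>\<close> solves a
  hypergeometric equation. Integration by parts in \<open>v\<close> against \<open>v\<^sup>-\<^sup>a (v + 1)\<^sup>-\<^sup>b\<close> exchanges linear
  factors in \<open>\<theta>\<close>; for the triples of the list every factor to be exchanged is available, so that the order
  of the equation rises by one only. The boundary terms cancel, since they arise from the
  boundary periods by operators in \<open>t\<close>. The step from the elliptic curves to the K3 surfaces is the case
  \<open>k = l = \<beta> = 1\<close>. The period over \<open>\<Sigma>\<^sub>3\<close> is an iterated integral over circles, therefore holomorphic at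
  \<open>t = 0\<close> with a value given by residues, and this value determines the holomorphic solution.
\<close>

section \<open>Polynomials in \<open>\<theta>\<close>\<close>

text \<open>The obstacle is that periods are given only locally and only along paths: a fibre period
  is a function of the parameter and of the time on the path, without any analytic dependence on the
  base point. So the loop on an elliptic curve is kept fixed while scale and modulus vary as
  independent complex variables, which splits off a square root from a solution of Gauss's equation.
  For K3 surfaces, the fibre over \<open>c s\<close> at parameter \<open>t\<close> is compared with
  the fibre over \<open>c s0\<close> at a rescaled parameter; this shows that only
  \<open>t / (v^k (v + 1)^l)\<close> matters. One exchange argument then serves both fibrations and
  the circles of \<open>\<Sigma>\<^sub>3\<close>. Operators are lists of shifts \<open>a\<close> of
  factors \<open>\<theta> + a\<close>, because exchanges act on single factors and the factors
  commute. The first exchange consumes \<open>\<theta> + k/k = \<theta> + 1\<close>; this factor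
  becomes available when \<theta> is applied once more to the equation of the fibre, which is why
  the order rises by one. The constants collected by the exchanges multiply to
  \<open>1 / c_kl k l\<close>.\<close>

definition Theta :: "complex list \<Rightarrow> (complex \<Rightarrow> complex) \<Rightarrow> complex \<Rightarrow> complex" where
  "Theta as f = foldr theta_plus as f"

lemma Theta_simps [simp]:
  "Theta [] f = f"
  "Theta (a # as) f = theta_plus a (Theta as f)"
  by (simp_all add: Theta_def)

lemma theta_plus_0: "theta_plus 0 f = theta f"
  by (simp add: theta_plus_def fun_eq_iff)

lemma theta_plus_holomorphic:
  assumes "open U" "f holomorphic_on U"
  shows "theta_plus a f holomorphic_on U"
  unfolding theta_plus_def theta_def
  by (intro holomorphic_intros holomorphic_deriv assms)

lemma Theta_holomorphic:
  assumes "open U" "f holomorphic_on U"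
  shows "Theta as f holomorphic_on U"
  by (induction as) (simp_all add: assms theta_plus_holomorphic)

lemma deriv_cong_open:
  assumes "open U" "\<And>x. x \<in> U \<Longrightarrow> f x = g x" "t \<in> U"
  shows "deriv f t = deriv g t"
  by (rule deriv_cong_ev) (use assms in \<open>auto simp: eventually_nhds\<close>)

lemma theta_plus_cong:
  assumes "open U" "\<And>x. x \<in> U \<Longrightarrow> f x = g x" "t \<in> U"
  shows "theta_plus a f t = theta_plus a g t"
  using deriv_cong_open[OF assms] assms by (simp add: theta_plus_def theta_def)

lemma Theta_cong:
  assumes "open U" "\<And>x. x \<in> U \<Longrightarrow> f x = g x" "t \<in> U"
  shows "Theta as f t = Theta as g t"
  using assms(3)
proof (induction as arbitrary: t)
  case (Cons a as)
  then show ?case using theta_plus_cong[OF assms(1), of "Theta as f" "Theta as g"] by simp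
qed (simp add: assms)

lemma deriv_theta_plus:
  assumes "open U" "f holomorphic_on U" "t \<in> U"
  shows "deriv (theta_plus a f) t = deriv f t + t * deriv (deriv f) t + a * deriv f t"
proof -
  have "deriv f holomorphic_on U" by (intro holomorphic_deriv assms)
  then have "(deriv f has_field_derivative deriv (deriv f) t) (at t)"
    by (rule holomorphic_derivI) (use assms in auto)
  moreover have "(f has_field_derivative deriv f t) (at t)"
    by (rule holomorphic_derivI) (use assms in auto)
  ultimately have "(theta_plus a f has_field_derivative
      (1 * deriv f t + deriv (deriv f) t * t) + a * deriv f t) (at t)"
    unfolding theta_plus_def theta_def
    by (auto intro!: derivative_eq_intros)
  then show ?thesis
    by (simp add: DERIV_imp_deriv mult.commute)
qed

lemma theta_plus_commute:
  assumes "open U" "f holomorphic_on U" "t \<in> U"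
  shows "theta_plus a (theta_plus b f) t = theta_plus b (theta_plus a f) t"
  using deriv_theta_plus[OF assms] by (simp add: theta_plus_def theta_def algebra_simps)

lemma Theta_move:
  assumes "open U" "f holomorphic_on U" "t \<in> U"
  shows "Theta (as @ x # bs) f t = Theta (x # as @ bs) f t"
  using assms(3)
proof (induction as arbitrary: t)
  case (Cons a as)
  have "Theta ((a # as) @ x # bs) f t = theta_plus a (Theta (x # as @ bs) f) t"
    using Cons theta_plus_cong[OF assms(1), of "Theta (as @ x # bs) f" "Theta (x # as @ bs) f"]
    by simp
  also have "\<dots> = Theta (x # (a # as) @ bs) f t"
    using theta_plus_commute[OF assms(1) Theta_holomorphic[OF assms(1,2)] Cons.prems, of a x "as @ bs"]
    by simp
  finally show ?case .
qed simp

text \<open>Only the multiset of shifts matters, hence an exchange may take its factor from any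
  position of the list.\<close>

lemma Theta_perm:
  assumes "open U" "f holomorphic_on U" "t \<in> U" "mset as = mset bs"
  shows "Theta as f t = Theta bs f t"
  using assms(3,4)
proof (induction as arbitrary: t bs)
  case (Cons a as)
  then have "a \<in> set bs" by (metis list.set_intros(1) set_mset_mset)
  then obtain b1 b2 where bs: "bs = b1 @ a # b2" by (meson split_list)
  with Cons have "mset as = mset (b1 @ b2)" by simp
  with Cons have "\<And>t. t \<in> U \<Longrightarrow> Theta as f t = Theta (b1 @ b2) f t" by blast
  from theta_plus_cong[OF assms(1) this Cons.prems(1)]
  have "Theta (a # as) f t = Theta (a # b1 @ b2) f t" by simp
  then show ?case
    using Theta_move[OF assms(1,2) Cons.prems(1), of b1 a b2] by (simp only: bs)
qed simp

text \<open>Meant for the boundary sums, whose coefficients are indicators of end points.\<close>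

lemma Theta_sum:
  assumes "open U" "finite J" "\<And>j. j \<in> J \<Longrightarrow> f j holomorphic_on U" "t \<in> U"
  shows "Theta as (\<lambda>t. \<Sum>j\<in>J. c j * f j t) t = (\<Sum>j\<in>J. c j * Theta as (f j) t)"
  using assms(4)
proof (induction as arbitrary: t)
  case (Cons a as)
  have d: "((\<lambda>t. \<Sum>j\<in>J. c j * Theta as (f j) t) has_field_derivative
     (\<Sum>j\<in>J. c j * deriv (Theta as (f j)) t)) (at t)"
  proof (intro DERIV_sum DERIV_cmult)
    fix j assume "j \<in> J"
    show "(Theta as (f j) has_field_derivative deriv (Theta as (f j)) t) (at t)"
      by (rule holomorphic_derivI[of _ U]) (use assms Cons \<open>j \<in> J\<close> Theta_holomorphic in auto)
  qed
  have "Theta (a # as) (\<lambda>t. \<Sum>j\<in>J. c j * f j t) t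
      = theta_plus a (\<lambda>t. \<Sum>j\<in>J. c j * Theta as (f j) t) t"
    using theta_plus_cong[OF assms(1), of "Theta as (\<lambda>t. \<Sum>j\<in>J. c j * f j t)"] Cons by simp
  also have "\<dots> = (\<Sum>j\<in>J. c j * Theta (a # as) (f j) t)"
    using DERIV_imp_deriv[OF d]
    by (simp add: theta_plus_def theta_def sum_distrib_left sum.distrib algebra_simps)
  finally show ?case .
qed simp

text \<open>\<theta> is invariant under scaling of the variable. Over a fixed base point a fibre
  period is a function of a multiple of \<open>t\<close>, so its equation can be read off from that
  function.\<close>

lemma Theta_rescale:
  assumes "open D" "f holomorphic_on D" "c * t \<in> D"
  shows "Theta as (\<lambda>t. r * f (c * t)) t = r * Theta as f (c * t)"
  using assms(3)
proof (induction as arbitrary: t)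
  case (Cons a as)
  define U where "U = (\<lambda>t. c * t) -` D"
  have U: "open U" "t \<in> U"
    using assms Cons by (auto simp: U_def intro!: open_vimage continuous_intros)
  have "Theta (a # as) (\<lambda>t. r * f (c * t)) t = theta_plus a (\<lambda>t. r * Theta as f (c * t)) t"
    using theta_plus_cong[OF U(1) _ U(2), of "Theta as (\<lambda>t. r * f (c * t))"] Cons.IH
    by (simp add: U_def)
  moreover have "((\<lambda>t. r * Theta as f (c * t)) has_field_derivative
      r * (deriv (Theta as f) (c * t) * c)) (at t)"
  proof -
    have "(Theta as f has_field_derivative deriv (Theta as f) (c * t)) (at (c * t))"
      by (rule holomorphic_derivI[of _ D]) (use assms Cons Theta_holomorphic in auto)
    then show ?thesis
      by (auto intro!: derivative_eq_intros DERIV_chain2[where f = "Theta as f"])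
  qed
  ultimately show ?case
    by (simp add: theta_plus_def theta_def DERIV_imp_deriv algebra_simps)
qed simp

lemma funpow_theta: "(theta ^^ n) f = Theta (replicate n 0) f"
  by (induction n) (simp_all add: theta_plus_0)

lemma PF_eq_Theta: "PF p q f t = Theta [0, 0, 0, 0] f t - t * Theta [p, q, 1 - q, 1 - p] f t"
  by (simp add: PF_def funpow_theta theta_plus_0 numeral_eq_Suc)

section \<open>Path integrals depending holomorphically on a parameter\<close>

text \<open>A piecewise \<open>C\<^sup>1\<close> path may have an unbounded derivative near the exceptional points, so
  differentiation under the integral sign is not available directly. Where the integrand is a
  holomorphic function of the point on the path, the path can be replaced by a segment.\<close>

definition holo_family :: "complex set \<Rightarrow> (real \<Rightarrow> complex) \<Rightarrow> (complex \<Rightarrow> real \<Rightarrow> complex)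
    \<Rightarrow> (complex \<Rightarrow> real \<Rightarrow> complex) \<Rightarrow> bool" where
  "holo_family U \<gamma> h h' \<longleftrightarrow> (\<forall>t0\<in>U. \<forall>s0\<in>{0..1}. \<exists>T X \<delta> H H'.
     open T \<and> t0 \<in> T \<and> open X \<and> \<gamma> s0 \<in> X \<and> \<delta> > 0 \<and>
     (\<forall>t\<in>T. H t holomorphic_on X \<and> H' t holomorphic_on X) \<and>
     (\<forall>x\<in>X. \<forall>t\<in>T. ((\<lambda>t. H t x) has_field_derivative H' t x) (at t)) \<and>
     continuous_on (T \<times> X) (\<lambda>(t, x). H' t x) \<and>
     (\<forall>s\<in>{0..1}. \<bar>s - s0\<bar> < \<delta> \<longrightarrow> (\<forall>t\<in>T. h t s = H t (\<gamma> s) \<and> h' t s = H' t (\<gamma> s))))"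

abbreviation velocity :: "(real \<Rightarrow> complex) \<Rightarrow> real \<Rightarrow> complex" where
  "velocity \<gamma> s \<equiv> vector_derivative \<gamma> (at s within {0..1})"

lemma valid_path_near:
  fixes \<gamma> :: "real \<Rightarrow> complex"
  assumes "valid_path \<gamma>" "s0 \<in> {0..1}" "open X" "\<gamma> s0 \<in> X"
  obtains \<delta> where "\<delta> > 0" "\<And>s. \<lbrakk>s \<in> {0..1}; \<bar>s - s0\<bar> < \<delta>\<rbrakk> \<Longrightarrow> \<gamma> s \<in> X"
proof -
  have "continuous_on {0..1} \<gamma>"
    using assms(1) by (simp add: valid_path_def piecewise_C1_differentiable_on_def)
  moreover obtain e where "e > 0" "ball (\<gamma> s0) e \<subseteq> X" using assms(3,4) open_contains_ball by blast
  ultimately obtain d where "d > 0" "\<And>s. s \<in> {0..1} \<Longrightarrow> dist s s0 < d \<Longrightarrow> dist (\<gamma> s) (\<gamma> s0) < e"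
    using assms(2) unfolding continuous_on_iff by blast
  with \<open>ball (\<gamma> s0) e \<subseteq> X\<close> show ?thesis
    by (intro that[of d]) (auto simp: dist_commute dist_real_def)
qed

lemma has_integral_primitive_subinterval:
  fixes f :: "complex \<Rightarrow> complex"
  assumes "valid_path \<gamma>" "0 \<le> a" "a \<le> b" "b \<le> 1"
    "\<And>x. x \<in> X \<Longrightarrow> (A has_field_derivative f x) (at x within X)"
    "\<And>s. s \<in> {a..b} \<Longrightarrow> \<gamma> s \<in> X"
  shows "((\<lambda>s. f (\<gamma> s) * velocity \<gamma> s) has_integral
           A (\<gamma> b) - A (\<gamma> a)) {a..b}"
proof -
  have "\<gamma> piecewise_differentiable_on {a..b}"
    using assms(1-4) piecewise_differentiable_on_subset[of \<gamma> "{0..1}" "{a..b}"]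
      piecewise_C1_imp_differentiable[of \<gamma> "{0..1}"]
    unfolding valid_path_def by auto
  then have *: "((\<lambda>s. f (\<gamma> s) * vector_derivative \<gamma> (at s within {a..b})) has_integral
           A (\<gamma> b) - A (\<gamma> a)) {a..b}"
    using contour_integral_primitive_lemma[of a b X A f \<gamma>] assms by blast
  show ?thesis
  \<comment> \<open>Derivatives within \<open>{0..1}\<close> and within \<open>{a..b}\<close> can
    differ only at the two end points.\<close>
  proof (rule has_integral_spike_finite[OF _ _ *])
    fix s assume "s \<in> {a..b} - {a, b}"
    then have "a < s" "s < b" by auto
    then show "f (\<gamma> s) * velocity \<gamma> s
        = f (\<gamma> s) * vector_derivative \<gamma> (at s within {a..b})"
      using assms by (simp add: at_within_Icc_at)
  qed simp
qed

text \<open>On a short piece the integrand has a primitive on a ball, so the integral over the path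
  equals the integral over its chord. The chord has constant velocity and the Leibniz rule applies
  to it. Bolzano's bisection lemma assembles the short pieces.\<close>

theorem holo_family_deriv:
  assumes "valid_path \<gamma>" and fam: "holo_family U \<gamma> h h'" and t0: "t0 \<in> U"
  shows "(\<lambda>s. h t0 s * velocity \<gamma> s) integrable_on {0..1}"
    and "(\<lambda>s. h' t0 s * velocity \<gamma> s) integrable_on {0..1}"
    and "((\<lambda>t. integral {0..1} (\<lambda>s. h t s * velocity \<gamma> s))
       has_field_derivative
       integral {0..1} (\<lambda>s. h' t0 s * velocity \<gamma> s)) (at t0)"
proof -
  let ?g = "\<lambda>s. velocity \<gamma> s"
  \<comment> \<open>Integrability is carried along for all \<open>t\<close> in a neighbourhood of
    \<open>t0\<close>: splitting the integral at an intermediate point must hold near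
    \<open>t0\<close> before the derivatives can be added.\<close>
  define P where "P a b \<longleftrightarrow> 0 \<le> a \<and> a \<le> b \<and> b \<le> 1 \<longrightarrow>
     (\<lambda>s. h' t0 s * ?g s) integrable_on {a..b} \<and>
     (\<exists>T. open T \<and> t0 \<in> T \<and> (\<forall>t\<in>T. (\<lambda>s. h t s * ?g s) integrable_on {a..b})) \<and>
     ((\<lambda>t. integral {a..b} (\<lambda>s. h t s * ?g s)) has_field_derivative
        integral {a..b} (\<lambda>s. h' t0 s * ?g s)) (at t0)" for a b
  have "P 0 1"
  proof (rule Bolzano[of 0 1])
    fix a b c assume P: "P a b" "P b c" and ab: "a \<le> b" "b \<le> (c::real)"
    show "P a c"
      unfolding P_def
    proof (intro impI)
      assume ac: "0 \<le> a \<and> a \<le> c \<and> c \<le> 1"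
      from P(1) ac ab obtain T1 where 1: "(\<lambda>s. h' t0 s * ?g s) integrable_on {a..b}"
        "open T1" "t0 \<in> T1" "\<forall>t\<in>T1. (\<lambda>s. h t s * ?g s) integrable_on {a..b}"
        "((\<lambda>t. integral {a..b} (\<lambda>s. h t s * ?g s)) has_field_derivative
        integral {a..b} (\<lambda>s. h' t0 s * ?g s)) (at t0)"
        unfolding P_def by force
      from P(2) ac ab obtain T2 where 2: "(\<lambda>s. h' t0 s * ?g s) integrable_on {b..c}"
        "open T2" "t0 \<in> T2" "\<forall>t\<in>T2. (\<lambda>s. h t s * ?g s) integrable_on {b..c}"
        "((\<lambda>t. integral {b..c} (\<lambda>s. h t s * ?g s)) has_field_derivative
        integral {b..c} (\<lambda>s. h' t0 s * ?g s)) (at t0)"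
        unfolding P_def by force
      have i: "(\<lambda>s. h t s * ?g s) integrable_on {a..c}" if "t \<in> T1 \<inter> T2" for t
        using 1 2 that ab by (blast intro: Henstock_Kurzweil_Integration.integrable_combine)
      have i': "(\<lambda>s. h' t0 s * ?g s) integrable_on {a..c}"
        using 1 2 ab by (blast intro: Henstock_Kurzweil_Integration.integrable_combine)
      have "((\<lambda>t. integral {a..b} (\<lambda>s. h t s * ?g s) + integral {b..c} (\<lambda>s. h t s * ?g s))
          has_field_derivative integral {a..b} (\<lambda>s. h' t0 s * ?g s)
            + integral {b..c} (\<lambda>s. h' t0 s * ?g s)) (at t0)"
        by (intro DERIV_add 1 2)
      also have "integral {a..b} (\<lambda>s. h' t0 s * ?g s) + integral {b..c} (\<lambda>s. h' t0 s * ?g s)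
         = integral {a..c} (\<lambda>s. h' t0 s * ?g s)"
        using i' ab by (intro Henstock_Kurzweil_Integration.integral_combine)
      finally have "((\<lambda>t. integral {a..c} (\<lambda>s. h t s * ?g s)) has_field_derivative
          integral {a..c} (\<lambda>s. h' t0 s * ?g s)) (at t0)"
        by (rule has_field_derivative_transform_within_open[where S = "T1 \<inter> T2"])
          (use 1 2 i ab in \<open>auto intro!: Henstock_Kurzweil_Integration.integral_combine\<close>)
      then show "(\<lambda>s. h' t0 s * ?g s) integrable_on {a..c} \<and>
        (\<exists>T. open T \<and> t0 \<in> T \<and> (\<forall>t\<in>T. (\<lambda>s. h t s * ?g s) integrable_on {a..c})) \<and>
        ((\<lambda>t. integral {a..c} (\<lambda>s. h t s * ?g s)) has_field_derivative
        integral {a..c} (\<lambda>s. h' t0 s * ?g s)) (at t0)"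
        using i i' 1 2 by (intro conjI exI[of _ "T1 \<inter> T2"]) auto
    qed
  next
    fix s0 :: real assume "0 \<le> s0" "s0 \<le> 1"
    then have "s0 \<in> {0..1}" by simp
    from fam[unfolded holo_family_def, rule_format, OF t0 this]
    obtain T X \<delta>1 H H' where loc: "open T" "t0 \<in> T" "open X" "\<gamma> s0 \<in> X" "\<delta>1 > 0"
      "\<forall>t\<in>T. H t holomorphic_on X \<and> H' t holomorphic_on X"
      "\<forall>x\<in>X. \<forall>t\<in>T. ((\<lambda>t. H t x) has_field_derivative H' t x) (at t)"
      "continuous_on (T \<times> X) (\<lambda>(t, x). H' t x)"
      "\<forall>s\<in>{0..1}. \<bar>s - s0\<bar> < \<delta>1 \<longrightarrow> (\<forall>t\<in>T. h t s = H t (\<gamma> s) \<and> h' t s = H' t (\<gamma> s))"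
      by (elim exE conjE)
    have loc6: "H t holomorphic_on X" "H' t holomorphic_on X" if "t \<in> T" for t
      using loc(6) that by auto
    have loc10: "h t s = H t (\<gamma> s)" "h' t s = H' t (\<gamma> s)" if "s \<in> {0..1}" "\<bar>s - s0\<bar> < \<delta>1" "t \<in> T" for s t
      using loc(9) that by auto
    obtain \<epsilon> where \<epsilon>: "\<epsilon> > 0" "ball (\<gamma> s0) \<epsilon> \<subseteq> X" using loc open_contains_ball by blast
    obtain e1 where e1: "e1 > 0" "ball t0 e1 \<subseteq> T" using loc open_contains_ball by blast
    obtain \<delta>2 where \<delta>2: "\<delta>2 > 0" "\<And>s. s \<in> {0..1} \<Longrightarrow> \<bar>s - s0\<bar> < \<delta>2 \<Longrightarrow> \<gamma> s \<in> ball (\<gamma> s0) \<epsilon>"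
      using valid_path_near[OF assms(1) \<open>s0 \<in> {0..1}\<close> open_ball] \<epsilon>(1) by (metis centre_in_ball)
    define \<delta> where "\<delta> = min \<delta>1 \<delta>2"
    define B where "B = ball (\<gamma> s0) \<epsilon>"
    define T1 where "T1 = ball t0 e1"
    have BX: "B \<subseteq> X" "convex B" "open B" and T1: "T1 \<subseteq> T" "open T1" "t0 \<in> T1" "convex T1"
      using \<epsilon> e1 by (auto simp: B_def T1_def)
    have "P a b" if ab: "a \<le> s0" "s0 \<le> b" "b - a < \<delta>" for a b
      unfolding P_def
    proof (intro impI)
      assume ab1: "0 \<le> a \<and> a \<le> b \<and> b \<le> 1"
      have near: "\<bar>s - s0\<bar> < \<delta>1" "\<bar>s - s0\<bar> < \<delta>2" "s \<in> {0..1}" if "s \<in> {a..b}" for s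
        using ab ab1 that by (auto simp: \<delta>_def)
      have inB: "\<gamma> s \<in> B" if "s \<in> {a..b}" for s
        using \<delta>2(2)[OF near(3)[OF that] near(2)[OF that]] by (simp add: B_def)
      have lp: "linepath (\<gamma> a) (\<gamma> b) s \<in> B" if "s \<in> {0..1}" for s
      proof -
        have "linepath (\<gamma> a) (\<gamma> b) s \<in> closed_segment (\<gamma> a) (\<gamma> b)"
          using that by (simp add: linepath_in_path)
        moreover have "closed_segment (\<gamma> a) (\<gamma> b) \<subseteq> B"
          using inB[of a] inB[of b] ab1 BX by (simp add: closed_segment_subset)
        ultimately show ?thesis by blast
      qed
      have key: "((\<lambda>s. F (\<gamma> s) * ?g s) has_integral
          integral {0..1} (\<lambda>s. F (linepath (\<gamma> a) (\<gamma> b) s) * (\<gamma> b - \<gamma> a))) {a..b}"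
        and key2: "(\<lambda>s. F (linepath (\<gamma> a) (\<gamma> b) s) * (\<gamma> b - \<gamma> a)) integrable_on {0..1}"
        if F: "F holomorphic_on X" for F
      proof -
        obtain A where A: "\<And>x. x \<in> B \<Longrightarrow> (A has_field_derivative F x) (at x within B)"
          using holomorphic_convex_primitive'[OF BX(2,3)] F holomorphic_on_subset BX(1) by metis
        have 1: "((\<lambda>s. F (\<gamma> s) * ?g s) has_integral A (\<gamma> b) - A (\<gamma> a)) {a..b}"
          by (rule has_integral_primitive_subinterval[OF assms(1), where X = B]) (use ab1 A inB in auto)
        have "(F has_contour_integral A (pathfinish (linepath (\<gamma> a) (\<gamma> b)))
            - A (pathstart (linepath (\<gamma> a) (\<gamma> b)))) (linepath (\<gamma> a) (\<gamma> b))"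
          by (rule contour_integral_primitive[of B]) (use A lp in \<open>auto simp: path_image_def\<close>)
        then have "((\<lambda>s. F (linepath (\<gamma> a) (\<gamma> b) s) * (\<gamma> b - \<gamma> a)) has_integral A (\<gamma> b) - A (\<gamma> a)) {0..1}"
          by (simp add: has_contour_integral_linepath)
        note I = this
        from 1 show "((\<lambda>s. F (\<gamma> s) * ?g s) has_integral
          integral {0..1} (\<lambda>s. F (linepath (\<gamma> a) (\<gamma> b) s) * (\<gamma> b - \<gamma> a))) {a..b}"
          by (simp only: integral_unique[OF I])
        show "(\<lambda>s. F (linepath (\<gamma> a) (\<gamma> b) s) * (\<gamma> b - \<gamma> a)) integrable_on {0..1}"
          using I by (rule has_integral_integrable)
      qed
      have h: "((\<lambda>s. h t s * ?g s) has_integral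
          integral {0..1} (\<lambda>s. H t (linepath (\<gamma> a) (\<gamma> b) s) * (\<gamma> b - \<gamma> a))) {a..b}"
        if "t \<in> T" for t
        using key[OF loc6(1)[OF that]] loc10 near that
        by (subst has_integral_cong[where g = "\<lambda>s. H t (\<gamma> s) * ?g s"]) auto
      have h': "((\<lambda>s. h' t s * ?g s) has_integral
          integral {0..1} (\<lambda>s. H' t (linepath (\<gamma> a) (\<gamma> b) s) * (\<gamma> b - \<gamma> a))) {a..b}"
        if "t \<in> T" for t
        using key[OF loc6(2)[OF that]] loc10 near that
        by (subst has_integral_cong[where g = "\<lambda>s. H' t (\<gamma> s) * ?g s"]) auto
      have "((\<lambda>t. integral (cbox 0 1) (\<lambda>s. H t (linepath (\<gamma> a) (\<gamma> b) s) * (\<gamma> b - \<gamma> a)))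
          has_field_derivative
          integral (cbox 0 1) (\<lambda>s. H' t0 (linepath (\<gamma> a) (\<gamma> b) s) * (\<gamma> b - \<gamma> a))) (at t0 within T1)"
      proof (rule leibniz_rule_field_derivative)
        fix t s assume ts: "t \<in> T1" "s \<in> cbox (0::real) 1"
        have "((\<lambda>t. H t (linepath (\<gamma> a) (\<gamma> b) s)) has_field_derivative
            H' t (linepath (\<gamma> a) (\<gamma> b) s)) (at t within T1)"
          by (rule has_field_derivative_at_within, rule loc(7)[rule_format])
            (use subsetD[OF BX(1) lp[of s]] subsetD[OF T1(1) ts(1)] ts(2) in simp_all)
        then show "((\<lambda>t. H t (linepath (\<gamma> a) (\<gamma> b) s) * (\<gamma> b - \<gamma> a)) has_field_derivative
            H' t (linepath (\<gamma> a) (\<gamma> b) s) * (\<gamma> b - \<gamma> a)) (at t within T1)"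
          by (intro DERIV_cmult_right)
      next
        fix t assume "t \<in> T1"
        then show "(\<lambda>s. H t (linepath (\<gamma> a) (\<gamma> b) s) * (\<gamma> b - \<gamma> a)) integrable_on cbox 0 1"
          using key2[OF loc6(1)] T1 by (auto simp: subset_iff)
      next
        have "continuous_on (T1 \<times> {0..1}) (\<lambda>p. (\<lambda>(t, x). H' t x) (fst p, linepath (\<gamma> a) (\<gamma> b) (snd p)))"
          by (rule continuous_on_compose2[OF loc(8)])
            (use lp BX T1 in \<open>auto intro!: continuous_intros continuous_on_compose2[OF continuous_on_linepath]\<close>)
        then show "continuous_on (T1 \<times> cbox 0 1) (\<lambda>(t, s). H' t (linepath (\<gamma> a) (\<gamma> b) s) * (\<gamma> b - \<gamma> a))"
          by (auto intro!: continuous_intros simp: case_prod_beta)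
      qed (use T1 in auto)
      then have "((\<lambda>t. integral {0..1} (\<lambda>s. H t (linepath (\<gamma> a) (\<gamma> b) s) * (\<gamma> b - \<gamma> a)))
          has_field_derivative integral {a..b} (\<lambda>s. h' t0 s * ?g s)) (at t0)"
        using T1 h'[OF loc(2)] at_within_open[OF T1(3,2)] by (simp add: integral_unique)
      moreover have "integral {0..1} (\<lambda>s. H t (linepath (\<gamma> a) (\<gamma> b) s) * (\<gamma> b - \<gamma> a))
          = integral {a..b} (\<lambda>s. h t s * ?g s)" if "t \<in> T" for t
        by (rule integral_unique[OF h[OF that], symmetric])
      ultimately have "((\<lambda>t. integral {a..b} (\<lambda>s. h t s * ?g s))
          has_field_derivative integral {a..b} (\<lambda>s. h' t0 s * ?g s)) (at t0)"
        by (rule has_field_derivative_transform_within_open[OF _ loc(1,2)])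
      then show "(\<lambda>s. h' t0 s * ?g s) integrable_on {a..b} \<and>
        (\<exists>T. open T \<and> t0 \<in> T \<and> (\<forall>t\<in>T. (\<lambda>s. h t s * ?g s) integrable_on {a..b})) \<and>
        ((\<lambda>t. integral {a..b} (\<lambda>s. h t s * ?g s)) has_field_derivative
        integral {a..b} (\<lambda>s. h' t0 s * ?g s)) (at t0)"
        using h h' loc by (intro conjI exI[of _ T]) (auto simp: integrable_on_def)
    qed
    moreover have "\<delta> > 0" using loc \<delta>2 by (simp add: \<delta>_def)
    ultimately show "\<exists>d>0. \<forall>a b. a \<le> s0 \<and> s0 \<le> b \<and> b - a < d \<longrightarrow> P a b" by blast
  qed simp
  then show "(\<lambda>s. h t0 s * ?g s) integrable_on {0..1}"
    "(\<lambda>s. h' t0 s * ?g s) integrable_on {0..1}"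
    "((\<lambda>t. integral {0..1} (\<lambda>s. h t s * ?g s)) has_field_derivative
       integral {0..1} (\<lambda>s. h' t0 s * ?g s)) (at t0)"
    by (auto simp: P_def)
qed

text \<open>The primitive is a function \<open>g\<close> of the time only. Its local expressions
  \<open>G\<close> are branches that need not agree where the path returns to a point, so there is
  no primitive on a domain of the plane; the differences telescope over short intervals
  instead.\<close>

lemma path_integral_exact:
  fixes \<gamma> :: "real \<Rightarrow> complex"
  assumes "valid_path \<gamma>"
    and loc: "\<And>s0. s0 \<in> {0..1} \<Longrightarrow> \<exists>X \<delta> G f. open X \<and> \<gamma> s0 \<in> X \<and> \<delta> > 0 \<and>
      (\<forall>x\<in>X. (G has_field_derivative f x) (at x)) \<and>
      (\<forall>s\<in>{0..1}. \<bar>s - s0\<bar> < \<delta> \<longrightarrow> g s = G (\<gamma> s) \<and> F s = f (\<gamma> s))"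
  shows "((\<lambda>s. F s * velocity \<gamma> s) has_integral g 1 - g 0) {0..1}"
proof -
  let ?g = "\<lambda>s. velocity \<gamma> s"
  define P where "P a b \<longleftrightarrow> (0 \<le> a \<and> a \<le> b \<and> b \<le> 1 \<longrightarrow>
     ((\<lambda>s. F s * ?g s) has_integral g b - g a) {a..b})" for a b :: real
  have "P 0 1"
  proof (rule Bolzano[of 0 1])
    fix a b c assume P: "P a b" "P b c" and ab: "a \<le> b" "b \<le> (c::real)"
    show "P a c"
      unfolding P_def
    proof (intro impI)
      assume "0 \<le> a \<and> a \<le> c \<and> c \<le> 1"
      then have "((\<lambda>s. F s * ?g s) has_integral (g b - g a)) {a..b}"
        "((\<lambda>s. F s * ?g s) has_integral (g c - g b)) {b..c}"
        using P ab unfolding P_def by auto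
      then have "((\<lambda>s. F s * ?g s) has_integral (g b - g a) + (g c - g b)) {a..c}"
        using ab by (intro Henstock_Kurzweil_Integration.has_integral_combine[of a b c])
      then show "((\<lambda>s. F s * ?g s) has_integral g c - g a) {a..c}" by (simp add: algebra_simps)
    qed
  next
    fix s0 :: real assume s0: "0 \<le> s0" "s0 \<le> 1"
    then have "s0 \<in> {0..1}" by simp
    from loc[OF this] obtain X \<delta>1 G f where X: "open X" "\<gamma> s0 \<in> X" "\<delta>1 > 0"
      "\<forall>x\<in>X. (G has_field_derivative f x) (at x)"
      "\<forall>s\<in>{0..1}. \<bar>s - s0\<bar> < \<delta>1 \<longrightarrow> g s = G (\<gamma> s) \<and> F s = f (\<gamma> s)"
      by (elim exE conjE)
    obtain \<delta>2 where \<delta>2: "\<delta>2 > 0" "\<And>s. s \<in> {0..1} \<Longrightarrow> \<bar>s - s0\<bar> < \<delta>2 \<Longrightarrow> \<gamma> s \<in> X"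
      using valid_path_near[OF assms(1) \<open>s0 \<in> {0..1}\<close> X(1,2)] by metis
    have "P a b" if ab: "a \<le> s0" "s0 \<le> b" "b - a < min \<delta>1 \<delta>2" for a b
      unfolding P_def
    proof (intro impI)
      assume ab1: "0 \<le> a \<and> a \<le> b \<and> b \<le> 1"
      have near: "\<bar>s - s0\<bar> < \<delta>1" "\<bar>s - s0\<bar> < \<delta>2" "s \<in> {0..1}" if "s \<in> {a..b}" for s
        using ab ab1 that by auto
      have inX: "\<gamma> s \<in> X" if "s \<in> {a..b}" for s
        by (rule \<delta>2(2)[OF near(3)[OF that] near(2)[OF that]])
      have "((\<lambda>s. f (\<gamma> s) * ?g s) has_integral G (\<gamma> b) - G (\<gamma> a)) {a..b}"
        by (rule has_integral_primitive_subinterval[OF assms(1), where X = X])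
          (use ab1 inX has_field_derivative_at_within[OF X(4)[rule_format]] in auto)
      moreover have "G (\<gamma> b) = g b" "G (\<gamma> a) = g a" using X(5) near ab1 by auto
      moreover have "((\<lambda>s. F s * ?g s) has_integral I) {a..b}
          \<longleftrightarrow> ((\<lambda>s. f (\<gamma> s) * ?g s) has_integral I) {a..b}" for I
        by (rule has_integral_cong) (use X(5) near in auto)
      ultimately show "((\<lambda>s. F s * ?g s) has_integral g b - g a) {a..b}" by simp
    qed
    moreover have "min \<delta>1 \<delta>2 > 0" using X \<delta>2 by simp
    ultimately show "\<exists>d>0. \<forall>a b. a \<le> s0 \<and> s0 \<le> b \<and> b - a < d \<longrightarrow> P a b" by blast
  qed simp
  then show ?thesis by (simp add: P_def)
qed

section \<open>Twisting a family of periods\<close>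

definition wt :: "nat \<Rightarrow> nat \<Rightarrow> complex \<Rightarrow> complex" where
  "wt a b x = 1 / (x ^ a * (x + 1) ^ b)"

lemma wt_0 [simp]: "wt 0 0 x = 1"
  by (simp add: wt_def)

lemma wt_Suc:
  assumes "x \<noteq> 0" "x + 1 \<noteq> 0"
  shows "wt a b x = x * wt (Suc a) b x" "wt a b x = (x + 1) * wt a (Suc b) x"
proof -
  have "1 / (x ^ a * y ^ b) = x * (1 / (x ^ Suc a * y ^ b))"
    "1 / (x ^ a * y ^ b) = y * (1 / (x ^ a * y ^ Suc b))" if "y \<noteq> 0" for y
    using assms(1) that by simp_all
  then show "wt a b x = x * wt (Suc a) b x" "wt a b x = (x + 1) * wt a (Suc b) x"
    using assms(2) unfolding wt_def by blast+
qed

lemma has_field_derivative_inverse_power: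
  fixes g :: "complex \<Rightarrow> complex"
  assumes "(g has_field_derivative 1) (at x)" "g x \<noteq> 0"
  shows "((\<lambda>x. inverse (g x ^ a)) has_field_derivative - (of_nat a / g x) * inverse (g x ^ a)) (at x)"
proof (induction a)
  case (Suc a)
  have "((\<lambda>x. inverse (g x)) has_field_derivative - (1 / g x) * inverse (g x)) (at x)"
    using assms by (auto intro!: derivative_eq_intros simp: field_simps)
  from DERIV_mult[OF this Suc.IH] show ?case
    by (simp add: algebra_simps add_divide_distrib)
qed simp

lemma wt_deriv:
  assumes "x \<noteq> 0" "x + 1 \<noteq> 0"
  shows "(wt a b has_field_derivative - (of_nat a / x + of_nat b / (x + 1)) * wt a b x) (at x)"
proof -
  have "((\<lambda>x. inverse (x ^ a)) has_field_derivative - (of_nat a / x) * inverse (x ^ a)) (at x)"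
    using has_field_derivative_inverse_power[of "\<lambda>x. x" x a] assms by simp
  moreover have "((\<lambda>x. x + 1) has_field_derivative 1) (at x)"
    by (auto intro!: derivative_eq_intros)
  then have "((\<lambda>x. inverse ((x + 1) ^ b)) has_field_derivative
      - (of_nat b / (x + 1)) * inverse ((x + 1) ^ b)) (at x)"
    using has_field_derivative_inverse_power[of "\<lambda>x. x + 1" x b] assms by simp
  ultimately have "((\<lambda>x. inverse (x ^ a) * inverse ((x + 1) ^ b)) has_field_derivative
      - (of_nat a / x) * inverse (x ^ a) * inverse ((x + 1) ^ b)
      + - (of_nat b / (x + 1)) * inverse ((x + 1) ^ b) * inverse (x ^ a)) (at x)"
    by (rule DERIV_mult)
  then have "((\<lambda>x. inverse (x ^ a) * inverse ((x + 1) ^ b)) has_field_derivative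
      - (of_nat a / x + of_nat b / (x + 1)) * (inverse (x ^ a) * inverse ((x + 1) ^ b))) (at x)"
    by (rule DERIV_cong) (simp add: algebra_simps)
  moreover have "wt a b = (\<lambda>x. inverse (x ^ a) * inverse ((x + 1) ^ b))"
    by (simp add: wt_def fun_eq_iff field_simps)
  ultimately show ?thesis by simp
qed

text \<open>Locally, the fibre periods \<open>h t s\<close> over the point \<open>v = c s\<close> of the base vanish
  or are of the form \<open>r v \<cdot> \<phi> (C t / (v\<^sup>k (v + 1)\<^sup>l))\<close>, where \<open>r\<close> is a branch of
  \<open>1 / (v (v + 1) powr \<beta>)\<close> up to a constant and \<open>\<phi>\<close> is annihilated by
  \<open>\<theta>\<^sup>r - x \<Prod>(\<theta> + a)\<close>, with \<open>a\<close> ranging over the list \<open>Q\<close> of length \<open>r\<close>.\<close>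

definition twist_at :: "nat \<Rightarrow> nat \<Rightarrow> complex \<Rightarrow> complex \<Rightarrow> complex list
    \<Rightarrow> (real \<Rightarrow> complex) \<Rightarrow> (complex \<Rightarrow> real \<Rightarrow> complex) \<Rightarrow> complex \<Rightarrow> real \<Rightarrow> bool" where
  "twist_at k l \<beta> C Q c h t0 s0 \<longleftrightarrow> (\<exists>T \<delta>. open T \<and> t0 \<in> T \<and> \<delta> > 0 \<and>
     ((\<forall>t\<in>T. \<forall>s\<in>{0..1}. \<bar>s - s0\<bar> < \<delta> \<longrightarrow> h t s = 0) \<or>
      (\<exists>V r D \<phi>. open V \<and> c s0 \<in> V \<and> 0 \<notin> V \<and> -1 \<notin> V \<and>
         (\<forall>v\<in>V. (r has_field_derivative - (1 / v + \<beta> / (v + 1)) * r v) (at v)) \<and>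
         open D \<and> \<phi> holomorphic_on D \<and>
         (\<forall>x\<in>D. Theta (replicate (length Q) 0) \<phi> x = x * Theta Q \<phi> x) \<and>
         (\<forall>t\<in>T. \<forall>v\<in>V. C * wt k l v * t \<in> D) \<and>
         (\<forall>t\<in>T. \<forall>s\<in>{0..1}. \<bar>s - s0\<bar> < \<delta> \<longrightarrow>
            c s \<in> V \<and> h t s = r (c s) * \<phi> (C * wt k l (c s) * t)))))"

lemma twist_at_zero:
  assumes "open T" "t0 \<in> T" "\<delta> > 0"
    "\<And>t s. \<lbrakk>t \<in> T; s \<in> {0..1}; \<bar>s - s0\<bar> < \<delta>\<rbrakk> \<Longrightarrow> h t s = 0"
  shows "twist_at k l \<beta> C Q c h t0 s0"
  unfolding twist_at_def
  by (rule exI[of _ T], rule exI[of _ \<delta>], intro conjI disjI1 ballI impI assms)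

lemma twist_at_chart:
  assumes "open T" "t0 \<in> T" "\<delta> > 0" "open V" "c s0 \<in> V" "0 \<notin> V" "-1 \<notin> V"
    "\<And>v. v \<in> V \<Longrightarrow> (r has_field_derivative - (1 / v + \<beta> / (v + 1)) * r v) (at v)"
    "open D" "\<phi> holomorphic_on D"
    "\<And>x. x \<in> D \<Longrightarrow> Theta (replicate (length Q) 0) \<phi> x = x * Theta Q \<phi> x"
    "\<And>t v. \<lbrakk>t \<in> T; v \<in> V\<rbrakk> \<Longrightarrow> C * wt k l v * t \<in> D"
    "\<And>t s. \<lbrakk>t \<in> T; s \<in> {0..1}; \<bar>s - s0\<bar> < \<delta>\<rbrakk> \<Longrightarrow>
      c s \<in> V \<and> h t s = r (c s) * \<phi> (C * wt k l (c s) * t)"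
  shows "twist_at k l \<beta> C Q c h t0 s0"
  unfolding twist_at_def
  by (rule exI[of _ T], rule exI[of _ \<delta>], intro conjI disjI2 assms, rule exI[of _ V], rule exI[of _ r],
      rule exI[of _ D], rule exI[of _ \<phi>], intro conjI ballI impI assms)

definition twist_family :: "nat \<Rightarrow> nat \<Rightarrow> complex \<Rightarrow> complex \<Rightarrow> complex list \<Rightarrow> complex set
    \<Rightarrow> (real \<Rightarrow> complex) \<Rightarrow> (complex \<Rightarrow> real \<Rightarrow> complex) \<Rightarrow> bool" where
  "twist_family k l \<beta> C Q U c h \<longleftrightarrow> (\<forall>t0\<in>U. \<forall>s0\<in>{0..1}. twist_at k l \<beta> C Q c h t0 s0)"

text \<open>Moving \<theta> past the factor \<open>x\<close> shifts it by one. This produces the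
  \<open>1\<close> in front of \<open>Q\<close> when \<theta> is applied to the equation of the
  fibre.\<close>

lemma theta_plus_id_mult:
  assumes "open D" "f holomorphic_on D" "x \<in> D"
  shows "theta_plus 0 (\<lambda>x. x * f x) x = x * theta_plus 1 f x"
proof -
  have "(f has_field_derivative deriv f x) (at x)"
    by (rule holomorphic_derivI[of _ D]) (use assms in auto)
  then have "((\<lambda>x. x * f x) has_field_derivative 1 * f x + deriv f x * x) (at x)"
    by (auto intro!: derivative_eq_intros)
  from DERIV_imp_deriv[OF this] show ?thesis
    by (simp add: theta_plus_def theta_def algebra_simps)
qed

text \<open>One shape for both alternatives of \<open>twist_at\<close>. \<open>H as\<close>
  expresses \<open>Theta as\<close> of the fibre period through parameter and base point, and
  \<open>H'\<close> is its derivative in the parameter. The derivative in \<open>x\<close> is the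
  exact form used for integration by parts, and the recurrence for \<open>H\<close> is the fibre
  equation after one more application of \<theta>.\<close>

definition local_form :: "nat \<Rightarrow> nat \<Rightarrow> complex \<Rightarrow> complex \<Rightarrow> complex list
    \<Rightarrow> (real \<Rightarrow> complex) \<Rightarrow> (complex \<Rightarrow> real \<Rightarrow> complex) \<Rightarrow> real \<Rightarrow> complex set \<Rightarrow> real \<Rightarrow> complex set
    \<Rightarrow> (complex list \<Rightarrow> complex \<Rightarrow> complex \<Rightarrow> complex)
    \<Rightarrow> (complex list \<Rightarrow> complex \<Rightarrow> complex \<Rightarrow> complex) \<Rightarrow> bool" where
  "local_form k l \<beta> C Q c h s0 T \<delta> X H H' \<longleftrightarrow>
    (\<forall>as. \<forall>t\<in>T. \<forall>s\<in>{0..1}. \<bar>s - s0\<bar> < \<delta> \<longrightarrow> Theta as (\<lambda>t. h t s) t = H as t (c s)) \<and>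
    (\<forall>as. \<forall>t\<in>T. \<forall>x\<in>X. ((\<lambda>t. H as t x) has_field_derivative H' as t x) (at t)) \<and>
    (\<forall>a b as. \<forall>t\<in>T. (\<lambda>x. wt a b x * H as t x) holomorphic_on X) \<and>
    (\<forall>a b as. \<forall>t\<in>T. (\<lambda>x. wt a b x * H' as t x) holomorphic_on X) \<and>
    (\<forall>a b as. continuous_on (T \<times> X) (\<lambda>(t, x). wt a b x * H' as t x)) \<and>
    (\<forall>a b as. \<forall>t\<in>T. \<forall>x\<in>X.
      ((\<lambda>x. x * (x + 1) * wt a b x * H as t x) has_field_derivative
        wt a b x * (x * ((1 - of_nat b - \<beta>) * H as t x - of_nat l * H (0 # as) t x)
          - (x + 1) * (of_nat a * H as t x + of_nat k * H (0 # as) t x))) (at x)) \<and>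
    (\<forall>t\<in>T. \<forall>x\<in>X. H (replicate (Suc (length Q)) 0) t x = C * t * wt k l x * H (1 # Q) t x) \<and>
    ((\<forall>x\<in>X. x \<noteq> 0 \<and> x + 1 \<noteq> 0) \<or> (\<forall>as t x. H as t x = 0))"

lemma twist_family_local:
  assumes "twist_family k l \<beta> C Q U c h" "t0 \<in> U" "s0 \<in> {0..1}"
  obtains T \<delta> X H H' where "open T" "t0 \<in> T" "\<delta> > 0" "open X" "c s0 \<in> X"
    "local_form k l \<beta> C Q c h s0 T \<delta> X H H'"
proof -
  from assms(1)[unfolded twist_family_def twist_at_def, rule_format, OF assms(2,3)]
  obtain T \<delta> where T: "open T" "t0 \<in> T" "\<delta> > 0" and
   alt: "(\<forall>t\<in>T. \<forall>s\<in>{0..1}. \<bar>s - s0\<bar> < \<delta> \<longrightarrow> h t s = 0) \<or>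
      (\<exists>V r D \<phi>. open V \<and> c s0 \<in> V \<and> 0 \<notin> V \<and> -1 \<notin> V \<and>
         (\<forall>v\<in>V. (r has_field_derivative - (1 / v + \<beta> / (v + 1)) * r v) (at v)) \<and>
         open D \<and> \<phi> holomorphic_on D \<and>
         (\<forall>x\<in>D. Theta (replicate (length Q) 0) \<phi> x = x * Theta Q \<phi> x) \<and>
         (\<forall>t\<in>T. \<forall>v\<in>V. C * wt k l v * t \<in> D) \<and>
         (\<forall>t\<in>T. \<forall>s\<in>{0..1}. \<bar>s - s0\<bar> < \<delta> \<longrightarrow>
            c s \<in> V \<and> h t s = r (c s) * \<phi> (C * wt k l (c s) * t)))" (is "_ \<or> ?chart")
    by blast
  from alt show ?thesis
  proof
    assume z: "\<forall>t\<in>T. \<forall>s\<in>{0..1}. \<bar>s - s0\<bar> < \<delta> \<longrightarrow> h t s = 0"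
    have "Theta as (\<lambda>t. h t s) t = 0" if "t \<in> T" "s \<in> {0..1}" "\<bar>s - s0\<bar> < \<delta>" for as t s
    proof -
      have "Theta as (\<lambda>t. h t s) t = Theta as (\<lambda>t. 0) t"
        by (rule Theta_cong[OF T(1) _ that(1)]) (use z that in auto)
      also have "Theta as (\<lambda>t. 0) = (\<lambda>t. 0)"
        by (induction as) (simp_all add: theta_plus_def theta_def)
      finally show ?thesis .
    qed
    \<comment> \<open>If the period vanishes, nothing is known about \<open>c s0\<close>, which may
      be \<open>0\<close> or \<open>-1\<close>; \<open>H = 0\<close> on the whole plane still
      satisfies every clause.\<close>
    then show ?thesis
      using T by (intro that[of T \<delta> UNIV "\<lambda>_ _ _. 0" "\<lambda>_ _ _. 0"]) (auto simp: local_form_def)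
  next
    assume "?chart"
    then obtain V r D \<phi> where V: "open V" "c s0 \<in> V" "0 \<notin> V" "-1 \<notin> V"
      and r': "\<forall>v\<in>V. (r has_field_derivative - (1 / v + \<beta> / (v + 1)) * r v) (at v)"
      and D: "open D" "\<phi> holomorphic_on D"
      and ode': "\<forall>x\<in>D. Theta (replicate (length Q) 0) \<phi> x = x * Theta Q \<phi> x"
      and inD': "\<forall>t\<in>T. \<forall>v\<in>V. C * wt k l v * t \<in> D"
      and h': "\<forall>t\<in>T. \<forall>s\<in>{0..1}. \<bar>s - s0\<bar> < \<delta> \<longrightarrow>
            c s \<in> V \<and> h t s = r (c s) * \<phi> (C * wt k l (c s) * t)"
      by (elim exE conjE)
    have r: "(r has_field_derivative - (1 / v + \<beta> / (v + 1)) * r v) (at v)" if "v \<in> V" for v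
      using r' that by blast
    have ode: "Theta (replicate (length Q) 0) \<phi> x = x * Theta Q \<phi> x" if "x \<in> D" for x
      using ode' that by blast
    have inD: "C * wt k l v * t \<in> D" if "t \<in> T" "v \<in> V" for t v
      using inD' that by blast
    have hV: "c s \<in> V" and h: "h t s = r (c s) * \<phi> (C * wt k l (c s) * t)"
      if "t \<in> T" "s \<in> {0..1}" "\<bar>s - s0\<bar> < \<delta>" for t s
      using h' that by blast+
    have nz: "x \<noteq> 0" "x + 1 \<noteq> 0" if "x \<in> V" for x
      using V that by (auto simp: eq_neg_iff_add_eq_0[symmetric])
    \<comment> \<open>Over fixed \<open>x\<close> the period is \<open>r x\<close> times
      \<open>\<phi>\<close> at a multiple of \<open>t\<close>, so \<open>Theta_rescale\<close> turns
      \<theta> in \<open>t\<close> into \<theta> acting on \<open>\<phi>\<close>.\<close>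
    define H where "H as t x = r x * Theta as \<phi> (C * wt k l x * t)" for as t x
    define H' where "H' as t x = r x * (deriv (Theta as \<phi>) (C * wt k l x * t) * (C * wt k l x))" for as t x
    have Th: "Theta as \<phi> holomorphic_on D" for as
      by (rule Theta_holomorphic[OF D])
    have dTh: "(Theta as \<phi> has_field_derivative deriv (Theta as \<phi>) x) (at x)" if "x \<in> D" for as x
      by (rule holomorphic_derivI[OF Th D(1) that])
    have rh: "r holomorphic_on V"
      using r V(1) by (auto simp: holomorphic_on_open)
    have wh: "wt a b holomorphic_on V" for a b
      using wt_deriv[OF nz] V(1) by (auto simp: holomorphic_on_open)
    have comp: "(\<lambda>x. f (C * wt k l x * t)) holomorphic_on V" if "f holomorphic_on D" "t \<in> T" for f t
      by (rule holomorphic_on_compose_gen[of "\<lambda>x. C * wt k l x * t" V f D, unfolded o_def])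
        (use that inD wh in \<open>auto intro!: holomorphic_intros\<close>)
    have "local_form k l \<beta> C Q c h s0 T \<delta> V H H'"
      unfolding local_form_def
    proof (intro conjI allI ballI impI)
      fix as t s assume ts: "t \<in> T" "s \<in> {0..1}" "\<bar>s - s0\<bar> < \<delta>"
      have "Theta as (\<lambda>t. h t s) t = Theta as (\<lambda>t. r (c s) * \<phi> (C * wt k l (c s) * t)) t"
        by (rule Theta_cong[OF T(1) _ ts(1)]) (use h ts in auto)
      also have "\<dots> = H as t (c s)"
        unfolding H_def by (rule Theta_rescale[OF D inD[OF ts(1) hV[OF ts]]])
      finally show "Theta as (\<lambda>t. h t s) t = H as t (c s)" .
    next
      fix as t x assume "t \<in> T" "x \<in> V"
      then show "((\<lambda>t. H as t x) has_field_derivative H' as t x) (at t)"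
        unfolding H_def H'_def
        by (auto intro!: derivative_eq_intros DERIV_chain2[OF dTh] inD)
    next
      fix a b as t assume "t \<in> T"
      then show "(\<lambda>x. wt a b x * H as t x) holomorphic_on V"
        unfolding H_def by (intro holomorphic_intros rh wh comp Th)
    next
      fix a b as t assume "t \<in> T"
      then show "(\<lambda>x. wt a b x * H' as t x) holomorphic_on V"
        unfolding H'_def by (intro holomorphic_intros rh wh comp holomorphic_deriv[OF Th D(1)])
    next
      fix a b as
      have 1: "continuous_on (T \<times> V) (\<lambda>p. f (snd p))" if "f holomorphic_on V" for f :: "complex \<Rightarrow> complex"
        by (rule continuous_on_compose2[OF holomorphic_on_imp_continuous_on[OF that]])
          (auto intro!: continuous_intros)
      have "continuous_on (T \<times> V) (\<lambda>p. deriv (Theta as \<phi>) (C * wt k l (snd p) * fst p))"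
        by (rule continuous_on_compose2[OF holomorphic_on_imp_continuous_on[OF holomorphic_deriv[OF Th D(1)]]])
          (use inD in \<open>auto intro!: continuous_intros 1 wh holomorphic_intros\<close>)
      then show "continuous_on (T \<times> V) (\<lambda>(t, x). wt a b x * H' as t x)"
        unfolding H'_def case_prod_beta by (intro continuous_intros 1 wh rh)
    next
      fix a b as t x assume tx: "t \<in> T" "x \<in> V"
      let ?p = "C * wt k l x * t"
      have "((\<lambda>x. C * wt k l x * t) has_field_derivative
          C * (- (of_nat k / x + of_nat l / (x + 1)) * wt k l x) * t) (at x)"
        by (intro DERIV_cmult DERIV_cmult_right wt_deriv nz[OF tx(2)])
      note c = DERIV_chain2[where f = "Theta as \<phi>" and g = "\<lambda>x. C * wt k l x * t", OF dTh[OF inD[OF tx]] this]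
      have p: "((\<lambda>x. x * (x + 1)) has_field_derivative 2 * x + 1) (at x)"
        by (auto intro!: derivative_eq_intros)
      note d = DERIV_mult[OF DERIV_mult[OF p wt_deriv[OF nz[OF tx(2)]]] DERIV_mult[OF r[OF tx(2)] c]]
      have "((\<lambda>x. x * (x + 1) * wt a b x * H as t x) has_field_derivative
         ((x * (x + 1) * (- (of_nat a / x + of_nat b / (x + 1)) * wt a b x)
           + (2 * x + 1) * wt a b x) * (r x * Theta as \<phi> ?p)
         + x * (x + 1) * wt a b x * (r x * (deriv (Theta as \<phi>) ?p
             * (C * (- (of_nat k / x + of_nat l / (x + 1)) * wt k l x) * t))
           + - (1 / x + \<beta> / (x + 1)) * r x * Theta as \<phi> ?p))) (at x)"
        unfolding H_def
        by (rule DERIV_cong[OF d]) (simp add: algebra_simps)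
      also have "((x * (x + 1) * (- (of_nat a / x + of_nat b / (x + 1)) * wt a b x)
           + (2 * x + 1) * wt a b x) * (r x * Theta as \<phi> ?p)
         + x * (x + 1) * wt a b x * (r x * (deriv (Theta as \<phi>) ?p
             * (C * (- (of_nat k / x + of_nat l / (x + 1)) * wt k l x) * t))
           + - (1 / x + \<beta> / (x + 1)) * r x * Theta as \<phi> ?p))
        = wt a b x * (x * ((1 - of_nat b - \<beta>) * H as t x - of_nat l * H (0 # as) t x)
          - (x + 1) * (of_nat a * H as t x + of_nat k * H (0 # as) t x))"
      proof -
        \<comment> \<open>Multiplication by \<open>x (x + 1)\<close> clears the poles of a
          logarithmic derivative; the same identity serves for the chain rule term and for
          \<open>r\<close>.\<close>
        have e: "x * (x + 1) * (- (p / x + q / (x + 1)) * w) = - (p * (x + 1) + q * x) * w" for p q w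
        proof -
          have "x * y * (- (p / x + q / y) * w) = - (p * y + q * x) * w" if "y \<noteq> 0" for y
            using nz(1)[OF tx(2)] that by (simp add: field_simps)
          then show ?thesis using nz(2)[OF tx(2)] by blast
        qed
        define d where "d = deriv (Theta as \<phi>) ?p"
        define W where "W = wt k l x * C * t * d"
        have "x * (x + 1) * wt a b x * (r x * (d
             * (C * (- (of_nat k / x + of_nat l / (x + 1)) * wt k l x) * t))
           + - (1 / x + \<beta> / (x + 1)) * r x * Theta as \<phi> ?p)
          = wt a b x * r x * (x * (x + 1) * (- (of_nat k / x + of_nat l / (x + 1)) * W)
             + x * (x + 1) * (- (1 / x + \<beta> / (x + 1)) * Theta as \<phi> ?p))"
          by (simp add: W_def algebra_simps)
        also have "\<dots> = wt a b x * r x * (- (of_nat k * (x + 1) + of_nat l * x) * W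
            - ((x + 1) + \<beta> * x) * Theta as \<phi> ?p)"
          unfolding e by (simp add: algebra_simps)
        finally show ?thesis
          unfolding e d_def[symmetric] H_def Theta_simps theta_plus_def theta_def
          by (simp add: W_def d_def algebra_simps)
      qed
      finally show "((\<lambda>x. x * (x + 1) * wt a b x * H as t x) has_field_derivative
        wt a b x * (x * ((1 - of_nat b - \<beta>) * H as t x - of_nat l * H (0 # as) t x)
          - (x + 1) * (of_nat a * H as t x + of_nat k * H (0 # as) t x))) (at x)" .
    next
      fix t x assume tx: "t \<in> T" "x \<in> V"
      let ?p = "C * wt k l x * t"
      have "Theta (replicate (Suc (length Q)) 0) \<phi> ?p = theta_plus 0 (\<lambda>x. x * Theta Q \<phi> x) ?p"
        using theta_plus_cong[OF D(1) ode inD[OF tx]] by simp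
      also have "\<dots> = ?p * Theta (1 # Q) \<phi> ?p"
        using theta_plus_id_mult[OF D(1) Th inD[OF tx]] by simp
      finally show "H (replicate (Suc (length Q)) 0) t x = C * t * wt k l x * H (1 # Q) t x"
        unfolding H_def by (simp only: mult_ac)
    next
      show "(\<forall>x\<in>V. x \<noteq> 0 \<and> x + 1 \<noteq> 0) \<or> (\<forall>as t x. H as t x = 0)"
        using nz by blast
    qed
    then show ?thesis using T V by (intro that) auto
  qed
qed

lemma local_formD:
  assumes "local_form k l \<beta> C Q c h s0 T \<delta> X H H'"
  shows "\<lbrakk>t \<in> T; s \<in> {0..1}; \<bar>s - s0\<bar> < \<delta>\<rbrakk> \<Longrightarrow> Theta as (\<lambda>t. h t s) t = H as t (c s)"
    and "\<lbrakk>t \<in> T; x \<in> X\<rbrakk> \<Longrightarrow> ((\<lambda>t. H as t x) has_field_derivative H' as t x) (at t)"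
    and "t \<in> T \<Longrightarrow> (\<lambda>x. wt a b x * H as t x) holomorphic_on X"
    and "t \<in> T \<Longrightarrow> (\<lambda>x. wt a b x * H' as t x) holomorphic_on X"
    and "continuous_on (T \<times> X) (\<lambda>(t, x). wt a b x * H' as t x)"
    and "\<lbrakk>t \<in> T; x \<in> X\<rbrakk> \<Longrightarrow>
      ((\<lambda>x. x * (x + 1) * wt a b x * H as t x) has_field_derivative
        wt a b x * (x * ((1 - of_nat b - \<beta>) * H as t x - of_nat l * H (0 # as) t x)
          - (x + 1) * (of_nat a * H as t x + of_nat k * H (0 # as) t x))) (at x)"
    and "\<lbrakk>t \<in> T; x \<in> X\<rbrakk> \<Longrightarrow>
      H (replicate (Suc (length Q)) 0) t x = C * t * wt k l x * H (1 # Q) t x"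
    and "(\<forall>x\<in>X. x \<noteq> 0 \<and> x + 1 \<noteq> 0) \<or> (\<forall>as t x. H as t x = 0)"
  subgoal by (rule assms[unfolded local_form_def, THEN conjunct1, rule_format])
  subgoal by (rule assms[unfolded local_form_def, THEN conjunct2, THEN conjunct1, rule_format])
  subgoal by (rule assms[unfolded local_form_def, THEN conjunct2, THEN conjunct2, THEN conjunct1, rule_format])
  subgoal by (rule assms[unfolded local_form_def, THEN conjunct2, THEN conjunct2, THEN conjunct2, THEN conjunct1, rule_format])
  subgoal by (rule assms[unfolded local_form_def, THEN conjunct2, THEN conjunct2, THEN conjunct2, THEN conjunct2, THEN conjunct1, rule_format])
  subgoal by (rule assms[unfolded local_form_def, THEN conjunct2, THEN conjunct2, THEN conjunct2, THEN conjunct2, THEN conjunct2, THEN conjunct1, rule_format])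
  subgoal by (rule assms[unfolded local_form_def, THEN conjunct2, THEN conjunct2, THEN conjunct2, THEN conjunct2, THEN conjunct2, THEN conjunct2, THEN conjunct1, rule_format])
  subgoal by (rule assms[unfolded local_form_def, THEN conjunct2, THEN conjunct2, THEN conjunct2, THEN conjunct2, THEN conjunct2, THEN conjunct2, THEN conjunct2])
  done

text \<open>Integration by parts exchanges a factor \<open>\<theta> + a/k\<close> or \<open>\<theta> + (b - 1 + \<beta>)/l\<close> for a
  factor \<open>\<theta> + (a + b - 1 + \<beta>)/(k + l)\<close>, while one factor \<open>v\<close> or \<open>v + 1\<close> is removed from the
  denominator \<open>v\<^sup>a (v + 1)\<^sup>b\<close>. It only applies if the factor to be exchanged is present.\<close>

inductive reduces :: "nat \<Rightarrow> nat \<Rightarrow> complex \<Rightarrow> nat \<Rightarrow> nat \<Rightarrow> complex list \<Rightarrow> complex list \<Rightarrow> bool"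
  for k l :: nat and \<beta> :: complex where
  stop: "mset M = mset M' \<Longrightarrow> reduces k l \<beta> 0 0 M M'"
| left: "\<lbrakk>of_nat (Suc a) / of_nat k \<in> set M;
    reduces k l \<beta> a b ((of_nat (a + b) + \<beta>) / of_nat (k + l)
      # remove1 (of_nat (Suc a) / of_nat k) M) M'\<rbrakk> \<Longrightarrow> reduces k l \<beta> (Suc a) b M M'"
| right: "\<lbrakk>(of_nat b + \<beta>) / of_nat l \<in> set M;
    reduces k l \<beta> a b ((of_nat (a + b) + \<beta>) / of_nat (k + l)
      # remove1 ((of_nat b + \<beta>) / of_nat l) M) M'\<rbrakk> \<Longrightarrow> reduces k l \<beta> a (Suc b) M M'"

section \<open>Integration by parts along a cycle\<close>

text \<open>Common frame for three situations: threefolds fibred by K3 surfaces, K3 surfaces fibred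
  by elliptic curves, and a single circle. The boundary condition is an identity of functions of
  \<open>t\<close> for every point \<open>x\<close>, so that operators in \<open>t\<close> can be
  applied to it.\<close>

locale twisted_cycle =
  fixes k l :: nat and \<beta> C :: complex and Q :: "complex list" and U :: "complex set"
    and m :: nat and c :: "nat \<Rightarrow> real \<Rightarrow> complex" and h :: "nat \<Rightarrow> complex \<Rightarrow> real \<Rightarrow> complex"
  assumes openU: "open U"
    and paths: "\<And>j. j < m \<Longrightarrow> valid_path (c j)"
    and twist: "\<And>j. j < m \<Longrightarrow> twist_family k l \<beta> C Q U (c j) (h j)"
    and boundary: "\<And>t x. t \<in> U \<Longrightarrow> (\<Sum>j<m. if c j 1 = x then h j t 1 else 0)
                            = (\<Sum>j<m. if c j 0 = x then h j t 0 else 0)"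
    and kl: "k > 0" "l > 0"
begin

text \<open>\<open>I 0 0 []\<close> is the period itself; the exchanges lead from weight
  \<open>(k, l)\<close> down to weight \<open>(0, 0)\<close>.\<close>

definition I :: "nat \<Rightarrow> nat \<Rightarrow> complex list \<Rightarrow> complex \<Rightarrow> complex" where
  "I a b as t = (\<Sum>j<m. integral {0..1} (\<lambda>s. wt a b (c j s) * Theta as (\<lambda>t. h j t s) t
     * velocity (c j) s))"

lemma h_holomorphic:
  assumes "j < m" "s \<in> {0..1}"
  shows "(\<lambda>t. h j t s) holomorphic_on U"
  unfolding holomorphic_on_open[OF openU]
proof
  fix t0 assume t0: "t0 \<in> U"
  obtain T \<delta> X H H' where "open T" "t0 \<in> T" "\<delta> > 0" "open X" "c j s \<in> X"
    and lf: "local_form k l \<beta> C Q (c j) (h j) s T \<delta> X H H'"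
    by (rule twist_family_local[OF twist[OF assms(1)] t0 assms(2)])
  note H = local_formD(1)[OF lf] and dH = local_formD(2)[OF lf]
  have "((\<lambda>t. h j t s) has_field_derivative H' [] t0 (c j s)) (at t0)"
    by (rule has_field_derivative_transform_within_open[OF dH[of t0 "c j s" "[]"] \<open>open T\<close> \<open>t0 \<in> T\<close>])
      (use H[of _ s "[]"] assms \<open>c j s \<in> X\<close> \<open>\<delta> > 0\<close> \<open>t0 \<in> T\<close> in auto)
  then show "\<exists>f'. ((\<lambda>t. h j t s) has_field_derivative f') (at t0)" by blast
qed

lemma family:
  assumes "j < m"
  shows "holo_family U (c j) (\<lambda>t s. wt a b (c j s) * Theta as (\<lambda>t. h j t s) t)
    (\<lambda>t s. wt a b (c j s) * deriv (Theta as (\<lambda>t. h j t s)) t)"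
  unfolding holo_family_def
proof (intro ballI)
  fix t0 :: complex and s0 :: real assume ts0: "t0 \<in> U" "s0 \<in> {0..1}"
  obtain T \<delta> X H H' where T: "open T" "t0 \<in> T" "\<delta> > 0" "open X" "c j s0 \<in> X"
    and lf: "local_form k l \<beta> C Q (c j) (h j) s0 T \<delta> X H H'"
    by (rule twist_family_local[OF twist[OF assms(1)] ts0])
  note H = local_formD(1)[OF lf] and dH = local_formD(2)[OF lf]
    and hol = local_formD(3,4)[OF lf] and cont = local_formD(5)[OF lf]
  obtain \<delta>2 where \<delta>2: "\<delta>2 > 0" "\<And>s. s \<in> {0..1} \<Longrightarrow> \<bar>s - s0\<bar> < \<delta>2 \<Longrightarrow> c j s \<in> X"
    using valid_path_near[OF paths[OF assms] ts0(2) T(4,5)] by metis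
  have d: "deriv (Theta as (\<lambda>t. h j t s)) t = H' as t (c j s)"
    if "t \<in> T" "s \<in> {0..1}" "\<bar>s - s0\<bar> < \<delta>" "\<bar>s - s0\<bar> < \<delta>2" for as t s
  proof (rule DERIV_imp_deriv, rule has_field_derivative_transform_within_open[OF dH T(1)])
    show "c j s \<in> X" using \<delta>2 that by blast
  qed (use H that in auto)
  show "\<exists>T X \<delta> H H'. open T \<and> t0 \<in> T \<and> open X \<and> c j s0 \<in> X \<and> 0 < \<delta> \<and>
      (\<forall>t\<in>T. H t holomorphic_on X \<and> H' t holomorphic_on X) \<and>
      (\<forall>x\<in>X. \<forall>t\<in>T. ((\<lambda>t. H t x) has_field_derivative H' t x) (at t)) \<and>
      continuous_on (T \<times> X) (\<lambda>(t, x). H' t x) \<and>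
      (\<forall>s\<in>{0..1}. \<bar>s - s0\<bar> < \<delta> \<longrightarrow>
         (\<forall>t\<in>T. wt a b (c j s) * Theta as (\<lambda>t. h j t s) t = H t (c j s) \<and>
            wt a b (c j s) * deriv (Theta as (\<lambda>t. h j t s)) t = H' t (c j s)))"
    by (rule exI[of _ T], rule exI[of _ X], rule exI[of _ "min \<delta> \<delta>2"],
        rule exI[of _ "\<lambda>t x. wt a b x * H as t x"], rule exI[of _ "\<lambda>t x. wt a b x * H' as t x"])
      (use T \<delta>2 hol cont H d in \<open>auto intro!: DERIV_cmult dH\<close>)
qed

lemma integrable:
  assumes "j < m" "t \<in> U"
  shows "(\<lambda>s. wt a b (c j s) * Theta as (\<lambda>t. h j t s) t
    * velocity (c j) s) integrable_on {0..1}"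
  by (rule holo_family_deriv(1)[OF paths[OF assms(1)] family[OF assms(1)] assms(2)])

lemma I_deriv:
  assumes t: "t \<in> U"
  obtains D where "(I a b as has_field_derivative D) (at t)" "t * D = I a b (0 # as) t"
proof
  show "(I a b as has_field_derivative (\<Sum>j<m. integral {0..1} (\<lambda>s. wt a b (c j s) *
     deriv (Theta as (\<lambda>t. h j t s)) t * velocity (c j) s))) (at t)"
    unfolding I_def
    by (intro DERIV_sum) (use t in \<open>auto intro!: holo_family_deriv(3)[OF paths family]\<close>)
  show "t * (\<Sum>j<m. integral {0..1} (\<lambda>s. wt a b (c j s) *
     deriv (Theta as (\<lambda>t. h j t s)) t * velocity (c j) s))
     = I a b (0 # as) t"
    unfolding I_def sum_distrib_left integral_mult_right[symmetric] Theta_simps theta_plus_0 theta_def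
    by (simp only: mult_ac)
qed

lemma I_Cons:
  assumes "t \<in> U"
  shows "I a b (\<rho> # as) t = I a b (0 # as) t + \<rho> * I a b as t"
proof -
  have "integral {0..1} (\<lambda>s. wt a b (c j s) * Theta (\<rho> # as) (\<lambda>t. h j t s) t * velocity (c j) s)
   = integral {0..1} (\<lambda>s. wt a b (c j s) * Theta (0 # as) (\<lambda>t. h j t s) t * velocity (c j) s)
   + \<rho> * integral {0..1} (\<lambda>s. wt a b (c j s) * Theta as (\<lambda>t. h j t s) t * velocity (c j) s)"
    if "j < m" for j
  proof -
    have "((\<lambda>s. wt a b (c j s) * Theta (0 # as) (\<lambda>t. h j t s) t * velocity (c j) s
        + \<rho> * (wt a b (c j s) * Theta as (\<lambda>t. h j t s) t * velocity (c j) s))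
      has_integral
        integral {0..1} (\<lambda>s. wt a b (c j s) * Theta (0 # as) (\<lambda>t. h j t s) t * velocity (c j) s)
       + \<rho> * integral {0..1} (\<lambda>s. wt a b (c j s) * Theta as (\<lambda>t. h j t s) t * velocity (c j) s)) {0..1}"
      by (intro has_integral_add has_integral_mult_right integrable_integral integrable[OF that assms])
    from integral_unique[OF this] show ?thesis
      by (simp only: Theta_simps theta_plus_def mult_zero_left add_0_right ring_distribs mult_ac)
  qed
  then show ?thesis
    by (simp add: I_def sum.distrib sum_distrib_left)
qed

lemma I_perm:
  assumes "t \<in> U" "mset as = mset bs"
  shows "I a b as t = I a b bs t"
  unfolding I_def
proof (intro sum.cong refl integral_cong)
  fix j s assume "j \<in> {..<m}" "s \<in> {0..1::real}"
  then show "wt a b (c j s) * Theta as (\<lambda>t. h j t s) t * velocity (c j) s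
    = wt a b (c j s) * Theta bs (\<lambda>t. h j t s) t * velocity (c j) s"
    using Theta_perm[OF openU h_holomorphic assms] by simp
qed

lemma Theta_I:
  assumes "t \<in> U"
  shows "Theta as (I a b []) t = I a b as t"
  using assms
proof (induction as arbitrary: t)
  case (Cons \<rho> as)
  obtain D where D: "(I a b as has_field_derivative D) (at t)" "t * D = I a b (0 # as) t"
    by (rule I_deriv[OF Cons.prems])
  have "Theta (\<rho> # as) (I a b []) t = theta_plus \<rho> (I a b as) t"
    using theta_plus_cong[OF openU Cons.IH Cons.prems] by (simp only: Theta_simps)
  also have "\<dots> = I a b (0 # as) t + \<rho> * I a b as t"
    using D by (simp add: theta_plus_def theta_def DERIV_imp_deriv)
  finally show ?case using I_Cons[OF Cons.prems, of a b \<rho> as] by (simp only:)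
qed simp

lemma I_holomorphic: "I a b as holomorphic_on U"
  unfolding holomorphic_on_open[OF openU] by (meson I_deriv)

text \<open>Grouping the end points by their position \<open>x\<close> makes the factor
  \<open>g x\<close> constant on each group. What remains is a sum of fibre periods as functions of
  \<open>t\<close> on an open set, where the boundary condition may be differentiated.\<close>

lemma boundary_sum:
  assumes "t \<in> U"
  shows "(\<Sum>j<m. g (c j 1) * Theta as (\<lambda>t. h j t 1) t) = (\<Sum>j<m. g (c j 0) * Theta as (\<lambda>t. h j t 0) t)"
proof -
  define X where "X = (\<lambda>j. c j 1) ` {..<m} \<union> (\<lambda>j. c j 0) ` {..<m}"
  have fin: "finite X" by (simp add: X_def)
  have *: "(\<Sum>j<m. g (c j s) * Theta as (\<lambda>t. h j t s) t)
      = (\<Sum>x\<in>X. g x * Theta as (\<lambda>t. \<Sum>j<m. if c j s = x then h j t s else 0) t)"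
    if s: "s \<in> {0..1}" "\<And>j. j < m \<Longrightarrow> c j s \<in> X" for s
  proof -
    have "Theta as (\<lambda>t. \<Sum>j<m. if c j s = x then h j t s else 0) t
        = (\<Sum>j<m. if c j s = x then Theta as (\<lambda>t. h j t s) t else 0)" for x
      using Theta_sum[OF openU, of "{..<m}" "\<lambda>j t. h j t s" t as "\<lambda>j. if c j s = x then 1 else 0"]
        h_holomorphic s assms by (simp add: if_distrib[of "\<lambda>x. x * _"] cong: if_cong)
    then have "(\<Sum>x\<in>X. g x * Theta as (\<lambda>t. \<Sum>j<m. if c j s = x then h j t s else 0) t)
        = (\<Sum>x\<in>X. \<Sum>j<m. if c j s = x then g x * Theta as (\<lambda>t. h j t s) t else 0)"
      by (simp add: sum_distrib_left if_distrib cong: if_cong)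
    also have "\<dots> = (\<Sum>j<m. \<Sum>x\<in>X. if c j s = x then g x * Theta as (\<lambda>t. h j t s) t else 0)"
      by (rule sum.swap)
    also have "\<dots> = (\<Sum>j<m. g (c j s) * Theta as (\<lambda>t. h j t s) t)"
      using s fin by (intro sum.cong) auto
    finally show ?thesis by simp
  qed
  have "(\<Sum>j<m. g (c j 1) * Theta as (\<lambda>t. h j t 1) t)
      = (\<Sum>x\<in>X. g x * Theta as (\<lambda>t. \<Sum>j<m. if c j 1 = x then h j t 1 else 0) t)"
    by (rule *) (auto simp: X_def)
  also have "\<dots> = (\<Sum>x\<in>X. g x * Theta as (\<lambda>t. \<Sum>j<m. if c j 0 = x then h j t 0 else 0) t)"
    using Theta_cong[OF openU boundary assms] by simp
  also have "\<dots> = (\<Sum>j<m. g (c j 0) * Theta as (\<lambda>t. h j t 0) t)"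
    by (rule *[symmetric]) (auto simp: X_def)
  finally show ?thesis .
qed

text \<open>The primitive carries the factor \<open>x (x + 1)\<close>, which cancels the poles
  arising from differentiating the weight and the branch \<open>r\<close>. Thus the derivative is
  again \<open>wt a b\<close> times a combination with polynomial coefficients. The end point
  contributions cancel by \<open>boundary_sum\<close>.\<close>

lemma exact:
  assumes t: "t \<in> U"
  shows "(\<Sum>j<m. integral {0..1} (\<lambda>s. (wt a b (c j s)
      * (c j s * ((1 - of_nat b - \<beta>) * Theta as (\<lambda>t. h j t s) t - of_nat l * Theta (0 # as) (\<lambda>t. h j t s) t)
          - (c j s + 1) * (of_nat a * Theta as (\<lambda>t. h j t s) t + of_nat k * Theta (0 # as) (\<lambda>t. h j t s) t)))
      * velocity (c j) s)) = 0" (is "(\<Sum>j<m. integral _ (\<lambda>s. ?F j s * _)) = 0")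
proof -
  define F where "F = ?F"
  define g where "g x = x * (x + 1) * wt a b x" for x
  have "((\<lambda>s. F j s * velocity (c j) s) has_integral
     (g (c j 1) * Theta as (\<lambda>t. h j t 1) t - g (c j 0) * Theta as (\<lambda>t. h j t 0) t)) {0..1}"
    if j: "j < m" for j
  proof (rule path_integral_exact[OF paths[OF j]])
    fix s0 :: real assume s0: "s0 \<in> {0..1}"
    obtain T \<delta> X H H' where T: "open T" "t \<in> T" "\<delta> > 0" "open X" "c j s0 \<in> X"
      and lf: "local_form k l \<beta> C Q (c j) (h j) s0 T \<delta> X H H'"
      by (rule twist_family_local[OF twist[OF j] t s0])
    note H = local_formD(1)[OF lf] and dH = local_formD(6)[OF lf]
    show "\<exists>X \<delta> G f. open X \<and> c j s0 \<in> X \<and> 0 < \<delta> \<and>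
      (\<forall>x\<in>X. (G has_field_derivative f x) (at x)) \<and>
      (\<forall>s\<in>{0..1}. \<bar>s - s0\<bar> < \<delta> \<longrightarrow>
         g (c j s) * Theta as (\<lambda>t. h j t s) t = G (c j s) \<and> F j s = f (c j s))"
      by (rule exI[of _ X], rule exI[of _ \<delta>], rule exI[of _ "\<lambda>x. x * (x + 1) * wt a b x * H as t x"],
          rule exI[of _ "\<lambda>x. wt a b x * (x * ((1 - of_nat b - \<beta>) * H as t x - of_nat l * H (0 # as) t x)
          - (x + 1) * (of_nat a * H as t x + of_nat k * H (0 # as) t x))"])
        (intro conjI ballI impI dH, use T H in \<open>auto simp: F_def g_def simp del: Theta_simps\<close>)
  qed
  then have "(\<Sum>j<m. integral {0..1} (\<lambda>s. F j s * velocity (c j) s))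
    = (\<Sum>j<m. g (c j 1) * Theta as (\<lambda>t. h j t 1) t - g (c j 0) * Theta as (\<lambda>t. h j t 0) t)"
    by (intro sum.cong) (auto simp: integral_unique)
  then have "(\<Sum>j<m. integral {0..1} (\<lambda>s. F j s * velocity (c j) s)) = 0"
    using boundary_sum[OF t, of g as] by (simp add: sum_subtractf)
  then show ?thesis unfolding F_def .
qed

text \<open>At \<open>0\<close> and \<open>-1\<close>, where division by zero gives
  \<open>0\<close>, lowering an exponent in \<open>wt\<close> may fail. The identities of integrands
  survive there because the fibre period vanishes identically.\<close>

lemma degenerate:
  assumes "j < m" "s \<in> {0..1}" "t \<in> U"
  shows "(c j s \<noteq> 0 \<and> c j s + 1 \<noteq> 0) \<or> (\<forall>as. Theta as (\<lambda>t. h j t s) t = 0)"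
    "Theta (replicate (Suc (length Q)) 0) (\<lambda>t. h j t s) t
       = C * t * wt k l (c j s) * Theta (1 # Q) (\<lambda>t. h j t s) t"
proof -
  obtain T \<delta> X H H' where T: "open T" "t \<in> T" "\<delta> > 0" "open X" "c j s \<in> X"
    and lf: "local_form k l \<beta> C Q (c j) (h j) s T \<delta> X H H'"
    by (rule twist_family_local[OF twist[OF assms(1)] assms(3,2)])
  note H = local_formD(1)[OF lf] and ode = local_formD(7)[OF lf] and deg = local_formD(8)[OF lf]
  have "Theta as (\<lambda>t. h j t s) t = H as t (c j s)" for as
    using H T assms by auto
  then show "(c j s \<noteq> 0 \<and> c j s + 1 \<noteq> 0) \<or> (\<forall>as. Theta as (\<lambda>t. h j t s) t = 0)"
    "Theta (replicate (Suc (length Q)) 0) (\<lambda>t. h j t s) t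
       = C * t * wt k l (c j s) * Theta (1 # Q) (\<lambda>t. h j t s) t"
    using ode[of t "c j s"] deg T by (auto simp del: Theta_simps replicate.simps)
qed

lemma I_combine:
  assumes t: "t \<in> U"
    and eq: "\<And>j s. \<lbrakk>j < m; s \<in> {0..1}\<rbrakk> \<Longrightarrow>
      p * (wt a b (c j s) * Theta as (\<lambda>t. h j t s) t) + q * (wt a' b' (c j s) * Theta bs (\<lambda>t. h j t s) t) = F j s"
    and F: "(\<Sum>j<m. integral {0..1} (\<lambda>s. F j s * velocity (c j) s)) = 0"
  shows "p * I a b as t + q * I a' b' bs t = 0"
proof -
  let ?d = "\<lambda>j s. velocity (c j) s"
  have "integral {0..1} (\<lambda>s. F j s * ?d j s)
     = p * integral {0..1} (\<lambda>s. wt a b (c j s) * Theta as (\<lambda>t. h j t s) t * ?d j s)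
     + q * integral {0..1} (\<lambda>s. wt a' b' (c j s) * Theta bs (\<lambda>t. h j t s) t * ?d j s)"
    if j: "j < m" for j
  proof -
    have "((\<lambda>s. p * (wt a b (c j s) * Theta as (\<lambda>t. h j t s) t * ?d j s)
        + q * (wt a' b' (c j s) * Theta bs (\<lambda>t. h j t s) t * ?d j s)) has_integral
       p * integral {0..1} (\<lambda>s. wt a b (c j s) * Theta as (\<lambda>t. h j t s) t * ?d j s)
     + q * integral {0..1} (\<lambda>s. wt a' b' (c j s) * Theta bs (\<lambda>t. h j t s) t * ?d j s)) {0..1}"
      by (intro has_integral_add has_integral_mult_right integrable_integral integrable[OF j t])
    moreover have "integral {0..1} (\<lambda>s. F j s * ?d j s)
      = integral {0..1} (\<lambda>s. p * (wt a b (c j s) * Theta as (\<lambda>t. h j t s) t * ?d j s)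
        + q * (wt a' b' (c j s) * Theta bs (\<lambda>t. h j t s) t * ?d j s))"
      by (intro integral_cong) (simp add: eq[OF j, symmetric] algebra_simps)
    ultimately show ?thesis by (simp add: integral_unique)
  qed
  with F show ?thesis
    by (simp add: I_def sum.distrib sum_distrib_left)
qed

text \<open>Sorted by powers of \<open>x\<close>, the bracket in \<open>exact\<close> for weight
  \<open>(Suc a, b)\<close> is \<open>- x ((k + l) \<theta> + a + b + \<beta>) - (k \<theta> + a +
  1)\<close>, and the factor \<open>x\<close> lowers \<open>Suc a\<close> to
  \<open>a\<close>.\<close>

lemma step_left:
  assumes "t \<in> U"
  shows "of_nat k * I (Suc a) b (of_nat (Suc a) / of_nat k # as) t
      = - of_nat (k + l) * I a b ((of_nat (a + b) + \<beta>) / of_nat (k + l) # as) t"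
proof -
  have "(- of_nat k) * I (Suc a) b (of_nat (Suc a) / of_nat k # as) t
      + (- of_nat (k + l)) * I a b ((of_nat (a + b) + \<beta>) / of_nat (k + l) # as) t = 0"
  proof (rule I_combine[OF assms _ exact[OF assms, of "Suc a" b as]])
    fix j s assume js: "j < m" "s \<in> {0..1::real}"
    let ?x = "c j s" and ?h = "\<lambda>as. Theta as (\<lambda>t. h j t s) t"
    have k: "of_nat k * ?h (\<rho> / of_nat k # as) = of_nat k * ?h (0 # as) + \<rho> * ?h as" for \<rho>
      using kl by (simp add: theta_plus_def field_simps)
    have kl': "of_nat (k + l) * ?h (\<rho> / of_nat (k + l) # as) = of_nat (k + l) * ?h (0 # as) + \<rho> * ?h as" for \<rho>
      using kl by (simp add: theta_plus_def field_simps del: of_nat_add)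
    show "(- of_nat k) * (wt (Suc a) b ?x * ?h (of_nat (Suc a) / of_nat k # as))
        + (- of_nat (k + l)) * (wt a b ?x * ?h ((of_nat (a + b) + \<beta>) / of_nat (k + l) # as))
      = wt (Suc a) b ?x * (?x * ((1 - of_nat b - \<beta>) * ?h as - of_nat l * ?h (0 # as))
          - (?x + 1) * (of_nat (Suc a) * ?h as + of_nat k * ?h (0 # as)))"
    proof (cases "?x \<noteq> 0 \<and> ?x + 1 \<noteq> 0")
      case True
      then have "wt a b ?x = ?x * wt (Suc a) b ?x" by (intro wt_Suc) auto
      then have "(- of_nat k) * (wt (Suc a) b ?x * ?h (of_nat (Suc a) / of_nat k # as))
        + (- of_nat (k + l)) * (wt a b ?x * ?h ((of_nat (a + b) + \<beta>) / of_nat (k + l) # as))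
        = - wt (Suc a) b ?x * (of_nat k * ?h (of_nat (Suc a) / of_nat k # as)
           + ?x * (of_nat (k + l) * ?h ((of_nat (a + b) + \<beta>) / of_nat (k + l) # as)))"
        unfolding \<open>wt a b ?x = _\<close> by (simp add: algebra_simps del: Theta_simps of_nat_add)
      then show ?thesis unfolding k kl' by (simp add: algebra_simps del: Theta_simps)
    next
      case False
      with degenerate(1)[OF js assms] have "?h as = 0" for as by blast
      then show ?thesis by (simp del: Theta_simps)
    qed
  qed
  moreover have "a * x = - b * y" if "(- a) * x + (- b) * y = 0" for a b x y :: complex
    using that by algebra
  ultimately show ?thesis by blast
qed

text \<open>For weight \<open>(a, Suc b)\<close> the bracket is sorted by powers of
  \<open>x + 1\<close> instead: \<open>- (x + 1) ((k + l) \<theta> + a + b + \<beta>) + (l \<theta>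
  + b + \<beta>)\<close>. This accounts for the sign that differs from
  \<open>step_left\<close>.\<close>

lemma step_right:
  assumes "t \<in> U"
  shows "of_nat l * I a (Suc b) ((of_nat b + \<beta>) / of_nat l # as) t
      = of_nat (k + l) * I a b ((of_nat (a + b) + \<beta>) / of_nat (k + l) # as) t"
proof -
  have "of_nat l * I a (Suc b) ((of_nat b + \<beta>) / of_nat l # as) t
      + (- of_nat (k + l)) * I a b ((of_nat (a + b) + \<beta>) / of_nat (k + l) # as) t = 0"
  proof (rule I_combine[OF assms _ exact[OF assms, of a "Suc b" as]])
    fix j s assume js: "j < m" "s \<in> {0..1::real}"
    let ?x = "c j s" and ?h = "\<lambda>as. Theta as (\<lambda>t. h j t s) t"
    have l: "of_nat l * ?h (\<rho> / of_nat l # as) = of_nat l * ?h (0 # as) + \<rho> * ?h as" for \<rho>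
      using kl by (simp add: theta_plus_def field_simps)
    have kl': "of_nat (k + l) * ?h (\<rho> / of_nat (k + l) # as) = of_nat (k + l) * ?h (0 # as) + \<rho> * ?h as" for \<rho>
      using kl by (simp add: theta_plus_def field_simps del: of_nat_add)
    show "of_nat l * (wt a (Suc b) ?x * ?h ((of_nat b + \<beta>) / of_nat l # as))
        + (- of_nat (k + l)) * (wt a b ?x * ?h ((of_nat (a + b) + \<beta>) / of_nat (k + l) # as))
      = wt a (Suc b) ?x * (?x * ((1 - of_nat (Suc b) - \<beta>) * ?h as - of_nat l * ?h (0 # as))
          - (?x + 1) * (of_nat a * ?h as + of_nat k * ?h (0 # as)))"
    proof (cases "?x \<noteq> 0 \<and> ?x + 1 \<noteq> 0")
      case True
      then have "wt a b ?x = (?x + 1) * wt a (Suc b) ?x" by (intro wt_Suc) auto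
      then have "of_nat l * (wt a (Suc b) ?x * ?h ((of_nat b + \<beta>) / of_nat l # as))
        + (- of_nat (k + l)) * (wt a b ?x * ?h ((of_nat (a + b) + \<beta>) / of_nat (k + l) # as))
        = wt a (Suc b) ?x * (of_nat l * ?h ((of_nat b + \<beta>) / of_nat l # as)
           - (?x + 1) * (of_nat (k + l) * ?h ((of_nat (a + b) + \<beta>) / of_nat (k + l) # as)))"
        unfolding \<open>wt a b ?x = _\<close> by (simp add: algebra_simps del: Theta_simps of_nat_add)
      then show ?thesis unfolding l kl' by (simp add: algebra_simps del: Theta_simps)
    next
      case False
      with degenerate(1)[OF js assms] have "?h as = 0" for as by blast
      then show ?thesis by (simp del: Theta_simps)
    qed
  qed
  then show ?thesis by (simp add: algebra_simps)
qed

text \<open>A left exchange contributes \<open>- (k + l) / k\<close>, a right one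
  \<open>(k + l) / l\<close>. Starting from \<open>(k, l)\<close> the product is
  \<open>1 / c_kl k l\<close>, which explains the constant in the generalized functional
  invariant.\<close>

lemma I_reduces:
  assumes t: "t \<in> U" and "reduces k l \<beta> a b M M'"
  shows "of_nat k ^ a * of_nat l ^ b * I a b M t = (-1) ^ a * of_nat (k + l) ^ (a + b) * I 0 0 M' t"
  using assms(2)
proof (induction rule: reduces.induct)
  case (stop M M')
  then show ?case using I_perm[OF t stop, of 0 0] by simp
next
  case (left a M b M')
  let ?x = "of_nat (Suc a) / of_nat k :: complex"
  have "I (Suc a) b M t = I (Suc a) b (?x # remove1 ?x M) t"
    using left by (intro I_perm[OF t]) simp
  then have "of_nat k * I (Suc a) b M t = - of_nat (k + l) * I a b ((of_nat (a + b) + \<beta>) / of_nat (k + l)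
      # remove1 ?x M) t"
    using step_left[OF t] by simp
  from arg_cong[OF this, of "(*) (of_nat k ^ a * of_nat l ^ b)"]
  have "of_nat k ^ Suc a * of_nat l ^ b * I (Suc a) b M t
     = - of_nat (k + l) * (of_nat k ^ a * of_nat l ^ b * I a b ((of_nat (a + b) + \<beta>) / of_nat (k + l)
      # remove1 ?x M) t)"
    by (simp add: mult_ac del: of_nat_Suc of_nat_add)
  also have "\<dots> = (-1) ^ Suc a * of_nat (k + l) ^ (Suc a + b) * I 0 0 M' t"
    unfolding left.IH by (simp del: of_nat_add)
  finally show ?case .
next
  case (right b M a M')
  let ?x = "(of_nat b + \<beta>) / of_nat l :: complex"
  have "I a (Suc b) M t = I a (Suc b) (?x # remove1 ?x M) t"
    using right by (intro I_perm[OF t]) simp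
  then have "of_nat l * I a (Suc b) M t = of_nat (k + l) * I a b ((of_nat (a + b) + \<beta>) / of_nat (k + l)
      # remove1 ?x M) t"
    using step_right[OF t] by simp
  from arg_cong[OF this, of "(*) (of_nat k ^ a * of_nat l ^ b)"]
  have "of_nat k ^ a * of_nat l ^ Suc b * I a (Suc b) M t
     = of_nat (k + l) * (of_nat k ^ a * of_nat l ^ b * I a b ((of_nat (a + b) + \<beta>) / of_nat (k + l)
      # remove1 ?x M) t)"
    by (simp add: mult_ac del: of_nat_Suc of_nat_add)
  also have "\<dots> = (-1) ^ a * of_nat (k + l) ^ (a + Suc b) * I 0 0 M' t"
    unfolding right.IH by (simp del: of_nat_add)
  finally show ?case .
qed

text \<open>The fibre equation trades \<open>\<theta>^(r + 1)\<close> for the weight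
  \<open>wt k l\<close> and the list \<open>1 # Q\<close>; the exchanges then remove the weight
  again. With \<open>C = c_kl k l\<close> the constant disappears; a general \<open>C\<close> allows
  a fibre over a fixed point of a further base.\<close>

theorem twisted_ode:
  assumes red: "reduces k l \<beta> k l (1 # Q) Q'"
    and P: "\<And>t. t \<in> U \<Longrightarrow> P t = (\<Sum>j<m. integral {0..1} (\<lambda>s. h j t s * velocity (c j) s))"
  shows "P holomorphic_on U"
    and "t \<in> U \<Longrightarrow> Theta (replicate (Suc (length Q)) 0) P t = C / c_kl k l * t * Theta Q' P t"
proof -
  have PI: "P t = I 0 0 [] t" if "t \<in> U" for t
    using P[OF that] by (simp add: I_def)
  have "I 0 0 [] holomorphic_on U" by (rule I_holomorphic)
  then show "P holomorphic_on U"
    by (rule holomorphic_transform) (simp add: PI)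
  assume t: "t \<in> U"
  have Th: "Theta as P t = I 0 0 as t" for as
    using Theta_cong[OF openU PI t] Theta_I[OF t] by simp
  \<comment> \<open>Holds already under the integral sign, by the fibre equation with one more
    \<theta>.\<close>
  have "I 0 0 (replicate (Suc (length Q)) 0) t = C * t * I k l (1 # Q) t"
    unfolding I_def sum_distrib_left integral_mult_right[symmetric] wt_0
  proof (intro sum.cong refl integral_cong)
    fix j s assume js: "j \<in> {..<m}" "s \<in> {0..1::real}"
    then have "j < m" by simp
    show "1 * Theta (replicate (Suc (length Q)) 0) (\<lambda>t. h j t s) t * velocity (c j) s =
         C * t * (wt k l (c j s) * Theta (1 # Q) (\<lambda>t. h j t s) t * velocity (c j) s)"
      unfolding degenerate(2)[OF \<open>j < m\<close> js(2) t] by (simp only: mult_ac mult_1_left)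
  qed
  moreover have "I k l (1 # Q) t = 1 / c_kl k l * I 0 0 Q' t"
  proof -
    define N where "N = (of_nat (k + l) :: complex) ^ (k + l)"
    have nz: "N \<noteq> 0" "c_kl k l \<noteq> 0"
      using kl by (simp_all add: N_def c_kl_def del: of_nat_add)
    have "c_kl k l * I k l (1 # Q) t = (-1) ^ k * (of_nat k ^ k * of_nat l ^ l * I k l (1 # Q) t) / N"
      by (simp add: c_kl_def N_def)
    also have "\<dots> = ((-1) ^ k * (-1) ^ k) * I 0 0 Q' t"
      unfolding I_reduces[OF t red] N_def[symmetric] using nz by simp
    also have "(-1) ^ k * (-1) ^ k = (1 :: complex)"
      by (simp flip: power_mult_distrib)
    finally have "c_kl k l * I k l (1 # Q) t = I 0 0 Q' t" by simp
    then show ?thesis using nz(2) by (simp add: field_simps)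
  qed
  ultimately show "Theta (replicate (Suc (length Q)) 0) P t = C / c_kl k l * t * Theta Q' P t"
    unfolding Th by simp
qed

end

section \<open>Periods of the elliptic curves\<close>

lemma Re_pos_not_nonpos_Reals: "Re z > 0 \<Longrightarrow> z \<notin> \<real>\<^sub>\<le>\<^sub>0"
  by (auto simp: complex_nonpos_Reals_iff)

lemma continuous_on_csqrt_Re:
  assumes "continuous_on A f" "\<And>x. x \<in> A \<Longrightarrow> Re (f x) > 0"
  shows "continuous_on A (\<lambda>x. csqrt (f x))"
proof (rule continuous_on_compose2[OF _ assms(1)])
  show "continuous_on {z. Re z > 0} csqrt"
    by (rule continuous_at_imp_continuous_on)
      (auto intro!: field_differentiable_imp_continuous_at field_differentiable_at_csqrt Re_pos_not_nonpos_Reals)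
qed (use assms in auto)

text \<open>\<open>y / y0\<close> lies in the right half-plane, where \<open>csqrt\<close> inverts
  squaring. A root selected by closeness to a reference value thereby gets an explicit holomorphic
  formula.\<close>

lemma csqrt_eq_divide:
  assumes "y0 \<noteq> 0" "norm (y - y0) < norm y0" "y ^ 2 = w"
  shows "y0 * csqrt (w / y0 ^ 2) = y"
proof -
  have "norm (y / y0 - 1) < 1"
    using assms by (simp add: diff_divide_distrib[symmetric] norm_divide divide_simps
        flip: diff_divide_eq_iff)
  then have "Re (y / y0) > 0"
    using abs_Re_le_cmod[of "y / y0 - 1"] by simp
  then have "csqrt ((y / y0) ^ 2) = y / y0"
    by (intro csqrt_square) simp
  then show "y0 * csqrt (w / y0 ^ 2) = y"
    using assms by (simp add: power_divide)
qed

text \<open>The coefficients are general functions of \<open>z\<close> because the locale is used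
  with the modulus and also with the scale as parameter. \<open>\<gamma>\<close> is fixed; only
  \<open>Y\<close> moves with \<open>z\<close>.\<close>

locale elliptic_loop =
  fixes N :: "complex set" and \<gamma> :: "real \<Rightarrow> complex" and Y :: "real \<Rightarrow> complex \<Rightarrow> complex"
    and a a' b b' :: "complex \<Rightarrow> complex"
  assumes openN: "open N" and path: "valid_path \<gamma>" and closed: "\<gamma> 1 = \<gamma> 0"
    and contY: "continuous_on ({0..1} \<times> N) (\<lambda>(s, z). Y s z)"
    and Y_nz: "\<And>s z. \<lbrakk>s \<in> {0..1}; z \<in> N\<rbrakk> \<Longrightarrow> Y s z \<noteq> 0"
    and Y_sq: "\<And>s z. \<lbrakk>s \<in> {0..1}; z \<in> N\<rbrakk> \<Longrightarrow> Y s z ^ 2 = 4 * \<gamma> s ^ 3 - a z * \<gamma> s - b z"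
    and Y_closed: "\<And>z. z \<in> N \<Longrightarrow> Y 1 z = Y 0 z"
    and da: "\<And>z. z \<in> N \<Longrightarrow> (a has_field_derivative a' z) (at z)"
    and db: "\<And>z. z \<in> N \<Longrightarrow> (b has_field_derivative b' z) (at z)"
    and cont_a': "continuous_on N a'" and cont_b': "continuous_on N b'"
begin

lemma cont_a: "continuous_on N a" and cont_b: "continuous_on N b"
  using da db by (auto intro!: continuous_at_imp_continuous_on DERIV_isCont)

text \<open>\<open>Y\<close> is given only over the points of \<open>\<gamma>\<close>. Near a
  reference point the formula with \<open>csqrt\<close> extends it to an open set of
  \<open>x\<close>, and implicit differentiation of \<open>B^2 = 4 x^3 - a x - b\<close> gives both
  partial derivatives.\<close>

lemma local_branch:
  assumes z0: "z0 \<in> N" and s0: "s0 \<in> {0..1}"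
  obtains T X \<delta> B where "open T" "z0 \<in> T" "T \<subseteq> N" "open X" "\<gamma> s0 \<in> X" "\<delta> > 0"
    "continuous_on (T \<times> X) (\<lambda>(z, x). B z x)"
    "\<forall>z\<in>T. \<forall>x\<in>X. B z x \<noteq> 0"
    "\<forall>z\<in>T. \<forall>x\<in>X. ((\<lambda>z. B z x) has_field_derivative - (a' z * x + b' z) / (2 * B z x)) (at z)"
    "\<forall>z\<in>T. \<forall>x\<in>X. ((\<lambda>x. B z x) has_field_derivative (12 * x ^ 2 - a z) / (2 * B z x)) (at x)"
    "\<forall>z\<in>T. \<forall>s\<in>{0..1}. \<bar>s - s0\<bar> < \<delta> \<longrightarrow> Y s z = B z (\<gamma> s)"
proof -
  define y0 where "y0 = Y s0 z0"
  have y0: "y0 \<noteq> 0" using Y_nz z0 s0 by (simp add: y0_def)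
  define q where "q z x = (4 * x ^ 3 - a z * x - b z) / y0 ^ 2" for z x
  define B where "B z x = y0 * csqrt (q z x)" for z x
  have contq: "continuous_on (N \<times> UNIV) (\<lambda>p. q (fst p) (snd p))"
    unfolding q_def
    by (intro continuous_intros continuous_on_compose2[OF cont_a] continuous_on_compose2[OF cont_b])
      (use y0 in auto)
  define W where "W = (N \<times> UNIV) \<inter> (\<lambda>p. q (fst p) (snd p)) -` {w. Re w > 0}"
  have "open W"
    unfolding W_def
    by (rule continuous_open_preimage[OF contq]) (auto intro: openN open_Times open_halfspace_Re_gt)
  moreover have "q z0 (\<gamma> s0) = 1"
    unfolding q_def Y_sq[OF s0 z0, symmetric] using y0 by (simp add: y0_def)
  then have "(z0, \<gamma> s0) \<in> W" using z0 by (simp add: W_def)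
  ultimately obtain T1 X where T1: "open T1" "open X" "z0 \<in> T1" "\<gamma> s0 \<in> X" "T1 \<times> X \<subseteq> W"
    by (rule open_prod_elim) auto
  \<comment> \<open>Continuity keeps \<open>Y\<close> within distance \<open>norm y0\<close> of
    \<open>y0\<close>, as \<open>csqrt_eq_divide\<close> requires; time and parameter each get half
    of \<open>d\<close>.\<close>
  obtain d where d: "d > 0" "\<And>p. \<lbrakk>p \<in> {0..1} \<times> N; dist p (s0, z0) < d\<rbrakk> \<Longrightarrow>
      dist (case p of (s, z) \<Rightarrow> Y s z) (Y s0 z0) < norm y0"
    using contY[unfolded continuous_on_iff, rule_format, of "(s0, z0)" "norm y0"] s0 z0 y0 by auto
  define T where "T = T1 \<inter> N \<inter> ball z0 (d / 2)"
  have T: "open T" "z0 \<in> T" "T \<subseteq> N" using T1 openN z0 d by (auto simp: T_def)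
  have pos: "Re (q z x) > 0" if "z \<in> T" "x \<in> X" for z x
    using T1(5) that by (auto simp: T_def W_def)
  have nn: "q z x \<notin> \<real>\<^sub>\<le>\<^sub>0" if "z \<in> T" "x \<in> X" for z x
    using pos[OF that] by (rule Re_pos_not_nonpos_Reals)
  have nz: "csqrt (q z x) \<noteq> 0" if "z \<in> T" "x \<in> X" for z x
    using pos[OF that] by auto
  show ?thesis
  proof (rule that[of T X "d / 2" B])
    have "continuous_on (T \<times> X) (\<lambda>p. B (fst p) (snd p))"
      unfolding B_def
      by (intro continuous_intros continuous_on_csqrt_Re continuous_on_subset[OF contq])
        (use T pos in auto)
    then show "continuous_on (T \<times> X) (\<lambda>(z, x). B z x)" by (simp add: case_prod_beta)
  next
    show "\<forall>z\<in>T. \<forall>x\<in>X. B z x \<noteq> 0"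
      using nz y0 by (auto simp: B_def)
  next
    show "\<forall>z\<in>T. \<forall>x\<in>X. ((\<lambda>z. B z x) has_field_derivative - (a' z * x + b' z) / (2 * B z x)) (at z)"
    proof (intro ballI)
      fix z x assume zx: "z \<in> T" "x \<in> X"
      have "((\<lambda>z. q z x) has_field_derivative - (a' z * x + b' z) / y0 ^ 2) (at z)"
        unfolding q_def
        by (rule DERIV_cdivide) (use zx T in \<open>auto intro!: derivative_eq_intros da db\<close>)
      from DERIV_cmult[OF has_field_derivative_csqrt'[OF this nn[OF zx]], of y0]
      show "((\<lambda>z. B z x) has_field_derivative - (a' z * x + b' z) / (2 * B z x)) (at z)"
        unfolding B_def by (rule DERIV_cong) (use y0 nz[OF zx] in \<open>simp add: field_simps power2_eq_square\<close>)
    qed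
  next
    show "\<forall>z\<in>T. \<forall>x\<in>X. ((\<lambda>x. B z x) has_field_derivative (12 * x ^ 2 - a z) / (2 * B z x)) (at x)"
    proof (intro ballI)
      fix z x assume zx: "z \<in> T" "x \<in> X"
      have "((\<lambda>x. q z x) has_field_derivative (12 * x ^ 2 - a z) / y0 ^ 2) (at x)"
        unfolding q_def
        by (rule DERIV_cdivide) (auto intro!: derivative_eq_intros)
      from DERIV_cmult[OF has_field_derivative_csqrt'[OF this nn[OF zx]], of y0]
      show "((\<lambda>x. B z x) has_field_derivative (12 * x ^ 2 - a z) / (2 * B z x)) (at x)"
        unfolding B_def by (rule DERIV_cong) (use y0 nz[OF zx] in \<open>simp add: field_simps power2_eq_square\<close>)
    qed
  next
    show "\<forall>z\<in>T. \<forall>s\<in>{0..1}. \<bar>s - s0\<bar> < d / 2 \<longrightarrow> Y s z = B z (\<gamma> s)"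
    proof (intro ballI impI)
      fix z s assume z: "z \<in> T" and s: "s \<in> {0..1}" "\<bar>s - s0\<bar> < d / 2"
      have "dist (s, z) (s0, z0) \<le> dist s s0 + dist z z0"
        unfolding dist_Pair_Pair by (rule sqrt_sum_squares_le_sum) auto
      also have "\<dots> < d" using z s by (simp add: T_def dist_real_def dist_commute)
      finally have "dist (Y s z) y0 < norm y0"
        using d(2)[of "(s, z)"] z s T by (auto simp: y0_def)
      then show "Y s z = B z (\<gamma> s)"
        unfolding B_def q_def
        by (intro csqrt_eq_divide[symmetric] y0) (use Y_sq s z T in \<open>auto simp: dist_norm\<close>)
    qed
  qed (use T T1 d in auto)
qed

text \<open>A general numerator and exponent cover the period (\<open>A = 1\<close>,
  \<open>m = 1\<close>) and its derivative (\<open>A = (a' x + b') / 2\<close>,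
  \<open>m = 3\<close>) alike.\<close>

lemma family:
  assumes dA: "\<And>z x. z \<in> N \<Longrightarrow> ((\<lambda>z. A z x) has_field_derivative A' z x) (at z)"
    and hA: "\<And>z. z \<in> N \<Longrightarrow> A z holomorphic_on UNIV" and hA': "\<And>z. z \<in> N \<Longrightarrow> A' z holomorphic_on UNIV"
    and cA: "continuous_on (N \<times> UNIV) (\<lambda>p. A (fst p) (snd p))"
    and cA': "continuous_on (N \<times> UNIV) (\<lambda>p. A' (fst p) (snd p))"
  shows "holo_family N \<gamma> (\<lambda>z s. A z (\<gamma> s) / Y s z ^ m)
    (\<lambda>z s. A' z (\<gamma> s) / Y s z ^ m + of_nat m / 2 * A z (\<gamma> s) * (a' z * \<gamma> s + b' z) / Y s z ^ (m + 2))"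
  unfolding holo_family_def
proof (intro ballI)
  fix z0 :: complex and s0 :: real assume zs0: "z0 \<in> N" "s0 \<in> {0..1}"
  obtain T X \<delta> B where T: "open T" "z0 \<in> T" "T \<subseteq> N" "open X" "\<gamma> s0 \<in> X" "\<delta> > 0"
    and cB: "continuous_on (T \<times> X) (\<lambda>(z, x). B z x)"
    and B: "\<forall>z\<in>T. \<forall>x\<in>X. B z x \<noteq> 0"
    "\<forall>z\<in>T. \<forall>x\<in>X. ((\<lambda>z. B z x) has_field_derivative - (a' z * x + b' z) / (2 * B z x)) (at z)"
    "\<forall>z\<in>T. \<forall>x\<in>X. ((\<lambda>x. B z x) has_field_derivative (12 * x ^ 2 - a z) / (2 * B z x)) (at x)"
    "\<forall>z\<in>T. \<forall>s\<in>{0..1}. \<bar>s - s0\<bar> < \<delta> \<longrightarrow> Y s z = B z (\<gamma> s)"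
    by (rule local_branch[OF zs0])
  have hB: "B z holomorphic_on X" if "z \<in> T" for z
    using B(3) T(4) that by (auto simp: holomorphic_on_open)
  have cB': "continuous_on (T \<times> X) (\<lambda>p. B (fst p) (snd p))"
    using cB by (simp add: case_prod_beta)
  have hA1: "A z holomorphic_on X" "A' z holomorphic_on X" if "z \<in> T" for z
    using hA hA' that T by (auto intro: holomorphic_on_subset)
  show "\<exists>T X \<delta> H H'. open T \<and> z0 \<in> T \<and> open X \<and> \<gamma> s0 \<in> X \<and> 0 < \<delta> \<and>
      (\<forall>t\<in>T. H t holomorphic_on X \<and> H' t holomorphic_on X) \<and>
      (\<forall>x\<in>X. \<forall>t\<in>T. ((\<lambda>t. H t x) has_field_derivative H' t x) (at t)) \<and>
      continuous_on (T \<times> X) (\<lambda>(t, x). H' t x) \<and>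
      (\<forall>s\<in>{0..1}. \<bar>s - s0\<bar> < \<delta> \<longrightarrow> (\<forall>t\<in>T. A t (\<gamma> s) / Y s t ^ m = H t (\<gamma> s) \<and>
            A' t (\<gamma> s) / Y s t ^ m + of_nat m / 2 * A t (\<gamma> s) * (a' t * \<gamma> s + b' t) / Y s t ^ (m + 2)
              = H' t (\<gamma> s)))"
  proof (rule exI[of _ T], rule exI[of _ X], rule exI[of _ \<delta>],
      rule exI[of _ "\<lambda>z x. A z x / B z x ^ m"],
      rule exI[of _ "\<lambda>z x. A' z x / B z x ^ m + of_nat m / 2 * A z x * (a' z * x + b' z) / B z x ^ (m + 2)"],
      intro conjI T ballI impI)
    fix z assume z: "z \<in> T"
    show "(\<lambda>x. A z x / B z x ^ m) holomorphic_on X"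
      "(\<lambda>x. A' z x / B z x ^ m + of_nat m / 2 * A z x * (a' z * x + b' z) / B z x ^ (m + 2)) holomorphic_on X"
      using z B(1) by (auto intro!: holomorphic_intros hA1 hB)
  next
    fix x z assume xz: "x \<in> X" "z \<in> T"
    let ?y = "B z x"
    have y: "?y \<noteq> 0" using B xz by blast
    have 1: "((\<lambda>z. inverse (B z x ^ m)) has_field_derivative
        of_nat m / 2 * (a' z * x + b' z) / ?y ^ (m + 2)) (at z)"
    proof (cases m)
      case (Suc n)
      have D: "((\<lambda>z. B z x ^ Suc n) has_field_derivative
          of_nat (Suc n) * (- (a' z * x + b' z) / (2 * ?y) * ?y ^ (Suc n - Suc 0))) (at z)"
        using B(2) xz by (intro DERIV_power) auto
      have "?y ^ Suc n \<noteq> 0" using y by simp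
      from DERIV_inverse'[OF D this] y show ?thesis
        unfolding Suc by (elim DERIV_cong) (simp add: field_simps del: of_nat_Suc)
    qed simp
    have "((\<lambda>z. A z x * inverse (B z x ^ m)) has_field_derivative
       A' z x * inverse (?y ^ m) + of_nat m / 2 * (a' z * x + b' z) / ?y ^ (m + 2) * A z x) (at z)"
      by (rule DERIV_mult[OF dA 1]) (use xz T in auto)
    then have "((\<lambda>z. A z x * inverse (B z x ^ m)) has_field_derivative
       A' z x / ?y ^ m + of_nat m / 2 * A z x * (a' z * x + b' z) / ?y ^ (m + 2)) (at z)"
      by (rule DERIV_cong) (simp add: inverse_eq_divide)
    then show "((\<lambda>z. A z x / B z x ^ m) has_field_derivative
       A' z x / ?y ^ m + of_nat m / 2 * A z x * (a' z * x + b' z) / ?y ^ (m + 2)) (at z)"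
      by (simp only: divide_inverse[of "A _ _" "B _ _ ^ m"])
  next
    have "continuous_on (T \<times> X) (\<lambda>p. A' (fst p) (snd p) / B (fst p) (snd p) ^ m
       + of_nat m / 2 * A (fst p) (snd p) * (a' (fst p) * (snd p) + b' (fst p)) / B (fst p) (snd p) ^ (m + 2))"
      by (intro continuous_intros continuous_on_subset[OF cA] continuous_on_subset[OF cA'] cB'
          continuous_on_compose2[OF cont_a'] continuous_on_compose2[OF cont_b'])
        (use T B in auto)
    then show "continuous_on (T \<times> X) (\<lambda>(z, x). A' z x / B z x ^ m
       + of_nat m / 2 * A z x * (a' z * x + b' z) / B z x ^ (m + 2))"
      by (simp add: case_prod_beta)
  qed (use B in auto)
qed

text \<open>The integrand is \<open>d (q / Y^m)\<close>, by
  \<open>dY/dx = (12 x^2 - a) / (2 Y)\<close>; both the loop and \<open>Y\<close> close up.\<close>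

lemma exact:
  assumes z: "z \<in> N" and dq: "\<And>x. (q has_field_derivative q' x) (at x)"
  shows "((\<lambda>s. (q' (\<gamma> s) / Y s z ^ m - of_nat m / 2 * q (\<gamma> s) * (12 * \<gamma> s ^ 2 - a z) / Y s z ^ (m + 2))
     * velocity \<gamma> s) has_integral 0) {0..1}"
proof -
  have "((\<lambda>s. (q' (\<gamma> s) / Y s z ^ m - of_nat m / 2 * q (\<gamma> s) * (12 * \<gamma> s ^ 2 - a z) / Y s z ^ (m + 2))
     * velocity \<gamma> s) has_integral
     q (\<gamma> 1) / Y 1 z ^ m - q (\<gamma> 0) / Y 0 z ^ m) {0..1}"
  proof (rule path_integral_exact[OF path])
    fix s0 :: real assume s0: "s0 \<in> {0..1}"
    obtain T X \<delta> B where T: "open T" "z \<in> T" "T \<subseteq> N" "open X" "\<gamma> s0 \<in> X" "\<delta> > 0"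
      and B: "\<forall>z\<in>T. \<forall>x\<in>X. B z x \<noteq> 0"
      "\<forall>z\<in>T. \<forall>x\<in>X. ((\<lambda>x. B z x) has_field_derivative (12 * x ^ 2 - a z) / (2 * B z x)) (at x)"
      "\<forall>z\<in>T. \<forall>s\<in>{0..1}. \<bar>s - s0\<bar> < \<delta> \<longrightarrow> Y s z = B z (\<gamma> s)"
      by (rule local_branch[OF z s0])
    show "\<exists>X \<delta> G f. open X \<and> \<gamma> s0 \<in> X \<and> 0 < \<delta> \<and>
      (\<forall>x\<in>X. (G has_field_derivative f x) (at x)) \<and>
      (\<forall>s\<in>{0..1}. \<bar>s - s0\<bar> < \<delta> \<longrightarrow> q (\<gamma> s) / Y s z ^ m = G (\<gamma> s) \<and>
         q' (\<gamma> s) / Y s z ^ m - of_nat m / 2 * q (\<gamma> s) * (12 * \<gamma> s ^ 2 - a z) / Y s z ^ (m + 2) = f (\<gamma> s))"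
    proof (rule exI[of _ X], rule exI[of _ \<delta>], rule exI[of _ "\<lambda>x. q x / B z x ^ m"],
        rule exI[of _ "\<lambda>x. q' x / B z x ^ m - of_nat m / 2 * q x * (12 * x ^ 2 - a z) / B z x ^ (m + 2)"],
        intro conjI T ballI impI)
      fix x assume x: "x \<in> X"
      let ?y = "B z x"
      have y: "?y \<noteq> 0" using B x T by blast
      have 1: "((\<lambda>x. inverse (B z x ^ m)) has_field_derivative
        - (of_nat m / 2 * (12 * x ^ 2 - a z) / ?y ^ (m + 2))) (at x)"
      proof (cases m)
        case (Suc n)
        have D: "((\<lambda>x. B z x ^ Suc n) has_field_derivative
            of_nat (Suc n) * ((12 * x ^ 2 - a z) / (2 * ?y) * ?y ^ (Suc n - Suc 0))) (at x)"
          using B(2) x T by (intro DERIV_power) auto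
        have "?y ^ Suc n \<noteq> 0" using y by simp
        from DERIV_inverse'[OF D this] y show ?thesis
          unfolding Suc by (elim DERIV_cong) (simp add: field_simps del: of_nat_Suc)
      qed simp
      have "((\<lambda>x. q x * inverse (B z x ^ m)) has_field_derivative
         q' x / ?y ^ m - of_nat m / 2 * q x * (12 * x ^ 2 - a z) / ?y ^ (m + 2)) (at x)"
        by (rule DERIV_cong[OF DERIV_mult[OF dq 1]]) (simp add: inverse_eq_divide)
      then show "((\<lambda>x. q x / B z x ^ m) has_field_derivative
         q' x / ?y ^ m - of_nat m / 2 * q x * (12 * x ^ 2 - a z) / ?y ^ (m + 2)) (at x)"
        by (simp only: divide_inverse[of "q _" "B _ _ ^ m"])
    qed (use B T in auto)
  qed
  then show ?thesis using closed Y_closed[OF z] by simp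
qed

text \<open>The exponent \<open>1\<close> keeps the integrand literally an instance of
  \<open>family\<close> and \<open>exact\<close>.\<close>

definition period :: "complex \<Rightarrow> complex" where
  "period z = integral {0..1} (\<lambda>s. 1 / Y s z ^ 1 * velocity \<gamma> s)"

definition period1 :: "complex \<Rightarrow> complex" where
  "period1 z = integral {0..1} (\<lambda>s. (a' z * \<gamma> s + b' z) / 2 / Y s z ^ 3 * velocity \<gamma> s)"

lemma period_family: "holo_family N \<gamma> (\<lambda>z s. 1 / Y s z ^ 1) (\<lambda>z s. (a' z * \<gamma> s + b' z) / 2 / Y s z ^ 3)"
proof -
  have "holo_family N \<gamma> (\<lambda>z s. 1 / Y s z ^ 1)
    (\<lambda>z s. 0 / Y s z ^ 1 + of_nat 1 / 2 * 1 * (a' z * \<gamma> s + b' z) / Y s z ^ (1 + 2))"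
    by (rule family[where A = "\<lambda>_ _. 1"]) (auto intro!: derivative_eq_intros continuous_intros holomorphic_intros)
  then show ?thesis by (simp add: numeral_3_eq_3)
qed

lemma period_deriv: "z \<in> N \<Longrightarrow> (period has_field_derivative period1 z) (at z)"
  unfolding period_def period1_def by (rule holo_family_deriv(3)[OF path period_family])

lemma period_holomorphic: "period holomorphic_on N"
  using period_deriv openN by (auto simp: holomorphic_on_open)

lemma period_has_integral:
  assumes "z \<in> N"
  shows "((\<lambda>s. 1 / Y s z ^ 1 * velocity \<gamma> s) has_integral period z) {0..1}"
    "((\<lambda>s. (a' z * \<gamma> s + b' z) / 2 / Y s z ^ 3 * velocity \<gamma> s)
       has_integral period1 z) {0..1}"
  unfolding period_def period1_def
  using holo_family_deriv(1,2)[OF path period_family assms] by (simp_all add: integrable_integral)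

end

locale elliptic_loop2 = elliptic_loop +
  fixes a'' b'' :: "complex \<Rightarrow> complex"
  assumes da': "\<And>z. z \<in> N \<Longrightarrow> (a' has_field_derivative a'' z) (at z)"
    and db': "\<And>z. z \<in> N \<Longrightarrow> (b' has_field_derivative b'' z) (at z)"
    and cont_a'': "continuous_on N a''" and cont_b'': "continuous_on N b''"
begin

definition period2 :: "complex \<Rightarrow> complex" where
  "period2 z = integral {0..1} (\<lambda>s. ((a'' z * \<gamma> s + b'' z) / 2 / Y s z ^ 3
     + 3 / 4 * (a' z * \<gamma> s + b' z) ^ 2 / Y s z ^ 5) * velocity \<gamma> s)"

lemma period1_family: "holo_family N \<gamma> (\<lambda>z s. (a' z * \<gamma> s + b' z) / 2 / Y s z ^ 3)
  (\<lambda>z s. (a'' z * \<gamma> s + b'' z) / 2 / Y s z ^ 3 + 3 / 4 * (a' z * \<gamma> s + b' z) ^ 2 / Y s z ^ 5)"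
proof -
  have "holo_family N \<gamma> (\<lambda>z s. (a' z * \<gamma> s + b' z) / 2 / Y s z ^ 3)
    (\<lambda>z s. (a'' z * \<gamma> s + b'' z) / 2 / Y s z ^ 3
      + of_nat 3 / 2 * ((a' z * \<gamma> s + b' z) / 2) * (a' z * \<gamma> s + b' z) / Y s z ^ (3 + 2))"
  proof (rule family[where A = "\<lambda>z x. (a' z * x + b' z) / 2"])
    show "continuous_on (N \<times> UNIV) (\<lambda>p. (a' (fst p) * snd p + b' (fst p)) / 2)"
      "continuous_on (N \<times> UNIV) (\<lambda>p. (a'' (fst p) * snd p + b'' (fst p)) / 2)"
      by (intro continuous_intros continuous_on_compose2[OF cont_a'] continuous_on_compose2[OF cont_b']
          continuous_on_compose2[OF cont_a''] continuous_on_compose2[OF cont_b'']; auto)+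
  qed (auto intro!: derivative_eq_intros holomorphic_intros da' db')
  then show ?thesis by (simp add: power2_eq_square mult_ac)
qed

lemma period1_deriv: "z \<in> N \<Longrightarrow> (period1 has_field_derivative period2 z) (at z)"
  unfolding period1_def period2_def by (rule holo_family_deriv(3)[OF path period1_family])

text \<open>Over the denominator \<open>Y^5\<close>, and with \<open>Y^2\<close> replaced by the
  cubic, the combination of the three integrands has a polynomial numerator. The hypothesis
  \<open>cert\<close> identifies it with the numerator of \<open>d (q / Y^3)\<close>.\<close>

lemma period_ode:
  assumes z: "z \<in> N" and dq: "\<And>x. (q has_field_derivative q' x) (at x)"
    and cert: "\<And>x. p2 * ((a'' z * x + b'' z) / 2 * (4 * x ^ 3 - a z * x - b z) + 3 / 4 * (a' z * x + b' z) ^ 2)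
        + p1 * ((a' z * x + b' z) / 2) * (4 * x ^ 3 - a z * x - b z) + p0 * (4 * x ^ 3 - a z * x - b z) ^ 2
      = q' x * (4 * x ^ 3 - a z * x - b z) - 3 / 2 * q x * (12 * x ^ 2 - a z)"
  shows "p2 * period2 z + p1 * period1 z + p0 * period z = 0"
proof -
  let ?d = "\<lambda>s. velocity \<gamma> s"
  have 2: "((\<lambda>s. ((a'' z * \<gamma> s + b'' z) / 2 / Y s z ^ 3
     + 3 / 4 * (a' z * \<gamma> s + b' z) ^ 2 / Y s z ^ 5) * ?d s) has_integral period2 z) {0..1}"
    unfolding period2_def using holo_family_deriv(2)[OF path period1_family z] by (simp add: integrable_integral)
  have "((\<lambda>s. p2 * (((a'' z * \<gamma> s + b'' z) / 2 / Y s z ^ 3 + 3 / 4 * (a' z * \<gamma> s + b' z) ^ 2 / Y s z ^ 5) * ?d s)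
     + p1 * ((a' z * \<gamma> s + b' z) / 2 / Y s z ^ 3 * ?d s) + p0 * (1 / Y s z ^ 1 * ?d s)) has_integral
     p2 * period2 z + p1 * period1 z + p0 * period z) {0..1}"
    by (intro has_integral_add has_integral_mult_right 2 period_has_integral z)
  moreover have "((\<lambda>s. p2 * (((a'' z * \<gamma> s + b'' z) / 2 / Y s z ^ 3 + 3 / 4 * (a' z * \<gamma> s + b' z) ^ 2 / Y s z ^ 5) * ?d s)
     + p1 * ((a' z * \<gamma> s + b' z) / 2 / Y s z ^ 3 * ?d s) + p0 * (1 / Y s z ^ 1 * ?d s)) has_integral 0) {0..1}"
  proof (rule has_integral_eq[OF _ exact[OF z dq, of 3]])
    fix s :: real assume s: "s \<in> {0..1}"
    let ?x = "\<gamma> s" and ?y = "Y s z"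
    have y: "?y \<noteq> 0" "4 * ?x ^ 3 - a z * ?x - b z = ?y ^ 2"
      using Y_nz[OF s z] Y_sq[OF s z] by auto
    have e1: "1 / ?y ^ 1 = ?y ^ 4 / ?y ^ 5" "w / ?y ^ 3 = w * ?y ^ 2 / ?y ^ 5" for w
      using y(1) by (simp_all add: field_simps eval_nat_numeral)
    have "p2 * ((a'' z * ?x + b'' z) / 2 / ?y ^ 3 + 3 / 4 * (a' z * ?x + b' z) ^ 2 / ?y ^ 5)
       + p1 * ((a' z * ?x + b' z) / 2 / ?y ^ 3) + p0 * (1 / ?y ^ 1)
      = (p2 * ((a'' z * ?x + b'' z) / 2 * ?y ^ 2 + 3 / 4 * (a' z * ?x + b' z) ^ 2)
        + p1 * ((a' z * ?x + b' z) / 2) * ?y ^ 2 + p0 * (?y ^ 2) ^ 2) / ?y ^ 5"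
      unfolding e1 by (simp add: algebra_simps add_divide_distrib)
    also have "\<dots> = (q' ?x * ?y ^ 2 - 3 / 2 * q ?x * (12 * ?x ^ 2 - a z)) / ?y ^ 5"
      using cert[of ?x] unfolding y(2) by (simp only:)
    also have "\<dots> = q' ?x / ?y ^ 3 - of_nat 3 / 2 * q ?x * (12 * ?x ^ 2 - a z) / ?y ^ (3 + 2)"
      unfolding e1(2) by (simp add: diff_divide_distrib)
    finally have e: "q' ?x / ?y ^ 3 - of_nat 3 / 2 * q ?x * (12 * ?x ^ 2 - a z) / ?y ^ (3 + 2)
      = p2 * ((a'' z * ?x + b'' z) / 2 / ?y ^ 3 + 3 / 4 * (a' z * ?x + b' z) ^ 2 / ?y ^ 5)
       + p1 * ((a' z * ?x + b' z) / 2 / ?y ^ 3) + p0 * (1 / ?y ^ 1)" by (rule sym)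
    show "(q' ?x / ?y ^ 3 - of_nat 3 / 2 * q ?x * (12 * ?x ^ 2 - a z) / ?y ^ (3 + 2)) * ?d s
      = p2 * (((a'' z * ?x + b'' z) / 2 / ?y ^ 3 + 3 / 4 * (a' z * ?x + b' z) ^ 2 / ?y ^ 5) * ?d s)
         + p1 * ((a' z * ?x + b' z) / 2 / ?y ^ 3 * ?d s) + p0 * (1 / ?y ^ 1 * ?d s)"
      unfolding e by (simp only: distrib_right mult.assoc)
  qed
  ultimately show ?thesis by (rule has_integral_unique)
qed

end

section \<open>Gauss's equation for the four Weierstrass families\<close>

definition g2' :: "nat \<Rightarrow> complex \<Rightarrow> complex" where
  "g2' n t = (if n = 1 then 0 else if n = 2 then - 4 else if n = 3 then - 24 else 1/3 * (8 * t - 64))"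

definition g3' :: "nat \<Rightarrow> complex \<Rightarrow> complex" where
  "g3' n t = (if n = 1 then 2 else if n = 2 then 8/3 else if n = 3 then - 36 + 16 * t
    else 8/27 * (- 96 + 60 * t + 3 * t^2))"

definition g2'' :: "nat \<Rightarrow> complex" where
  "g2'' n = (if n = 1 then 0 else if n = 2 then 0 else if n = 3 then 0 else 8/3)"

definition g3'' :: "nat \<Rightarrow> complex \<Rightarrow> complex" where
  "g3'' n t = (if n = 1 then 0 else if n = 2 then 0 else if n = 3 then 16 else 8/27 * (60 + 6 * t))"

lemma g_deriv:
  "(g2 n has_field_derivative g2' n t) (at t)" "(g3 n has_field_derivative g3' n t) (at t)"
  "(g2' n has_field_derivative g2'' n) (at t)" "(g3' n has_field_derivative g3'' n t) (at t)"
  unfolding g2_def[abs_def] g3_def[abs_def] g2'_def[abs_def] g3'_def[abs_def] g2''_def g3''_def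
  by (auto intro!: derivative_eq_intros simp: field_simps power2_eq_square)

lemma g_continuous:
  "continuous_on A (g2 n)" "continuous_on A (g3 n)" "continuous_on A (g2' n)" "continuous_on A (g3' n)"
  "continuous_on A (g3'' n)"
proof -
  show "continuous_on A (g2 n)" "continuous_on A (g3 n)" "continuous_on A (g2' n)" "continuous_on A (g3' n)"
    by (auto intro!: continuous_at_imp_continuous_on DERIV_isCont g_deriv)
  show "continuous_on A (g3'' n)"
    unfolding g3''_def[abs_def]
    by (cases "n = 1 \<or> n = 2"; cases "n = 3") (auto intro!: continuous_intros)
qed

text \<open>The exact form \<open>d (q / y\<^sup>3)\<close> that realizes the Picard-Fuchs operator in the Gauss-Manin
  system, found by solving for the coefficients of \<open>q\<close>; \<open>L\<close> is the scale of \<open>x\<close>.\<close>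

definition cert :: "nat \<Rightarrow> complex \<Rightarrow> complex \<Rightarrow> complex \<Rightarrow> complex" where
  "cert n L t x = (if n = 1 then 1/6 * L^4 + (1/9 - 2/9 * t) * L^3 * x - 7/6 * L^2 * x^2 + 10/9 * x^4
    else if n = 2 then 2/9 * t * L^4 + (8/9 - 2/3 * t) * L^3 * x + (t/2 - 2) * L^2 * x^2 + 3/2 * x^4
    else if n = 3 then 8/3 * t^2 * L^4 + (- 12 + 8 * t + 16/9 * t^2) * L^3 * x
      + (- 12 + 16/3 * t) * L^2 * x^2 + 16/9 * x^4
    else 8/9 * t^3 * L^4 + (- 256/27 + 64/9 * t + 8/9 * t^2 + 8/27 * t^3) * L^3 * x
      + (- 32/3 + 16/3 * t + 2/3 * t^2) * L^2 * x^2 + 2 * x^4)"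

definition cert' :: "nat \<Rightarrow> complex \<Rightarrow> complex \<Rightarrow> complex \<Rightarrow> complex" where
  "cert' n L t x = (if n = 1 then (1/9 - 2/9 * t) * L^3 - 7/3 * L^2 * x + 40/9 * x^3
    else if n = 2 then (8/9 - 2/3 * t) * L^3 + (t - 4) * L^2 * x + 6 * x^3
    else if n = 3 then (- 12 + 8 * t + 16/9 * t^2) * L^3
      + (- 24 + 32/3 * t) * L^2 * x + 64/9 * x^3
    else (- 256/27 + 64/9 * t + 8/9 * t^2 + 8/27 * t^3) * L^3
      + (- 64/3 + 32/3 * t + 4/3 * t^2) * L^2 * x + 8 * x^3)"

lemma cert_deriv: "(cert n L t has_field_derivative cert' n L t x) (at x)"
  unfolding cert_def[abs_def] cert'_def
  by (auto intro!: derivative_eq_intros simp: field_simps power2_eq_square power3_eq_cube)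

text \<open>The coefficients are those of
  \<open>t (1 - t) f'' + (1 - 2 t) f' - \<mu> (1 - \<mu>) f = 0\<close>. In each family this is a
  polynomial identity in \<open>t\<close>, \<open>x\<close> and \<open>L\<close>, homogeneous when
  \<open>x\<close> and \<open>L\<close> have weight one, and expansion verifies it.\<close>

lemma cert_identity:
  assumes R_def: "R = 4 * x ^ 3 - L ^ 2 * g2 n t * x - L ^ 3 * g3 n t"
  shows "t * (1 - t) * ((L ^ 2 * g2'' n * x + L ^ 3 * g3'' n t) / 2 * R
      + 3 / 4 * (L ^ 2 * g2' n t * x + L ^ 3 * g3' n t) ^ 2)
    + (1 - 2 * t) * ((L ^ 2 * g2' n t * x + L ^ 3 * g3' n t) / 2) * R + (- (mu n * (1 - mu n))) * R ^ 2
    = cert' n L t x * R - 3 / 2 * cert n L t x * (12 * x ^ 2 - L ^ 2 * g2 n t)"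
proof -
  consider "n = 1" | "n = 2" | "n = 3" | "n \<noteq> 1" "n \<noteq> 2" "n \<noteq> 3" by blast
  then show ?thesis
  proof cases
    case 1
    then show ?thesis
      unfolding R_def g2_def g3_def g2'_def g3'_def g2''_def g3''_def cert_def cert'_def mu_def
      by (simp add: eval_nat_numeral) (simp add: field_simps)
  next
    case 2
    then show ?thesis
      unfolding R_def g2_def g3_def g2'_def g3'_def g2''_def g3''_def cert_def cert'_def mu_def
      by (simp add: eval_nat_numeral) (simp add: field_simps)
  next
    case 3
    then show ?thesis
      unfolding R_def g2_def g3_def g2'_def g3'_def g2''_def g3''_def cert_def cert'_def mu_def
      by (simp add: eval_nat_numeral) (simp add: field_simps)
  next
    case 4
    then show ?thesis
      unfolding R_def g2_def g3_def g2'_def g3'_def g2''_def g3''_def cert_def cert'_def mu_def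
      by (simp add: eval_nat_numeral) (simp add: field_simps)
  qed
qed

lemma Theta_order_two:
  assumes "open N" "\<And>z. z \<in> N \<Longrightarrow> (f has_field_derivative f1 z) (at z)"
    "\<And>z. z \<in> N \<Longrightarrow> (f1 has_field_derivative f2 z) (at z)" "t \<in> N"
  shows "Theta [a, b] f t = t * (f1 t + t * f2 t) + (a + b) * t * f1 t + a * b * f t"
proof -
  have d: "deriv f z = f1 z" if "z \<in> N" for z
    using assms(2)[OF that] by (rule DERIV_imp_deriv)
  have "deriv (deriv f) t = deriv f1 t"
    by (rule deriv_cong_open[OF assms(1) d assms(4)])
  also have "\<dots> = f2 t" using assms(3)[OF assms(4)] by (rule DERIV_imp_deriv)
  finally have d2: "deriv (deriv f) t = f2 t" .
  have "f holomorphic_on N" using assms(1,2) by (auto simp: holomorphic_on_open)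
  from deriv_theta_plus[OF assms(1) this assms(4)] show ?thesis
    using d[OF assms(4)] d2 by (simp add: theta_plus_def theta_def algebra_simps)
qed

lemma (in elliptic_loop2) picard_fuchs:
  assumes ab: "a = (\<lambda>t. L ^ 2 * g2 n t)" "b = (\<lambda>t. L ^ 3 * g3 n t)"
      "a' = (\<lambda>t. L ^ 2 * g2' n t)" "b' = (\<lambda>t. L ^ 3 * g3' n t)"
      "a'' = (\<lambda>t. L ^ 2 * g2'' n)" "b'' = (\<lambda>t. L ^ 3 * g3'' n t)"
    and t: "t \<in> N"
  shows "Theta [0, 0] period t = t * Theta [mu n, 1 - mu n] period t"
proof -
  have "t * (1 - t) * period2 t + (1 - 2 * t) * period1 t + (- (mu n * (1 - mu n))) * period t = 0"
    using cert_identity[OF refl, of t L n]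
    by (intro period_ode[OF t cert_deriv[of n L t]]) (simp add: ab mult.assoc)
  \<comment> \<open>\<open>t\<close> times Gauss's expression is exactly the difference of the two
    sides, since \<open>\<theta>^2 f = t f' + t^2 f''\<close>.\<close>
  then have "t * (t * (1 - t) * period2 t + (1 - 2 * t) * period1 t + (- (mu n * (1 - mu n))) * period t) = 0"
    by simp
  then show ?thesis
    using Theta_order_two[of N period period1 period2 t, OF openN period_deriv period1_deriv t]
    by (simp add: algebra_simps del: Theta_simps)
qed

text \<open>Euler's relation for the weighted homogeneity of the periods comes from \<open>d (x / y)\<close>.\<close>

lemma (in elliptic_loop) period_scaling:
  assumes ab: "a = (\<lambda>L. L ^ 2 * A)" "b = (\<lambda>L. L ^ 3 * B)" "a' = (\<lambda>L. 2 * L * A)" "b' = (\<lambda>L. 3 * L ^ 2 * B)"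
    and L: "L \<in> N"
  shows "2 * L * period1 L + period L = 0"
proof -
  let ?d = "\<lambda>s. velocity \<gamma> s"
  have "((\<lambda>s. 2 * L * ((a' L * \<gamma> s + b' L) / 2 / Y s L ^ 3 * ?d s) + 1 / Y s L ^ 1 * ?d s)
      has_integral 2 * L * period1 L + period L) {0..1}"
    by (intro has_integral_add has_integral_mult_right period_has_integral L)
  moreover have "((\<lambda>s. 2 * L * ((a' L * \<gamma> s + b' L) / 2 / Y s L ^ 3 * ?d s) + 1 / Y s L ^ 1 * ?d s)
      has_integral (-2) * 0) {0..1}"
  \<comment> \<open>Over \<open>Y^3\<close> both integrands have the numerator
    \<open>4 x^3 + a x + 2 b\<close>: the combination is \<open>-2 d (x / Y)\<close>.\<close>
  proof (rule has_integral_eq[OF _ has_integral_mult_right[OF exact[OF L, of "\<lambda>x. x" "\<lambda>_. 1" 1]]])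
    fix s :: real assume s: "s \<in> {0..1}"
    let ?x = "\<gamma> s" and ?y = "Y s L"
    have y: "?y \<noteq> 0" "?y ^ 2 = 4 * ?x ^ 3 - a L * ?x - b L"
      using Y_nz[OF s L] Y_sq[OF s L] by auto
    have e: "w / ?y = w * ?y ^ 2 / ?y ^ 3" for w
      using y(1) by (simp add: field_simps eval_nat_numeral)
    have "2 * L * ((a' L * ?x + b' L) / 2 / ?y ^ 3) + 1 / ?y ^ 1
      = (2 * a L * ?x + 3 * b L + ?y ^ 2) / ?y ^ 3"
      unfolding power_one_right e ab by (simp add: add_divide_distrib algebra_simps eval_nat_numeral)
    also have "\<dots> = -2 * (1 / ?y ^ 1 - of_nat 1 / 2 * ?x * (12 * ?x ^ 2 - a L) / ?y ^ (1 + 2))"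
      unfolding power_one_right e y(2)
      by (simp add: diff_divide_distrib[symmetric] add_divide_distrib[symmetric] numeral_3_eq_3[symmetric])
        (simp add: algebra_simps eval_nat_numeral diff_divide_distrib add_divide_distrib)
    finally have *: "-2 * (1 / ?y ^ 1 - of_nat 1 / 2 * ?x * (12 * ?x ^ 2 - a L) / ?y ^ (1 + 2))
      = 2 * L * ((a' L * ?x + b' L) / 2 / ?y ^ 3) + 1 / ?y ^ 1" by (rule sym)
    show "-2 * ((1 / ?y ^ 1 - of_nat 1 / 2 * ?x * (12 * ?x ^ 2 - a L) / ?y ^ (1 + 2)) * ?d s)
      = 2 * L * ((a' L * ?x + b' L) / 2 / ?y ^ 3 * ?d s) + 1 / ?y ^ 1 * ?d s"
      unfolding mult.assoc[symmetric, of "-2"] * by (simp only: distrib_right mult.assoc)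
  qed (auto intro!: derivative_eq_intros)
  ultimately have "2 * L * period1 L + period L = (-2) * 0" by (rule has_integral_unique)
  then show ?thesis by simp
qed

section \<open>Separating scale and modulus\<close>

text \<open>Solutions of \<open>2 L f' + f = 0\<close> are multiples of \<open>L\<close> to the
  power \<open>-1/2\<close>, so the quotient by \<open>csqrt (L0 / L)\<close> has derivative zero.
  The bound on \<open>\<rho>\<close> keeps the ball away from \<open>0\<close> and
  \<open>L0 / L\<close> in the right half-plane.\<close>

lemma csqrt_scaling_unique:
  assumes "L0 \<noteq> 0" "\<rho> \<le> norm L0" "\<And>L. L \<in> ball L0 \<rho> \<Longrightarrow> (f has_field_derivative f1 L) (at L)"
    "\<And>L. L \<in> ball L0 \<rho> \<Longrightarrow> 2 * L * f1 L + f L = 0" "L \<in> ball L0 \<rho>"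
  shows "Re (L0 / L) > 0" "f L = csqrt (L0 / L) * f L0"
proof -
  have pos: "Re (L0 / L) > 0" and nz: "L \<noteq> 0" if "L \<in> ball L0 \<rho>" for L
  proof -
    have "norm (L - L0) < norm L0" using that assms(2) by (simp add: dist_norm norm_minus_commute)
    then have "norm (L / L0 - 1) < 1"
      using assms(1) by (simp add: norm_divide divide_simps flip: diff_divide_eq_iff)
    then have "Re (L / L0) > 0" using abs_Re_le_cmod[of "L / L0 - 1"] by simp
    moreover have "Re (inverse w) > 0" if "Re w > 0" for w
      using that by (simp add: add_pos_nonneg)
    ultimately have "Re (inverse (L / L0)) > 0" by blast
    then show "Re (L0 / L) > 0" by (simp only: inverse_divide)
    show "L \<noteq> 0" using \<open>Re (L0 / L) > 0\<close> by auto
  qed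
  have cs: "csqrt (L0 / L) \<noteq> 0" if "L \<in> ball L0 \<rho>" for L
    using pos[OF that] by auto
  have d: "((\<lambda>L. f L / csqrt (L0 / L)) has_field_derivative 0) (at L)" if L: "L \<in> ball L0 \<rho>" for L
  proof -
    have "((\<lambda>L. L0 / L) has_field_derivative - (L0 / L) / L) (at L)"
      using nz[OF L] by (auto intro!: derivative_eq_intros simp: field_simps power2_eq_square)
    from has_field_derivative_csqrt'[OF this Re_pos_not_nonpos_Reals[OF pos[OF L]]]
    have "((\<lambda>L. csqrt (L0 / L)) has_field_derivative - csqrt (L0 / L) / (2 * L)) (at L)"
    proof (rule DERIV_cong)
      define w where "w = csqrt (L0 / L)"
      have "L0 / L = w * w" "w \<noteq> 0"
        using cs[OF L] by (simp_all add: w_def flip: power2_eq_square)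
      then show "- (L0 / L) / L / (2 * csqrt (L0 / L)) = - csqrt (L0 / L) / (2 * L)"
        unfolding w_def[symmetric] using nz[OF L] by (simp add: field_simps)
    qed
    from DERIV_divide[OF assms(3)[OF L] this cs[OF L]]
    show ?thesis
    proof (rule DERIV_cong)
      have "f1 L * csqrt (L0 / L) - f L * (- csqrt (L0 / L) / (2 * L)) = csqrt (L0 / L) * (2 * L * f1 L + f L) / (2 * L)"
        using nz[OF L] by (simp add: field_simps)
      then show "(f1 L * csqrt (L0 / L) - f L * (- csqrt (L0 / L) / (2 * L)))
        / (csqrt (L0 / L) * csqrt (L0 / L)) = 0"
        using assms(4)[OF L] by simp
    qed
  qed
  obtain c where c: "\<And>L. L \<in> ball L0 \<rho> \<Longrightarrow> f L / csqrt (L0 / L) = c"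
    using has_field_derivative_zero_constant[of "ball L0 \<rho>" "\<lambda>L. f L / csqrt (L0 / L)"] d
    by (meson convex_ball has_field_derivative_at_within)
  have "\<rho> > 0" using assms(5) by (metis ball_eq_empty empty_iff not_le)
  then have "f L / csqrt (L0 / L) = f L0 / csqrt (L0 / L0)"
    using c[OF assms(5)] c[of L0] by simp
  then show "f L = csqrt (L0 / L) * f L0"
    using cs[OF assms(5)] assms(1) by (simp add: field_simps)
  show "Re (L0 / L) > 0" by (rule pos[OF assms(5)])
qed

text \<open>\<open>z\<close> ranges over an arbitrary topological space, so nothing can be
  differentiated in \<open>z\<close>. Instead \<open>Y\<close> is matched with a branch
  \<open>B s L x\<close> in which scale and modulus are independent complex variables. The
  Picard-Fuchs equation in \<open>x\<close> at \<open>L = L0\<close> and Euler's relation in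
  \<open>L\<close> then apply separately; \<open>\<phi>\<close> is the period at scale
  \<open>L0\<close>.\<close>

theorem curve_period_local:
  fixes \<Lambda> S :: "'z::topological_space \<Rightarrow> complex"
  assumes per: "curve_period G2 G3 N P" and z0: "z0 \<in> N"
    and G: "\<And>z. z \<in> N \<Longrightarrow> G2 z = \<Lambda> z ^ 2 * g2 n (S z)" "\<And>z. z \<in> N \<Longrightarrow> G3 z = \<Lambda> z ^ 3 * g3 n (S z)"
    and cont: "continuous_on N \<Lambda>" "continuous_on N S"
  obtains N0 D \<phi> where "openin (top_of_set N) N0" "z0 \<in> N0" "open D" "\<phi> holomorphic_on D"
    "\<forall>x\<in>D. Theta [0, 0] \<phi> x = x * Theta [mu n, 1 - mu n] \<phi> x"
    "\<forall>z\<in>N0. S z \<in> D \<and> Re (\<Lambda> z0 / \<Lambda> z) > 0 \<and> P z = csqrt (\<Lambda> z0 / \<Lambda> z) * \<phi> (S z)"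
proof -
  from per[unfolded curve_period_def, rule_format, OF z0]
  obtain N1 \<gamma> Y where N1: "openin (top_of_set N) N1" "z0 \<in> N1"
    and disc: "\<forall>z\<in>N1. G2 z^3 - 27 * G3 z^2 \<noteq> 0"
    and \<gamma>: "valid_path \<gamma>" "pathfinish \<gamma> = pathstart \<gamma>"
    and contY: "continuous_on ({0..1} \<times> N1) (\<lambda>(s, z). Y s z)"
    and Y: "\<forall>s\<in>{0..1}. \<forall>z\<in>N1. Y s z \<noteq> 0 \<and> Y s z^2 = 4 * \<gamma> s^3 - G2 z * \<gamma> s - G3 z"
    and Yc: "\<forall>z\<in>N1. Y 1 z = Y 0 z"
    and P: "\<forall>z\<in>N1. P z = integral {0..1} (\<lambda>s. velocity \<gamma> s / Y s z)"
    by (elim exE conjE)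
  have N1N: "N1 \<subseteq> N" using N1(1) openin_imp_subset by blast
  have c\<gamma>: "continuous_on {0..1} \<gamma>"
    using \<gamma> by (simp add: valid_path_def piecewise_C1_differentiable_on_def)
  define L0 S0 where "L0 = \<Lambda> z0" and "S0 = S z0"
  have L0: "L0 \<noteq> 0"
    using disc N1 G[OF z0] by (auto simp: L0_def)
  define y0 where "y0 s = Y s z0" for s
  have y0: "y0 s \<noteq> 0" "y0 s ^ 2 = 4 * \<gamma> s ^ 3 - L0 ^ 2 * g2 n S0 * \<gamma> s - L0 ^ 3 * g3 n S0"
    if "s \<in> {0..1}" for s
    using Y N1 that G[OF z0] by (auto simp: y0_def L0_def S0_def)
  have cy0: "continuous_on {0..1} y0"
    unfolding y0_def
    by (rule continuous_on_compose2[OF contY, of _ "\<lambda>s. (s, z0)", simplified])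
      (use N1 in \<open>auto intro!: continuous_intros\<close>)
  define R where "R s L x = 4 * \<gamma> s ^ 3 - L ^ 2 * g2 n x * \<gamma> s - L ^ 3 * g3 n x" for s L x
  define q where "q s L x = R s L x / y0 s ^ 2" for s L x
  have contR: "continuous_on ({0..1} \<times> UNIV) (\<lambda>p. R (fst p) (fst (snd p)) (snd (snd p)))"
    unfolding R_def
    by (intro continuous_intros continuous_on_compose2[OF c\<gamma>] continuous_on_compose2[OF g_continuous(1)[of UNIV]]
        continuous_on_compose2[OF g_continuous(2)[of UNIV]]) auto
  have contq: "continuous_on ({0..1} \<times> UNIV) (\<lambda>p. q (fst p) (fst (snd p)) (snd (snd p)))"
    unfolding q_def
    by (intro continuous_intros contR continuous_on_compose2[OF cy0]) (use y0 in auto)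
  have q0: "q s L0 S0 = 1" if "s \<in> {0..1}" for s
    unfolding q_def R_def y0(2)[OF that, symmetric] using y0(1)[OF that] by simp
  \<comment> \<open>Compactness of \<open>{0..1}\<close> keeps \<open>q\<close> within
    \<open>1/2\<close> of its value \<open>1\<close> uniformly along the loop, so a single product
    neighbourhood of \<open>(L0, S0)\<close> carries the branch \<open>B\<close>.\<close>
  have "continuous_on (UNIV \<times> {0..1}) (\<lambda>p. q (snd p) (fst (fst p)) (snd (fst p)))"
    by (rule continuous_on_compose2[OF contq, of _ "\<lambda>p. (snd p, fst p)", simplified])
      (auto intro!: continuous_intros)
  then obtain X0 where X0: "(L0, S0) \<in> X0" "open X0"
    "\<forall>x\<in>X0 \<inter> UNIV. \<forall>s\<in>{0..1}. dist (q s (fst x) (snd x)) (q s L0 S0) \<le> 1 / 2"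
    by (rule continuous_on_prod_compactE[where ?x0.0 = "(L0, S0)" and e = "1/2"]) (auto simp: fst_conv snd_conv)
  obtain A1 A2 where A: "open A1" "open A2" "(L0, S0) \<in> A1 \<times> A2" "A1 \<times> A2 \<subseteq> X0"
    using open_prod_elim[OF X0(2,1)] by blast
  obtain \<rho>1 where \<rho>1: "\<rho>1 > 0" "ball L0 \<rho>1 \<subseteq> A1" using A open_contains_ball by blast
  define \<rho> where "\<rho> = min \<rho>1 (norm L0)"
  have \<rho>: "\<rho> > 0" "\<rho> \<le> norm L0" "ball L0 \<rho> \<subseteq> A1" using \<rho>1 L0 by (auto simp: \<rho>_def)
  have qpos: "Re (q s L x) > 0" if "s \<in> {0..1}" "L \<in> A1" "x \<in> A2" for s L x
  proof -
    have "dist (q s L x) 1 \<le> 1 / 2"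
      using X0(3) A(4) q0[OF that(1)] that by force
    then show ?thesis using abs_Re_le_cmod[of "q s L x - 1"] by (simp add: dist_norm)
  qed
  define B where "B s L x = y0 s * csqrt (q s L x)" for s L x
  have contB: "continuous_on ({0..1} \<times> (A1 \<times> A2)) (\<lambda>p. B (fst p) (fst (snd p)) (snd (snd p)))"
    unfolding B_def
    by (intro continuous_intros continuous_on_csqrt_Re continuous_on_subset[OF contq]
        continuous_on_compose2[OF cy0]) (use qpos in auto)
  have Bsq: "B s L x ^ 2 = R s L x" if "s \<in> {0..1}" for s L x
    using y0(1)[OF that] by (simp add: B_def q_def power_mult_distrib)
  have Bnz: "B s L x \<noteq> 0" if "s \<in> {0..1}" "L \<in> A1" "x \<in> A2" for s L x
    using qpos[OF that] y0(1)[OF that(1)] by (auto simp: B_def)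
  have \<gamma>c: "\<gamma> 1 = \<gamma> 0" using \<gamma> by (simp add: pathfinish_def pathstart_def)
  have "y0 1 = y0 0" using Yc N1 by (simp add: y0_def)
  then have Bc: "B 1 L x = B 0 L x" for L x
    by (simp add: B_def q_def R_def \<gamma>c)
  have L0A: "L0 \<in> A1" "S0 \<in> A2" using A by auto
  interpret x: elliptic_loop2 A2 \<gamma> "\<lambda>s x. B s L0 x" "\<lambda>x. L0 ^ 2 * g2 n x" "\<lambda>x. L0 ^ 2 * g2' n x"
    "\<lambda>x. L0 ^ 3 * g3 n x" "\<lambda>x. L0 ^ 3 * g3' n x" "\<lambda>x. L0 ^ 2 * g2'' n" "\<lambda>x. L0 ^ 3 * g3'' n x"
  proof
    have "continuous_on ({0..1} \<times> A2) (\<lambda>p. B (fst p) L0 (snd p))"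
      by (rule continuous_on_compose2[OF contB, of _ "\<lambda>p. (fst p, (L0, snd p))", simplified])
        (use L0A in \<open>auto intro!: continuous_intros\<close>)
    then show "continuous_on ({0..1} \<times> A2) (\<lambda>(s, z). B s L0 z)" by (simp add: case_prod_beta)
  qed (use A \<gamma> \<gamma>c Bnz Bsq Bc L0A in \<open>auto simp: R_def intro!: DERIV_cmult g_deriv continuous_intros g_continuous\<close>)
  have scale: "integral {0..1} (\<lambda>s. 1 / B s L x ^ 1 * velocity \<gamma> s)
      = csqrt (L0 / L) * x.period x" "Re (L0 / L) > 0"
    if x: "x \<in> A2" and L: "L \<in> ball L0 \<rho>" for L x
  proof -
    interpret L: elliptic_loop "ball L0 \<rho>" \<gamma> "\<lambda>s L. B s L x" "\<lambda>L. L ^ 2 * g2 n x" "\<lambda>L. 2 * L * g2 n x"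
      "\<lambda>L. L ^ 3 * g3 n x" "\<lambda>L. 3 * L ^ 2 * g3 n x"
    proof
      have "continuous_on ({0..1} \<times> ball L0 \<rho>) (\<lambda>p. B (fst p) (snd p) x)"
        by (rule continuous_on_compose2[OF contB, of _ "\<lambda>p. (fst p, (snd p, x))", simplified])
          (use x \<rho> in \<open>auto intro!: continuous_intros\<close>)
      then show "continuous_on ({0..1} \<times> ball L0 \<rho>) (\<lambda>(s, z). B s z x)" by (simp add: case_prod_beta)
    qed (use A \<gamma> \<gamma>c Bnz Bsq Bc L0A x \<rho> in
      \<open>auto simp: R_def subset_iff intro!: derivative_eq_intros continuous_intros\<close>)
    have "L.period L0 = x.period x" by (simp add: L.period_def x.period_def)
    moreover have "L.period L = csqrt (L0 / L) * L.period L0" "Re (L0 / L) > 0"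
      using csqrt_scaling_unique[OF L0 \<rho>(2) L.period_deriv L.period_scaling L] by simp_all
    ultimately show "integral {0..1} (\<lambda>s. 1 / B s L x ^ 1 * velocity \<gamma> s)
      = csqrt (L0 / L) * x.period x" "Re (L0 / L) > 0"
      by (simp_all add: L.period_def)
  qed
  \<comment> \<open>The same uniformity for the given \<open>Y\<close>: close to \<open>z0\<close>
    it stays near \<open>y0\<close> on the whole loop and must therefore coincide with
    \<open>B\<close>.\<close>
  have "continuous_on (N1 \<times> {0..1}) (\<lambda>p. (\<lambda>(s, z). Y s z) (snd p, fst p))"
    by (rule continuous_on_compose2[OF contY]) (auto intro!: continuous_intros)
  then have "continuous_on (N1 \<times> {0..1}) (\<lambda>p. Y (snd p) (fst p) / y0 (snd p))"
    by (intro continuous_intros continuous_on_compose2[OF cy0]) (use y0 in auto)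
  then obtain Z where Z: "z0 \<in> Z" "open Z"
    "\<forall>z\<in>Z \<inter> N1. \<forall>s\<in>{0..1}. dist (Y s z / y0 s) (Y s z0 / y0 s) \<le> 1 / 2"
    using continuous_on_prod_compactE[of N1 "{0..1}" "\<lambda>p. Y (snd p) (fst p) / y0 (snd p)" z0 "1/2"] N1
    by auto
  define N0 where "N0 = Z \<inter> N1 \<inter> {z\<in>N. \<Lambda> z \<in> ball L0 \<rho>} \<inter> {z\<in>N. S z \<in> A2}"
  have "openin (top_of_set N) N0"
  proof -
    have "openin (top_of_set N) {z\<in>N. \<Lambda> z \<in> ball L0 \<rho>}" "openin (top_of_set N) {z\<in>N. S z \<in> A2}"
      using continuous_openin_preimage_gen[OF cont(1), of "ball L0 \<rho>"]
        continuous_openin_preimage_gen[OF cont(2), of A2] A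
      by (simp_all add: vimage_def Int_def conj_commute)
    moreover have "openin (top_of_set N) (Z \<inter> N1)"
      using N1(1) Z(2) by (metis inf_commute openin_Int_open)
    ultimately show ?thesis unfolding N0_def by (meson openin_Int)
  qed
  moreover have "z0 \<in> N0"
    using Z N1 z0 \<rho> L0A by (simp add: N0_def L0_def[symmetric] S0_def[symmetric])
  moreover have "S z \<in> A2 \<and> Re (\<Lambda> z0 / \<Lambda> z) > 0 \<and> P z = csqrt (\<Lambda> z0 / \<Lambda> z) * x.period (S z)"
    if z: "z \<in> N0" for z
  proof -
    have zN: "z \<in> N1" "z \<in> N" "\<Lambda> z \<in> ball L0 \<rho>" "S z \<in> A2" "z \<in> Z" using z by (auto simp: N0_def)
    have "Y s z = B s (\<Lambda> z) (S z)" if s: "s \<in> {0..1}" for s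
    proof -
      have "Y s z ^ 2 = R s (\<Lambda> z) (S z)"
        using Y s zN G[OF zN(2)] by (simp add: R_def)
      moreover have "norm (Y s z - y0 s) < norm (y0 s)"
      proof -
        have "norm (Y s z / y0 s - 1) \<le> 1 / 2"
          using Z(3) zN s y0(1)[OF s] by (force simp: y0_def[symmetric] dist_norm)
        also have "\<dots> < 1" by simp
        finally have "norm (y0 s * (Y s z / y0 s - 1)) < norm (y0 s) * 1"
          using y0(1)[OF s] by (simp add: norm_mult)
        then show ?thesis using y0(1)[OF s] by (simp add: algebra_simps)
      qed
      ultimately show ?thesis
        unfolding B_def q_def by (intro csqrt_eq_divide[symmetric] y0(1)[OF s])
    qed
    then have "P z = integral {0..1} (\<lambda>s. 1 / B s (\<Lambda> z) (S z) ^ 1 * velocity \<gamma> s)"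
      using P zN by (auto intro!: integral_cong)
    then show ?thesis using scale[OF zN(4,3)] zN(4) by (simp add: L0_def)
  qed
  ultimately show ?thesis
    by (intro that[of N0 A2 x.period])
      (use A x.period_holomorphic x.picard_fuchs[where L = L0 and n = n] in auto)
qed

section \<open>Periods of the K3 surfaces and of the threefolds\<close>

lemma eventually_nhds_prodD:
  assumes "\<forall>\<^sub>F z in nhds (x, y). P z"
  shows "\<exists>A B. open A \<and> open B \<and> x \<in> A \<and> y \<in> B \<and> (\<forall>a\<in>A. \<forall>b\<in>B. P (a, b))"
proof -
  obtain W where W: "open W" "(x, y) \<in> W" "\<forall>z\<in>W. P z"
    using assms unfolding eventually_nhds by blast
  obtain A B where "open A" "open B" "(x, y) \<in> A \<times> B" "A \<times> B \<subseteq> W"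
    using open_prod_elim[OF W(1,2)] by blast
  then show ?thesis using W(3) by (intro exI[of _ A] exI[of _ B]) auto
qed

text \<open>The tube lemma in terms of filters; it makes local statements uniform over the time
  interval of a path.\<close>

lemma eventually_tube:
  assumes "compact K" "\<And>y. y \<in> K \<Longrightarrow> \<forall>\<^sub>F z in nhds (x0, y). P z"
  shows "\<forall>\<^sub>F x in nhds x0. \<forall>y\<in>K. P (x, y)"
proof -
  have "\<forall>y\<in>K. \<exists>W. open W \<and> (x0, y) \<in> W \<and> (\<forall>z\<in>W. P z)"
    using assms(2) unfolding eventually_nhds by blast
  then obtain W where W: "\<And>y. y \<in> K \<Longrightarrow> open (W y) \<and> (x0, y) \<in> W y \<and> (\<forall>z\<in>W y. P z)"
    by metis
  have "open (\<Union>y\<in>K. W y)" "{x0} \<times> K \<subseteq> (\<Union>y\<in>K. W y)" using W by auto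
  from Elementary_Topology.tube_lemma[OF assms(1) this] obtain X0 where "x0 \<in> X0" "open X0" "X0 \<times> K \<subseteq> (\<Union>y\<in>K. W y)"
    by blast
  then have "\<forall>x\<in>X0. \<forall>y\<in>K. P (x, y)" using W by blast
  then show ?thesis using \<open>x0 \<in> X0\<close> \<open>open X0\<close> unfolding eventually_nhds by blast
qed

lemma eventually_nhds_isCont:
  assumes "isCont f x" "\<forall>\<^sub>F y in nhds (f x). P y"
  shows "\<forall>\<^sub>F x in nhds x. P (f x)"
proof -
  have "filterlim f (nhds (f x)) (nhds x)"
    using assms(1) by (simp add: isCont_def tendsto_at_iff_tendsto_nhds)
  then show ?thesis using assms(2) by (rule eventually_compose_filterlim[rotated])
qed

lemma eventually_Re_pos:
  fixes f :: "'a::t2_space \<Rightarrow> complex"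
  assumes "isCont f x" "Re (f x) > 0"
  shows "\<forall>\<^sub>F x in nhds x. Re (f x) > 0"
  using assms(1)
proof (rule eventually_nhds_isCont)
  show "\<forall>\<^sub>F y in nhds (f x). Re y > 0"
    using eventually_nhds_in_open[OF open_halfspace_Re_gt[of 0], of "f x"] assms(2) by simp
qed

text \<open>Extends paths to all of \<open>\<real>\<close>, so that their continuity can be used at a point rather than
  relative to \<open>{0..1}\<close>.\<close>

definition clamp01 :: "real \<Rightarrow> real" where "clamp01 s = max 0 (min 1 s)"

lemma clamp01: "clamp01 s \<in> {0..1}" "s \<in> {0..1} \<Longrightarrow> clamp01 s = s"
  by (auto simp: clamp01_def)

lemma isCont_clamped:
  assumes "continuous_on {0..1} c"
  shows "isCont (\<lambda>s. c (clamp01 s)) s"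
proof -
  have "continuous_on UNIV (\<lambda>s. c (clamp01 s))"
    by (rule continuous_on_compose2[OF assms])
      (auto simp: clamp01_def intro!: continuous_intros)
  then show ?thesis by (simp add: continuous_on_eq_continuous_at)
qed

section \<open>Coefficients of the twisted families\<close>

text \<open>For \<open>mb = 2 \<beta>\<close> this is the scale
  \<open>v^2 (v + 1)^(2 \<beta>)\<close> of \<open>X\<close>. It is single-valued, and the factor
  \<open>1 / (v (v + 1)^\<beta>)\<close> of the periods is a branch of \<open>qv\<close> to the
  power \<open>-1/2\<close>.\<close>

definition qv :: "nat \<Rightarrow> complex \<Rightarrow> complex" where
  "qv mb v = v ^ 2 * (v + 1) ^ mb"

lemma K3_param_eq: "K3_param k l t v = c_kl k l * wt k l v * t"
  by (simp add: K3_param_def wt_def)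

lemma c_kl_1_1: "c_kl (Suc 0) (Suc 0) = - 1 / 4"
  by (simp add: c_kl_def)

lemma c_kl_nz: "k > 0 \<Longrightarrow> l > 0 \<Longrightarrow> c_kl k l \<noteq> 0"
  by (simp add: c_kl_def del: of_nat_add)

lemma powr_half:
  assumes "\<beta> = of_nat mb / 2" "mb > 0"
  shows "(z::complex) powr (4 * \<beta>) = z ^ (2 * mb)" "z powr (6 * \<beta>) = z ^ (3 * mb)"
proof -
  have 1: "4 * \<beta> = of_nat (2 * mb)" and 2: "6 * \<beta> = of_nat (3 * mb)"
    unfolding assms(1) by simp_all
  show "z powr (4 * \<beta>) = z ^ (2 * mb)" "z powr (6 * \<beta>) = z ^ (3 * mb)"
    unfolding 1 2 by (rule powr_nat', use assms(2) in simp)+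
qed

text \<open>As \<open>c_kl 1 1 = -1/4\<close>, the K3 family is itself the twist of the elliptic
  curves with invariant \<open>(1, 1, 1)\<close>. All rescalings collect into a single scale,
  entering squared in \<open>g2\<close> and cubed in \<open>g3\<close>, as
  \<open>curve_period_local\<close> expects.\<close>

lemma g_CY_eq:
  assumes "\<beta> = of_nat mb / 2" "mb > 0"
  shows "g2_CY n k l \<beta> t v u = ((u * (u + 1)) ^ 2 * qv mb v) ^ 2
      * g2 n (c_kl 1 1 * (c_kl k l * wt k l v * t) * wt 1 1 u)"
    "g3_CY n k l \<beta> t v u = ((u * (u + 1)) ^ 2 * qv mb v) ^ 3
      * g3 n (c_kl 1 1 * (c_kl k l * wt k l v * t) * wt 1 1 u)"
proof -
  have S: "- K / (4 * u * (u + 1)) = c_kl 1 1 * K * wt 1 1 u" for K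
    by (simp add: c_kl_1_1 wt_def)
  have \<Lambda>: "((u * (u + 1)) ^ 2 * qv mb v) ^ 2 = (u * (u + 1)) ^ 4 * v ^ 4 * (v + 1) ^ (2 * mb)"
    "((u * (u + 1)) ^ 2 * qv mb v) ^ 3 = (u * (u + 1)) ^ 6 * v ^ 6 * (v + 1) ^ (3 * mb)"
    by (simp_all add: qv_def power_mult_distrib flip: power_mult) (simp_all add: mult.commute)
  show "g2_CY n k l \<beta> t v u = ((u * (u + 1)) ^ 2 * qv mb v) ^ 2
      * g2 n (c_kl 1 1 * (c_kl k l * wt k l v * t) * wt 1 1 u)"
    "g3_CY n k l \<beta> t v u = ((u * (u + 1)) ^ 2 * qv mb v) ^ 3
      * g3 n (c_kl 1 1 * (c_kl k l * wt k l v * t) * wt 1 1 u)"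
    unfolding g2_CY_def g3_CY_def g2_K3_def g3_K3_def powr_half[OF assms(1,2)] S K3_param_eq \<Lambda>
    by (simp_all only: mult_ac)
qed

lemma curve_period_disc:
  "curve_period G2 G3 N P \<Longrightarrow> z \<in> N \<Longrightarrow> G2 z ^ 3 - 27 * G3 z ^ 2 \<noteq> 0"
  unfolding curve_period_def by blast

lemma csqrt_ratio_deriv:
  assumes "\<And>v. v \<in> V \<Longrightarrow> (q has_field_derivative 2 * d v * q v) (at v)" "v \<in> V" "Re (q0 / q v) > 0"
  shows "((\<lambda>v. csqrt (q0 / q v)) has_field_derivative - d v * csqrt (q0 / q v)) (at v)"
proof -
  have nz: "q v \<noteq> 0" using assms(3) by auto
  define w where "w = csqrt (q0 / q v)"
  have w: "q0 / q v = w * w" "w \<noteq> 0"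
    using assms(3) by (auto simp: w_def simp flip: power2_eq_square)
  have "((\<lambda>v. q0 / q v) has_field_derivative - 2 * d v * (q0 / q v)) (at v)"
    using nz assms(1)[OF assms(2)] by (auto intro!: derivative_eq_intros simp: field_simps)
  from has_field_derivative_csqrt'[OF this Re_pos_not_nonpos_Reals[OF assms(3)]]
  show ?thesis
  proof (rule DERIV_cong)
    show "- 2 * d v * (q0 / q v) / (2 * csqrt (q0 / q v)) = - d v * csqrt (q0 / q v)"
      unfolding w_def[symmetric] unfolding w(1) using w(2) by simp
  qed
qed

lemma qv_deriv:
  assumes "v \<noteq> 0" "v + 1 \<noteq> 0" "\<beta> = of_nat mb / 2"
  shows "(qv mb has_field_derivative 2 * (1 / v + \<beta> / (v + 1)) * qv mb v) (at v)"
proof -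
  have 1: "((\<lambda>v. (v + 1) ^ mb) has_field_derivative of_nat mb / (v + 1) * (v + 1) ^ mb) (at v)"
  proof (cases mb)
    case (Suc n)
    have "((\<lambda>v. (v + 1) ^ mb) has_field_derivative of_nat mb * (1 * (v + 1) ^ (mb - Suc 0))) (at v)"
      by (intro DERIV_power) (auto intro!: derivative_eq_intros)
    then show ?thesis by (rule DERIV_cong) (use assms(2) in \<open>simp add: Suc\<close>)
  qed simp
  have 2: "((\<lambda>v. v ^ 2) has_field_derivative 2 * v) (at v)"
    by (auto intro!: derivative_eq_intros)
  have "(2 * v) * w + m / y * w * v ^ 2 = 2 * (1 / v + m / 2 / y) * (v ^ 2 * w)"
    if "y \<noteq> 0" for w m y
    using assms(1) that by (simp add: field_simps power2_eq_square)
  from this[OF assms(2)] show ?thesis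
    unfolding qv_def[abs_def] assms(3) by (intro DERIV_cong[OF DERIV_mult[OF 2 1]])
qed

text \<open>Over the fixed point \<open>v0\<close> the surface is fibred with invariant
  \<open>(1, 1, 1)\<close>, so \<open>f t = h (t, s0)\<close> has an equation of order three. Over
  nearby \<open>v\<close> the moduli of the curves depend on \<open>t\<close> and \<open>v\<close>
  through \<open>wt k l v * t\<close> only, and the scale differs by a ratio independent of
  \<open>u\<close>. Hence the period over \<open>v\<close> is a root of that ratio times
  \<open>f\<close> at a rescaled parameter.\<close>

theorem surface_period_twist:
  fixes c :: "real \<Rightarrow> complex" and h :: "complex \<times> real \<Rightarrow> complex"
  assumes \<beta>: "\<beta> = of_nat mb / 2" "mb > 0" and kl: "k > 0" "l > 0"
    and openN: "open N" and c: "valid_path c"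
    and per: "surface_period (\<lambda>(t, s). g2_CY n k l \<beta> t (c s)) (\<lambda>(t, s). g3_CY n k l \<beta> t (c s))
      (N \<times> {0..1}) h"
  shows "twist_family k l \<beta> (c_kl k l) [1 / 2, mu n, 1 - mu n] N c (\<lambda>t s. h (t, s))"
  unfolding twist_family_def
proof (intro ballI)
  fix t0 :: complex and s0 :: real assume t0: "t0 \<in> N" and s0: "s0 \<in> {0..1}"
  define v0 where "v0 = c s0"
  define cc where "cc s = c (clamp01 s)" for s
  have "continuous_on {0..1} c"
    using c by (simp add: valid_path_def piecewise_C1_differentiable_on_def)
  then have cont_cc: "isCont cc s" for s
    unfolding cc_def by (rule isCont_clamped)
  have cc: "cc s = c s" if "s \<in> {0..1}" for s using that by (simp add: cc_def clamp01)
  have "(t0, s0) \<in> N \<times> {0..1}" using t0 s0 by simp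
  from per[unfolded surface_period_def warped_period_def pathfinish_def pathstart_def, rule_format, OF this]
  obtain M m u g where M: "openin (top_of_set (N \<times> {0..1})) M" "(t0, s0) \<in> M"
    and ug': "\<forall>j<(m::nat). valid_path (u j) \<and> curve_period
       (\<lambda>(z, s). (case z of (t, s) \<Rightarrow> g2_CY n k l \<beta> t (c s)) (u j s))
       (\<lambda>(z, s). (case z of (t, s) \<Rightarrow> g3_CY n k l \<beta> t (c s)) (u j s)) (M \<times> {0..1}) (g j)"
    and bd': "\<forall>z\<in>M. \<forall>x. (\<Sum>j<m. if u j 1 = x then g j (z, 1) else 0)
                   = (\<Sum>j<m. if u j 0 = x then g j (z, 0) else 0)"
    and h': "\<forall>z\<in>M. h z = (\<Sum>j<m. integral {0..1}
                  (\<lambda>s. g j (z, s) * velocity (u j) s))"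
    by (elim exE conjE)
  note vu = ug'[rule_format, THEN conjunct1] and ug = ug'[rule_format, THEN conjunct2]
    and bd = bd'[rule_format] and h = h'[rule_format]
  obtain W where W: "open W" "M = (N \<times> {0..1}) \<inter> W"
    using M(1) unfolding openin_open by blast
  have W': "open ((N \<times> UNIV) \<inter> W)" using W openN by (intro open_Int open_Times) auto
  have evM: "\<forall>\<^sub>F z in nhds (t0, s0). snd z \<in> {0..1} \<longrightarrow> z \<in> M"
  proof -
    have "\<forall>\<^sub>F z in nhds (t0, s0). z \<in> (N \<times> UNIV) \<inter> W"
      using M W by (intro eventually_nhds_in_open W') auto
    then show ?thesis by eventually_elim (use W in auto)
  qed
  define Q where "Q = [1 / 2, mu n, 1 - mu n]"
  have "twist_at k l \<beta> (c_kl k l) Q c (\<lambda>t s. h (t, s)) t0 s0"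
  proof (cases "m = 0")
    \<comment> \<open>An empty sum of paths gives the zero period and leaves \<open>c s0\<close>
      unconstrained.\<close>
    case True
    from eventually_nhds_prodD[OF evM, unfolded snd_conv]
    obtain T B where TB: "open T" "open B" "t0 \<in> T" "s0 \<in> B"
      "\<forall>t\<in>T. \<forall>s\<in>B. s \<in> {0..1} \<longrightarrow> (t, s) \<in> M"
      by (elim exE conjE)
    obtain \<delta> where \<delta>: "\<delta> > 0" "ball s0 \<delta> \<subseteq> B" using TB open_contains_ball by blast
    have "h (t, s) = 0" if "t \<in> T" "s \<in> {0..1}" "\<bar>s - s0\<bar> < \<delta>" for t s
    proof -
      have "s \<in> B" using \<delta> that by (auto simp: dist_real_def subset_iff)
      then have "(t, s) \<in> M" using TB(5) that by blast
      then show ?thesis using h True by simp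
    qed
    then show ?thesis
      by (intro twist_at_zero[of T _ \<delta>]) (use TB \<delta> in auto)
  next
    case False
    define \<Lambda> where "\<Lambda> v u = (u * (u + 1)) ^ 2 * qv mb v" for v u
    define S where "S t v u = c_kl 1 1 * (c_kl k l * wt k l v * t) * wt 1 1 u" for t v u
    have cu: "continuous_on {0..1} (u j)" if "j < m" for j
      using vu[OF that] by (simp add: valid_path_def piecewise_C1_differentiable_on_def)
    have CP: "curve_period (\<lambda>z. \<Lambda> (c (snd (fst z))) (u j (snd z)) ^ 2
           * g2 n (S (fst (fst z)) (c (snd (fst z))) (u j (snd z))))
        (\<lambda>z. \<Lambda> (c (snd (fst z))) (u j (snd z)) ^ 3
           * g3 n (S (fst (fst z)) (c (snd (fst z))) (u j (snd z)))) (M \<times> {0..1}) (g j)"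
      if "j < m" for j
      using ug[OF that] unfolding g_CY_eq[OF \<beta>] \<Lambda>_def S_def by (simp add: case_prod_beta')
    \<comment> \<open>Here smoothness of the fibres enters: scale zero would give discriminant zero,
      so neither the base path nor the paths in \<open>u\<close> meet \<open>0\<close> or
      \<open>-1\<close>.\<close>
    have \<Lambda>_nz: "\<Lambda> (c (snd (fst z))) (u j (snd z)) \<noteq> 0" if "j < m" "z \<in> M \<times> {0..1}" for j z
      using curve_period_disc[OF CP[OF that(1)] that(2)] by auto
    have nz: "c s \<noteq> 0 \<and> c s + 1 \<noteq> 0 \<and> u j s' \<noteq> 0 \<and> u j s' + 1 \<noteq> 0"
      if "j < m" "(t, s) \<in> M" "s' \<in> {0..1}" for j t s s'
      using \<Lambda>_nz[of j "((t, s), s')"] that \<beta>(2) by (auto simp: \<Lambda>_def qv_def)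
    have v0: "v0 \<noteq> 0" "v0 + 1 \<noteq> 0"
      using nz[of 0 t0 s0 0] False M by (auto simp: v0_def)
    have w0: "wt k l v0 \<noteq> 0" using v0 by (simp add: wt_def)
    have q0: "qv mb v0 \<noteq> 0" using v0 by (simp add: qv_def)
    have contM: "continuous_on (M \<times> {0..1}) (\<lambda>z. \<Lambda> (c (snd (fst z))) (u j (snd z)))"
      "continuous_on (M \<times> {0..1}) (\<lambda>z. S (fst (fst z)) (c (snd (fst z))) (u j (snd z)))"
      if j: "j < m" for j
    proof -
      have MI: "snd z \<in> {0..1}" if "z \<in> M" for z using that W by auto
      have 1: "continuous_on (M \<times> {0..1}) (\<lambda>z. c (snd (fst z)))"
        by (rule continuous_on_compose2[OF \<open>continuous_on {0..1} c\<close>])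
          (use MI in \<open>auto intro!: continuous_intros\<close>)
      have 2: "continuous_on (M \<times> {0..1}) (\<lambda>z. u j (snd z))"
        by (rule continuous_on_compose2[OF cu[OF j]]) (auto intro!: continuous_intros)
      show "continuous_on (M \<times> {0..1}) (\<lambda>z. \<Lambda> (c (snd (fst z))) (u j (snd z)))"
        unfolding \<Lambda>_def qv_def by (intro continuous_intros 1 2)
      show "continuous_on (M \<times> {0..1}) (\<lambda>z. S (fst (fst z)) (c (snd (fst z))) (u j (snd z)))"
        unfolding S_def wt_def by (intro continuous_intros 1 2) (use nz[OF j] in auto)
    qed
    have local: "\<exists>D \<phi>. open D \<and> \<phi> holomorphic_on D \<and>
        (\<forall>x\<in>D. Theta [0, 0] \<phi> x = x * Theta [mu n, 1 - mu n] \<phi> x) \<and>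
        (\<forall>\<^sub>F z in nhds ((t1, s0), s1). snd (fst z) \<in> {0..1} \<longrightarrow> snd z \<in> {0..1} \<longrightarrow>
           fst z \<in> M \<and> S (fst (fst z)) (c (snd (fst z))) (u j (snd z)) \<in> D \<and>
           g j z = csqrt (\<Lambda> v0 (u j s1) / \<Lambda> (c (snd (fst z))) (u j (snd z)))
             * \<phi> (S (fst (fst z)) (c (snd (fst z))) (u j (snd z))))"
      if j: "j < m" and t1: "(t1, s0) \<in> M" and s1: "s1 \<in> {0..1}" for j t1 s1
    proof -
      have z0: "((t1, s0), s1) \<in> M \<times> {0..1}" using t1 s1 by simp
      obtain N0 D \<phi> where N0: "openin (top_of_set (M \<times> {0..1})) N0" "((t1, s0), s1) \<in> N0"
        and D: "open D" "\<phi> holomorphic_on D" "\<forall>x\<in>D. Theta [0, 0] \<phi> x = x * Theta [mu n, 1 - mu n] \<phi> x"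
        and loc: "\<forall>z\<in>N0. S (fst (fst z)) (c (snd (fst z))) (u j (snd z)) \<in> D \<and>
          Re (\<Lambda> (c (snd (fst ((t1, s0), s1)))) (u j (snd ((t1, s0), s1)))
              / \<Lambda> (c (snd (fst z))) (u j (snd z))) > 0 \<and>
          g j z = csqrt (\<Lambda> (c (snd (fst ((t1, s0), s1)))) (u j (snd ((t1, s0), s1)))
              / \<Lambda> (c (snd (fst z))) (u j (snd z))) * \<phi> (S (fst (fst z)) (c (snd (fst z))) (u j (snd z)))"
        by (rule curve_period_local[OF CP[OF j] z0 refl refl contM[OF j]])
      obtain W0 where W0: "open W0" "N0 = (M \<times> {0..1}) \<inter> W0"
        using N0(1) unfolding openin_open by blast
      have "open (W0 \<inter> (((N \<times> UNIV) \<inter> W) \<times> UNIV))"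
        using W0(1) open_Times[OF W' open_UNIV] by (rule open_Int)
      moreover have "((t1, s0), s1) \<in> W0 \<inter> (((N \<times> UNIV) \<inter> W) \<times> UNIV)"
        using N0(2) W0 W t1 by auto
      ultimately have "\<forall>\<^sub>F z in nhds ((t1, s0), s1). z \<in> W0 \<inter> (((N \<times> UNIV) \<inter> W) \<times> UNIV)"
        by (rule eventually_nhds_in_open)
      then have "\<forall>\<^sub>F z in nhds ((t1, s0), s1). snd (fst z) \<in> {0..1} \<longrightarrow> snd z \<in> {0..1} \<longrightarrow>
           fst z \<in> M \<and> S (fst (fst z)) (c (snd (fst z))) (u j (snd z)) \<in> D \<and>
           g j z = csqrt (\<Lambda> v0 (u j s1) / \<Lambda> (c (snd (fst z))) (u j (snd z)))
             * \<phi> (S (fst (fst z)) (c (snd (fst z))) (u j (snd z)))"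
      proof eventually_elim
        case (elim z)
        show ?case
        proof (intro impI)
          assume "snd (fst z) \<in> {0..1}" "snd z \<in> {0..1}"
          then have "z \<in> N0" "fst z \<in> M" using elim W W0 by (auto simp: mem_Times_iff)
          then show "fst z \<in> M \<and> S (fst (fst z)) (c (snd (fst z))) (u j (snd z)) \<in> D \<and>
           g j z = csqrt (\<Lambda> v0 (u j s1) / \<Lambda> (c (snd (fst z))) (u j (snd z)))
             * \<phi> (S (fst (fst z)) (c (snd (fst z))) (u j (snd z)))"
            using loc by (auto simp: v0_def)
        qed
      qed
      then show ?thesis using D by blast
    qed
    define T1 where "T1 = {t. (t, s0) \<in> M}"
    have T1_eq: "T1 = (\<lambda>t. (t, s0)) -` ((N \<times> UNIV) \<inter> W)" using W s0 by (auto simp: T1_def)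
    have T1: "open T1" "t0 \<in> T1"
      unfolding T1_eq by (intro open_vimage W' continuous_intros) (use M W in auto)
    have inner: "twist_family 1 1 1 (c_kl 1 1 * (c_kl k l * wt k l v0)) [mu n, 1 - mu n] T1 (u j)
       (\<lambda>t s'. g j ((t, s0), s'))" if j: "j < m" for j
      unfolding twist_family_def
    proof (intro ballI)
      fix t1 :: complex and s1 :: real assume t1: "t1 \<in> T1" and s1: "s1 \<in> {0..1}"
      obtain D \<phi> where D: "open D" "\<phi> holomorphic_on D"
        "\<forall>x\<in>D. Theta [0, 0] \<phi> x = x * Theta [mu n, 1 - mu n] \<phi> x"
        and ev: "\<forall>\<^sub>F z in nhds ((t1, s0), s1). snd (fst z) \<in> {0..1} \<longrightarrow> snd z \<in> {0..1} \<longrightarrow>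
           fst z \<in> M \<and> S (fst (fst z)) (c (snd (fst z))) (u j (snd z)) \<in> D \<and>
           g j z = csqrt (\<Lambda> v0 (u j s1) / \<Lambda> (c (snd (fst z))) (u j (snd z)))
             * \<phi> (S (fst (fst z)) (c (snd (fst z))) (u j (snd z)))"
        using local[OF j _ s1, of t1] t1 unfolding T1_def by blast
      define u0 where "u0 = u j s1"
      have u0: "u0 \<noteq> 0" "u0 + 1 \<noteq> 0" using nz[OF j _ s1, of t1 s0] t1 by (auto simp: u0_def T1_def)
      \<comment> \<open>\<open>\<Lambda>\<close> is a perfect square in \<open>u\<close>, so the
        square root of the ratio is rational. \<open>r\<close> is the root equal to \<open>1\<close>
        at \<open>u0\<close>.\<close>
      define r where "r x = u0 * (u0 + 1) * wt 1 1 x" for x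
      have S0: "S t1 v0 u0 \<in> D"
        using eventually_nhds_x_imp_x[OF ev] s0 s1 by (simp add: v0_def u0_def)
      have evS: "\<forall>\<^sub>F z in nhds (t1, u0). S (fst z) v0 (snd z) \<in> D"
      proof (rule eventually_nhds_isCont[where f = "\<lambda>z. S (fst z) v0 (snd z)"])
        show "isCont (\<lambda>z. S (fst z) v0 (snd z)) (t1, u0)"
          unfolding S_def wt_def using u0 by (intro continuous_intros) auto
        show "\<forall>\<^sub>F y in nhds (S (fst (t1, u0)) v0 (snd (t1, u0))). y \<in> D"
          using S0 D by (intro eventually_nhds_in_open) auto
      qed
      from eventually_nhds_prodD[OF evS, unfolded fst_conv snd_conv]
      obtain A B where AB: "open A" "open B" "t1 \<in> A" "u0 \<in> B" "\<forall>t\<in>A. \<forall>x\<in>B. S t v0 x \<in> D"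
        by (elim exE conjE)
      have "\<forall>\<^sub>F x in nhds u0. Re (r x) > 0"
      proof (rule eventually_Re_pos)
        show "isCont r u0" unfolding r_def wt_def using u0 by (intro continuous_intros) auto
        show "Re (r u0) > 0" using u0 by (simp add: r_def wt_def)
      qed
      then obtain B2 where B2: "open B2" "u0 \<in> B2" "\<And>x. x \<in> B2 \<Longrightarrow> Re (r x) > 0"
        unfolding eventually_nhds by blast
      define V where "V = B \<inter> B2 \<inter> (UNIV - {0, -1})"
      have V: "open V" "u0 \<in> V" "0 \<notin> V" "-1 \<notin> V"
        using AB B2 u0 by (auto simp: V_def add_eq_0_iff2 intro!: open_Diff)
      have Vnz: "x \<noteq> 0" "x + 1 \<noteq> 0" if "x \<in> V" for x
        using V that by (auto simp: eq_neg_iff_add_eq_0[symmetric])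
      have "isCont (\<lambda>p. ((fst p, s0), snd p)) (t1, s1)" by (intro continuous_intros)
      from eventually_nhds_isCont[OF this, of "\<lambda>z. snd (fst z) \<in> {0..1} \<longrightarrow> snd z \<in> {0..1} \<longrightarrow>
           fst z \<in> M \<and> S (fst (fst z)) (c (snd (fst z))) (u j (snd z)) \<in> D \<and>
           g j z = csqrt (\<Lambda> v0 (u j s1) / \<Lambda> (c (snd (fst z))) (u j (snd z)))
             * \<phi> (S (fst (fst z)) (c (snd (fst z))) (u j (snd z)))"] ev s0
      have "\<forall>\<^sub>F p in nhds (t1, s1). snd p \<in> {0..1} \<longrightarrow>
           g j ((fst p, s0), snd p) = csqrt (\<Lambda> v0 u0 / \<Lambda> v0 (u j (snd p))) * \<phi> (S (fst p) v0 (u j (snd p)))"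
        by (simp add: v0_def u0_def eventually_mono)
      from eventually_nhds_prodD[OF this, unfolded fst_conv snd_conv]
      obtain A2 B3 where A2: "open A2" "open B3" "t1 \<in> A2" "s1 \<in> B3"
        "\<forall>t\<in>A2. \<forall>s\<in>B3. s \<in> {0..1} \<longrightarrow>
           g j ((t, s0), s) = csqrt (\<Lambda> v0 u0 / \<Lambda> v0 (u j s)) * \<phi> (S t v0 (u j s))"
        by (elim exE conjE)
      have "isCont (\<lambda>s. u j (clamp01 s)) s1" by (rule isCont_clamped[OF cu[OF j]])
      then have "\<forall>\<^sub>F s in nhds s1. u j (clamp01 s) \<in> V"
        by (rule eventually_nhds_isCont) (use V s1 in \<open>auto simp: u0_def clamp01 intro!: eventually_nhds_in_open\<close>)
      then obtain B4 where B4: "open B4" "s1 \<in> B4" "\<And>s. s \<in> B4 \<Longrightarrow> u j (clamp01 s) \<in> V"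
        unfolding eventually_nhds by blast
      obtain \<delta> where \<delta>: "\<delta> > 0" "ball s1 \<delta> \<subseteq> B3 \<inter> B4"
        using A2 B4 open_contains_ball[of "B3 \<inter> B4"] by blast
      have rad: "csqrt (\<Lambda> v0 u0 / \<Lambda> v0 x) = r x" if x: "x \<in> V" for x
      proof -
        have "\<Lambda> v0 u0 / \<Lambda> v0 x = r x ^ 2"
          using Vnz[OF x] q0 by (simp add: \<Lambda>_def r_def wt_def power_divide power_mult_distrib)
        then show ?thesis using B2(3)[of x] x by (simp add: V_def csqrt_square)
      qed
      have SS: "c_kl 1 1 * (c_kl k l * wt k l v0) * wt 1 1 x * t = S t v0 x" for x t
        by (simp add: S_def)
      have fin: "u j s \<in> V \<and> g j ((t, s0), s) = r (u j s) * \<phi> (S t v0 (u j s))"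
        if "t \<in> A \<inter> A2" "s \<in> {0..1}" "\<bar>s - s1\<bar> < \<delta>" for t s
      proof -
        have s: "s \<in> B3" "s \<in> B4" using \<delta> that by (auto simp: dist_real_def subset_iff)
        then have "u j s \<in> V" using B4(3)[of s] that by (simp add: clamp01)
        then show ?thesis using A2(5) that s rad by simp
      qed
      have r': "(r has_field_derivative - (1 / x + 1 / (x + 1)) * r x) (at x)" if "x \<in> V" for x
        unfolding r_def
        by (rule DERIV_cong[OF DERIV_cmult[OF wt_deriv[OF Vnz[OF that]]]]) simp
      show "twist_at 1 1 1 (c_kl 1 1 * (c_kl k l * wt k l v0)) [mu n, 1 - mu n] (u j)
          (\<lambda>t s'. g j ((t, s0), s')) t1 s1"
        by (rule twist_at_chart[of "A \<inter> A2" t1 \<delta> V "u j" s1 r 1 D \<phi>], unfold SS)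
          (use V D r' fin AB A2 \<delta> in \<open>auto simp: u0_def[symmetric] V_def numeral_2_eq_2\<close>)
    qed
    interpret inner: twisted_cycle 1 1 1 "c_kl 1 1 * (c_kl k l * wt k l v0)" "[mu n, 1 - mu n]" T1 m u
      "\<lambda>j t s'. g j ((t, s0), s')"
    proof
      fix t x assume "t \<in> T1"
      then show "(\<Sum>j<m. if u j 1 = x then g j ((t, s0), 1) else 0)
          = (\<Sum>j<m. if u j 0 = x then g j ((t, s0), 0) else 0)"
        using bd by (simp add: T1_def)
    qed (use T1 vu inner in auto)
    define f where "f t = h (t, s0)" for t
    \<comment> \<open>The left exchange replaces the shift \<open>1\<close> by
      \<open>(0 + 1 + 1) / 2 = 1\<close>, the right one replaces that by \<open>1/2\<close>; this is
      the \<open>1/2\<close> in the K3 equation.\<close>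
    have red: "reduces 1 1 1 1 1 (1 # [mu n, 1 - mu n]) Q"
      unfolding One_nat_def Q_def
      by (rule reduces.left, simp, rule reduces.right, simp, rule reduces.stop, simp)
    have f_eq: "f t = (\<Sum>j<m. integral {0..1} (\<lambda>s. g j ((t, s0), s) * velocity (u j) s))"
      if "t \<in> T1" for t using h that by (simp add: f_def T1_def)
    have fh: "f holomorphic_on T1" by (rule inner.twisted_ode(1)[OF red f_eq])
    have f_ode: "Theta [0, 0, 0] f t = c_kl k l * wt k l v0 * t * Theta Q f t" if "t \<in> T1" for t
      using inner.twisted_ode(2)[OF red f_eq that] c_kl_nz[of 1 1] by (simp add: numeral_2_eq_2 del: Theta_simps)
    have hom: "\<forall>\<^sub>F p in nhds (t0, s0). snd p \<in> {0..1} \<longrightarrow>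
        h p = csqrt (qv mb v0 / qv mb (c (snd p))) * f (fst p * wt k l (c (snd p)) / wt k l v0)"
    proof -
      \<comment> \<open>The parameter at which the curves over \<open>v0\<close> have the same
        moduli as those over \<open>cc (snd p)\<close> at parameter \<open>fst p\<close>.\<close>
      define \<tau> where "\<tau> p = fst p * wt k l (cc (snd p)) / wt k l v0" for p
      have cc0: "cc s0 = v0" using cc[OF s0] by (simp add: v0_def)
      have \<tau>0: "\<tau> (t0, s0) = t0" using w0 by (simp add: \<tau>_def cc0)
      have ccc: "isCont (\<lambda>p. cc (snd p)) p" for p :: "complex \<times> real"
        by (rule isCont_o2[OF _ cont_cc]) (intro continuous_intros)
      have \<tau>c: "isCont \<tau> (t0, s0)"
        unfolding \<tau>_def wt_def by (intro continuous_intros ccc) (use v0 cc0 w0 in \<open>auto simp: wt_def\<close>)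
      have each: "\<forall>\<^sub>F p in nhds (t0, s0). \<forall>s'\<in>{0..1}. snd p \<in> {0..1} \<longrightarrow> p \<in> M \<and> (\<tau> p, s0) \<in> M \<and>
          g j (p, s') = csqrt (qv mb v0 / qv mb (c (snd p))) * g j ((\<tau> p, s0), s')" if j: "j < m" for j
      proof -
        have "\<forall>\<^sub>F z in nhds ((t0, s0), s1). snd z \<in> {0..1} \<longrightarrow> snd (fst z) \<in> {0..1} \<longrightarrow> fst z \<in> M \<and>
          (\<tau> (fst z), s0) \<in> M \<and>
          g j z = csqrt (qv mb v0 / qv mb (c (snd (fst z)))) * g j ((\<tau> (fst z), s0), snd z)"
          if s1: "s1 \<in> {0..1}" for s1
        proof -
          define u0 where "u0 = u j s1"
          have u0: "u0 \<noteq> 0" "u0 + 1 \<noteq> 0" using nz[OF j M(2) s1] by (auto simp: u0_def)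
          have \<Lambda>0: "\<Lambda> v0 u0 \<noteq> 0" using u0 q0 by (simp add: \<Lambda>_def)
          obtain D \<phi> where ev: "\<forall>\<^sub>F z in nhds ((t0, s0), s1). snd (fst z) \<in> {0..1} \<longrightarrow> snd z \<in> {0..1} \<longrightarrow>
             fst z \<in> M \<and> S (fst (fst z)) (c (snd (fst z))) (u j (snd z)) \<in> D \<and>
             g j z = csqrt (\<Lambda> v0 u0 / \<Lambda> (c (snd (fst z))) (u j (snd z)))
               * \<phi> (S (fst (fst z)) (c (snd (fst z))) (u j (snd z)))"
            using local[OF j M(2) s1] unfolding u0_def by blast
          have "isCont (\<lambda>z. \<tau> (fst z)) ((t0, s0), s1)"
            by (rule isCont_o2[where f = fst and g = \<tau>]) (use \<tau>c in \<open>simp_all add: isCont_fst\<close>)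
          then have "isCont (\<lambda>z. ((\<tau> (fst z), s0), snd z)) ((t0, s0), s1)"
            by (intro continuous_intros)
          from eventually_nhds_isCont[OF this, of "\<lambda>z. snd (fst z) \<in> {0..1} \<longrightarrow> snd z \<in> {0..1} \<longrightarrow>
             fst z \<in> M \<and> S (fst (fst z)) (c (snd (fst z))) (u j (snd z)) \<in> D \<and>
             g j z = csqrt (\<Lambda> v0 u0 / \<Lambda> (c (snd (fst z))) (u j (snd z)))
               * \<phi> (S (fst (fst z)) (c (snd (fst z))) (u j (snd z)))"] ev
          have ev2: "\<forall>\<^sub>F z in nhds ((t0, s0), s1). snd z \<in> {0..1} \<longrightarrow> (\<tau> (fst z), s0) \<in> M \<and>
             g j ((\<tau> (fst z), s0), snd z) = csqrt (\<Lambda> v0 u0 / \<Lambda> v0 (u j (snd z))) * \<phi> (S (\<tau> (fst z)) v0 (u j (snd z)))"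
            using s0 by (simp add: \<tau>0 v0_def eventually_mono)
          define uc where "uc s = u j (clamp01 s)" for s
          have ucc: "isCont uc s" for s unfolding uc_def by (rule isCont_clamped[OF cu[OF j]])
          have uc0: "uc s1 = u0" using s1 by (simp add: uc_def u0_def clamp01)
          define x where "x z = qv mb v0 / qv mb (cc (snd (fst z)))" for z :: "(complex \<times> real) \<times> real"
          define y where "y z = \<Lambda> v0 u0 / \<Lambda> v0 (uc (snd z))" for z :: "(complex \<times> real) \<times> real"
          let ?z0 = "((t0, s0), s1)"
          have xy0: "x ?z0 = 1" "y ?z0 = 1" using q0 \<Lambda>0 by (simp_all add: x_def y_def cc0 uc0)
          have c1: "isCont (\<lambda>z. cc (snd (fst z))) ?z0"
            by (rule isCont_o2[OF _ cont_cc]) (intro continuous_intros)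
          have c2: "isCont (\<lambda>z. uc (snd z)) ?z0"
            by (rule isCont_o2[OF _ ucc]) (intro continuous_intros)
          have cx: "isCont x ?z0"
            unfolding x_def qv_def by (intro continuous_intros c1) (use v0 cc0 in auto)
          have cy: "isCont y ?z0"
            unfolding y_def \<Lambda>_def by (intro continuous_intros c2) (use u0 q0 uc0 in auto)
          have cs1: "isCont csqrt 1"
            by (rule field_differentiable_imp_continuous_at[OF field_differentiable_at_csqrt]) auto
          \<comment> \<open>\<open>csqrt\<close> is not multiplicative, but a product of roots is
            the principal root while its real part is positive. Both radicands are \<open>1\<close>
            at \<open>?z0\<close>, so this holds nearby.\<close>
          have "\<forall>\<^sub>F z in nhds ?z0. Re (csqrt (x z) * csqrt (y z)) > 0"
          proof (rule eventually_Re_pos)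
            show "isCont (\<lambda>z. csqrt (x z) * csqrt (y z)) ?z0"
              by (intro continuous_intros isCont_o2[OF cx] isCont_o2[OF cy]) (simp_all only: xy0 cs1)
          qed (simp add: xy0)
          with ev ev2 show ?thesis
          proof eventually_elim
            case (elim z)
            show ?case
            proof (intro impI)
              assume s: "snd z \<in> {0..1}" "snd (fst z) \<in> {0..1}"
              let ?v = "c (snd (fst z))" and ?u = "u j (snd z)"
              have zM: "fst z \<in> M" and gz: "g j z = csqrt (\<Lambda> v0 u0 / \<Lambda> ?v ?u) * \<phi> (S (fst (fst z)) ?v ?u)"
                using elim s by auto
              have tM: "(\<tau> (fst z), s0) \<in> M" and gt: "g j ((\<tau> (fst z), s0), snd z)
                  = csqrt (\<Lambda> v0 u0 / \<Lambda> v0 ?u) * \<phi> (S (\<tau> (fst z)) v0 ?u)"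
                using elim s by auto
              have nzu: "?u \<noteq> 0" "?u + 1 \<noteq> 0"
                using nz[OF j _ s(1), of "fst (fst z)" "snd (fst z)"] zM by auto
              have ev: "cc (snd (fst z)) = ?v" "uc (snd z) = ?u" using s by (simp_all add: cc uc_def clamp01)
              have xy: "x z = qv mb v0 / qv mb ?v" "y z = \<Lambda> v0 u0 / \<Lambda> v0 ?u"
                by (simp_all add: x_def y_def ev)
              have "S (\<tau> (fst z)) v0 ?u = S (fst (fst z)) ?v ?u"
                using w0 by (simp add: S_def \<tau>_def ev)
              moreover have "csqrt (\<Lambda> v0 u0 / \<Lambda> ?v ?u) = csqrt (x z) * csqrt (y z)"
              proof (rule csqrt_unique)
                have "x z * y z = \<Lambda> v0 u0 / \<Lambda> ?v ?u"
                  using nzu q0 by (simp add: xy \<Lambda>_def mult_ac)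
                then show "(csqrt (x z) * csqrt (y z))\<^sup>2 = \<Lambda> v0 u0 / \<Lambda> ?v ?u"
                  by (simp add: power_mult_distrib)
              qed (use elim in auto)
              ultimately show "fst z \<in> M \<and> (\<tau> (fst z), s0) \<in> M \<and>
                  g j z = csqrt (qv mb v0 / qv mb ?v) * g j ((\<tau> (fst z), s0), snd z)"
                unfolding gz gt using zM tM by (simp add: xy)
            qed
          qed
        qed
        \<comment> \<open>The neighbourhood of \<open>(t0, s0)\<close> must serve for all
          \<open>s'\<close> at once, since the identity is integrated over the whole path.\<close>
        from eventually_tube[OF compact_Icc this]
        show ?thesis by (auto elim!: eventually_mono)
      qed
      have "\<forall>\<^sub>F p in nhds (t0, s0). \<forall>j\<in>{..<m}. \<forall>s'\<in>{0..1}. snd p \<in> {0..1} \<longrightarrow> p \<in> M \<and> (\<tau> p, s0) \<in> M \<and>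
          g j (p, s') = csqrt (qv mb v0 / qv mb (c (snd p))) * g j ((\<tau> p, s0), s')"
        by (rule eventually_ball_finite) (use each in auto)
      then show ?thesis
      proof eventually_elim
        case (elim p)
        show ?case
        proof
          assume p: "snd p \<in> {0..1}"
          have pM: "p \<in> M" "(\<tau> p, s0) \<in> M" using elim False p by (force dest: bspec[of _ _ 0])+
          have "h p = (\<Sum>j<m. integral {0..1} (\<lambda>s. csqrt (qv mb v0 / qv mb (c (snd p)))
             * (g j ((\<tau> p, s0), s) * velocity (u j) s)))"
            unfolding h[OF pM(1)]
          proof (intro sum.cong refl integral_cong)
            fix j s assume "j \<in> {..<m}" "s \<in> {0..1::real}"
            then show "g j (p, s) * velocity (u j) s
              = csqrt (qv mb v0 / qv mb (c (snd p)))
                * (g j ((\<tau> p, s0), s) * velocity (u j) s)"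
              using elim p by simp
          qed
          also have "\<dots> = csqrt (qv mb v0 / qv mb (c (snd p))) * h (\<tau> p, s0)"
            using h pM by (simp add: sum_distrib_left)
          finally show "h p = csqrt (qv mb v0 / qv mb (c (snd p))) * f (fst p * wt k l (c (snd p)) / wt k l v0)"
            by (simp add: f_def \<tau>_def cc[OF p])
        qed
      qed
    qed
    define w where "w = c_kl k l * wt k l v0"
    have w: "w \<noteq> 0" using w0 c_kl_nz[OF kl] by (simp add: w_def)
    \<comment> \<open>Dividing by \<open>w\<close> changes from the variable \<open>t\<close> of the
      fibre over \<open>v0\<close> to \<open>c_kl k l * wt k l v * t\<close>; this absorbs the
      constant in \<open>f_ode\<close>.\<close>
    define D where "D = (\<lambda>x. 1 / w * x) -` T1"
    define \<phi> where "\<phi> x = 1 * f (1 / w * x)" for x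
    define r where "r v = csqrt (qv mb v0 / qv mb v)" for v
    have D: "open D" unfolding D_def by (intro open_vimage T1 continuous_intros)
    have \<phi>h: "\<phi> holomorphic_on D"
      unfolding \<phi>_def
      by (intro holomorphic_intros holomorphic_on_compose_gen[OF _ fh, unfolded o_def])
        (auto simp: D_def intro!: holomorphic_intros)
    have \<phi>_ode: "Theta [0, 0, 0] \<phi> x = x * Theta Q \<phi> x" if "x \<in> D" for x
    proof -
      have T: "Theta as \<phi> x = Theta as f (1 / w * x)" for as
        unfolding \<phi>_def using that Theta_rescale[OF T1(1) fh, of "1 / w" x as 1] by (simp add: D_def)
      show ?thesis
        unfolding T using f_ode[of "1 / w * x"] that w by (simp add: D_def w_def del: Theta_simps)
    qed
    have "\<forall>\<^sub>F z in nhds (t0, v0). c_kl k l * wt k l (snd z) * fst z \<in> D"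
    proof (rule eventually_nhds_isCont[where f = "\<lambda>z. c_kl k l * wt k l (snd z) * fst z"])
      show "isCont (\<lambda>z. c_kl k l * wt k l (snd z) * fst z) (t0, v0)"
        unfolding wt_def using v0 by (intro continuous_intros) auto
      show "\<forall>\<^sub>F y in nhds (c_kl k l * wt k l (snd (t0, v0)) * fst (t0, v0)). y \<in> D"
        using T1(2) w by (intro eventually_nhds_in_open D) (simp add: D_def w_def)
    qed
    from eventually_nhds_prodD[OF this, unfolded fst_conv snd_conv]
    obtain A B where AB: "open A" "open B" "t0 \<in> A" "v0 \<in> B"
      "\<forall>t\<in>A. \<forall>v\<in>B. c_kl k l * wt k l v * t \<in> D"
      by (elim exE conjE)
    have "\<forall>\<^sub>F v in nhds v0. Re (qv mb v0 / qv mb v) > 0"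
    proof (rule eventually_Re_pos)
      show "isCont (\<lambda>v. qv mb v0 / qv mb v) v0"
        unfolding qv_def using v0 by (intro continuous_intros) auto
    qed (use q0 in simp)
    then obtain B2 where B2: "open B2" "v0 \<in> B2" "\<And>v. v \<in> B2 \<Longrightarrow> Re (qv mb v0 / qv mb v) > 0"
      unfolding eventually_nhds by blast
    define V where "V = B \<inter> B2 \<inter> (UNIV - {0, -1})"
    have V: "open V" "v0 \<in> V" "0 \<notin> V" "-1 \<notin> V"
      using AB B2 v0 by (auto simp: V_def add_eq_0_iff2 intro!: open_Diff)
    have Vnz: "x \<noteq> 0" "x + 1 \<noteq> 0" if "x \<in> V" for x
      using V that by (auto simp: eq_neg_iff_add_eq_0[symmetric])
    have r': "(r has_field_derivative - (1 / v + \<beta> / (v + 1)) * r v) (at v)" if v: "v \<in> V" for v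
      unfolding r_def
      by (rule csqrt_ratio_deriv[where V = V]) (use v B2 Vnz V_def qv_deriv[OF _ _ \<beta>(1)] in auto)
    from eventually_nhds_prodD[OF hom, unfolded fst_conv snd_conv]
    obtain A2 B3 where A2: "open A2" "open B3" "t0 \<in> A2" "s0 \<in> B3"
      "\<forall>t\<in>A2. \<forall>s\<in>B3. s \<in> {0..1} \<longrightarrow>
        h (t, s) = csqrt (qv mb v0 / qv mb (c s)) * f (t * wt k l (c s) / wt k l v0)"
      by (elim exE conjE)
    have "\<forall>\<^sub>F s in nhds s0. cc s \<in> V"
      by (rule eventually_nhds_isCont[OF cont_cc])
        (use V s0 in \<open>auto simp: cc v0_def intro!: eventually_nhds_in_open\<close>)
    then obtain B4 where B4: "open B4" "s0 \<in> B4" "\<And>s. s \<in> B4 \<Longrightarrow> cc s \<in> V"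
      unfolding eventually_nhds by blast
    obtain \<delta> where \<delta>: "\<delta> > 0" "ball s0 \<delta> \<subseteq> B3 \<inter> B4"
      using A2 B4 open_contains_ball[of "B3 \<inter> B4"] by blast
    have fin: "c s \<in> V \<and> h (t, s) = r (c s) * \<phi> (c_kl k l * wt k l (c s) * t)"
      if "t \<in> A \<inter> A2" "s \<in> {0..1}" "\<bar>s - s0\<bar> < \<delta>" for t s
    proof -
      have s: "s \<in> B3" "s \<in> B4" using \<delta> that by (auto simp: dist_real_def subset_iff)
      have "1 / w * (c_kl k l * wt k l (c s) * t) = t * wt k l (c s) / wt k l v0"
        using w by (simp add: w_def)
      then show ?thesis
        using A2(5) B4(3)[OF s(2)] that s by (simp add: cc r_def \<phi>_def)
    qed
    have "Theta (replicate (length Q) 0) \<phi> x = x * Theta Q \<phi> x" if "x \<in> D" for x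
      using \<phi>_ode[OF that] by (simp add: Q_def numeral_3_eq_3 del: Theta_simps)
    then show ?thesis
      by (intro twist_at_chart[of "A \<inter> A2" t0 \<delta> V c s0 r \<beta> D \<phi>])
        (use V D \<phi>h r' fin AB A2 \<delta> in \<open>auto simp: v0_def[symmetric] V_def\<close>)
  qed
  then show "twist_at k l \<beta> (c_kl k l) [1 / 2, mu n, 1 - mu n] c (\<lambda>t s. h (t, s)) t0 s0"
    unfolding Q_def .
qed

text \<open>Cycles are supplied only near each parameter value, but holomorphy and the differential
  equation are local. Here \<open>C = c_kl k l\<close>, so no constant remains.\<close>

theorem threefold_period_ode:
  assumes \<beta>: "\<beta> = of_nat mb / 2" "mb > 0" and kl: "k > 0" "l > 0"
    and W: "open W" and per: "threefold_period n k l \<beta> W P"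
    and red: "reduces k l \<beta> k l [1, 1 / 2, mu n, 1 - mu n] Q"
  shows "P holomorphic_on W" "t \<in> W \<Longrightarrow> Theta [0, 0, 0, 0] P t = t * Theta Q P t"
proof -
  from per obtain R where R: "warped_period
      (\<lambda>c. surface_period (\<lambda>(t, s). g2_CY n k l \<beta> t (c s)) (\<lambda>(t, s). g3_CY n k l \<beta> t (c s))) W R"
    and PR: "\<And>t. t \<in> W \<Longrightarrow> P t = form_const n * R t"
    unfolding threefold_period_def by blast
  have loc: "\<exists>N. open N \<and> t0 \<in> N \<and> N \<subseteq> W \<and> R holomorphic_on N \<and>
      (\<forall>t\<in>N. Theta [0, 0, 0, 0] R t = t * Theta Q R t)" if t0: "t0 \<in> W" for t0
  proof -
    from R[unfolded warped_period_def pathfinish_def pathstart_def, rule_format, OF t0]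
    obtain N m c h where N: "openin (top_of_set W) N" "t0 \<in> N"
      and ch': "\<forall>j<(m::nat). valid_path (c j) \<and> surface_period (\<lambda>(t, s). g2_CY n k l \<beta> t (c j s))
        (\<lambda>(t, s). g3_CY n k l \<beta> t (c j s)) (N \<times> {0..1}) (h j)"
      and bd': "\<forall>z\<in>N. \<forall>x. (\<Sum>j<m. if c j 1 = x then h j (z, 1) else 0)
                   = (\<Sum>j<m. if c j 0 = x then h j (z, 0) else 0)"
      and Rh': "\<forall>z\<in>N. R z = (\<Sum>j<m. integral {0..1}
                  (\<lambda>s. h j (z, s) * velocity (c j) s))"
      by (elim exE conjE)
    note vc = ch'[rule_format, THEN conjunct1] and ch = ch'[rule_format, THEN conjunct2]
      and bd = bd'[rule_format] and Rh = Rh'[rule_format]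
    have N': "open N" "N \<subseteq> W" using N W openin_open_eq by blast+
    interpret twisted_cycle k l \<beta> "c_kl k l" "[1 / 2, mu n, 1 - mu n]" N m c "\<lambda>j t s. h j (t, s)"
      by unfold_locales
        (use N' kl vc ch bd surface_period_twist[OF \<beta> kl N'(1)] in auto)
    have "R holomorphic_on N" by (rule twisted_ode(1)[OF red]) (use Rh in auto)
    moreover have "Theta [0, 0, 0, 0] R t = t * Theta Q R t" if "t \<in> N" for t
      using twisted_ode(2)[OF red _ that, of R] Rh c_kl_nz[OF kl]
      by (simp add: numeral_3_eq_3 del: Theta_simps)
    ultimately show ?thesis using N N' by blast
  qed
  have Rhol: "R holomorphic_on W"
    unfolding holomorphic_on_open[OF W]
  proof
    fix t assume "t \<in> W"
    from loc[OF this] obtain N where "open N" "t \<in> N" "R holomorphic_on N" by blast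
    then show "\<exists>f'. (R has_field_derivative f') (at t)"
      by (meson holomorphic_on_open)
  qed
  have "(\<lambda>t. form_const n * R t) holomorphic_on W" by (intro holomorphic_intros Rhol)
  then show "P holomorphic_on W" by (rule holomorphic_transform) (simp add: PR)
  assume t: "t \<in> W"
  have Th: "Theta as P t = form_const n * Theta as R t" for as
    using Theta_cong[OF W PR t] Theta_rescale[OF W Rhol, of 1 t as "form_const n"] t by simp
  from loc[OF t] have "Theta [0, 0, 0, 0] R t = t * Theta Q R t" by blast
  then show "Theta [0, 0, 0, 0] P t = t * Theta Q P t" unfolding Th by simp
qed

section \<open>Solutions that are holomorphic at the origin\<close>

text \<open>\<open>\<theta> + a\<close> acts diagonally, multiplying \<open>t^n\<close> by
  \<open>a + n\<close>.\<close>

lemma Theta_fps_expansion: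
  fixes f :: "complex \<Rightarrow> complex"
  assumes "f has_fps_expansion F"
  shows "Theta as f has_fps_expansion Abs_fps (\<lambda>n. (\<Prod>a\<leftarrow>as. a + of_nat n) * fps_nth F n)"
proof (induction as)
  case Nil
  have "Abs_fps (\<lambda>n. fps_nth F n) = F" by (simp add: fps_eq_iff)
  then show ?case using assms by simp
next
  case (Cons a as)
  let ?G = "Abs_fps (\<lambda>n. (\<Prod>a\<leftarrow>as. a + of_nat n) * fps_nth F n)"
  have "(\<lambda>t. t * deriv (Theta as f) t + a * Theta as f t) has_fps_expansion
      fps_X * fps_deriv ?G + fps_const a * ?G"
    by (intro fps_expansion_intros Cons)
  moreover have "fps_X * fps_deriv ?G + fps_const a * ?G
      = Abs_fps (\<lambda>n. (\<Prod>a\<leftarrow>a # as. a + of_nat n) * fps_nth F n)"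
  proof (rule fps_ext)
    fix n
    show "fps_nth (fps_X * fps_deriv ?G + fps_const a * ?G) n
      = fps_nth (Abs_fps (\<lambda>n. (\<Prod>a\<leftarrow>a # as. a + of_nat n) * fps_nth F n)) n"
      by (cases n) (simp_all add: algebra_simps)
  qed
  moreover have "Theta (a # as) f = (\<lambda>t. t * deriv (Theta as f) t + a * Theta as f t)"
    by (simp add: theta_plus_def theta_def fun_eq_iff)
  ultimately show ?case by simp
qed

lemma foldl_mult_prod_list:
  fixes c :: complex
  shows "foldl (\<lambda>r a. r * (a + x)) c as = c * (\<Prod>a\<leftarrow>as. a + x)"
  by (induction as arbitrary: c) (simp_all add: mult_ac)

lemma prod_list_replicate: "(\<Prod>a\<leftarrow>replicate r (z::complex). a + x) = (z + x) ^ r"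
  by (induction r) simp_all

text \<open>Comparing coefficients gives
  \<open>(n + 1)^(r + 1) F (n + 1) = (\<Prod>a. a + n) F n\<close>. The leading factor never
  vanishes, so \<open>F\<close> is determined by its constant term.\<close>

theorem hypergeometric_unique:
  assumes \<rho>: "\<rho> > 0" and f: "f holomorphic_on ball 0 \<rho>"
    and ode: "\<And>t. t \<in> ball 0 \<rho> \<Longrightarrow> Theta (replicate (Suc r) 0) f t = t * Theta Q f t"
  shows "\<forall>\<^sub>F t in nhds 0. f t = f 0 * eval_fps (fps_hypergeo Q (replicate r 1) 1) t"
proof -
  have "f analytic_on {0}"
    using f \<rho> by (auto simp: analytic_at intro!: exI[of _ "ball 0 \<rho>"])
  then have F: "f has_fps_expansion fps_expansion f 0"
    by (rule analytic_at_imp_has_fps_expansion_0)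
  define F where "F = fps_expansion f 0"
  define H where "H = fps_hypergeo Q (replicate r (1::complex)) 1"
  note F = F[folded F_def]
  have "Theta (replicate (Suc r) 0) f has_fps_expansion Abs_fps (\<lambda>n. of_nat n ^ Suc r * fps_nth F n)"
    using Theta_fps_expansion[OF F, of "replicate (Suc r) 0"] by (simp only: prod_list_replicate) simp
  moreover have "(\<lambda>t. t * Theta Q f t) has_fps_expansion
      fps_X * Abs_fps (\<lambda>n. (\<Prod>a\<leftarrow>Q. a + of_nat n) * fps_nth F n)"
    by (intro fps_expansion_intros Theta_fps_expansion F)
  moreover have "\<forall>\<^sub>F t in nhds 0. Theta (replicate (Suc r) 0) f t = t * Theta Q f t"
    using eventually_nhds_in_open[of "ball 0 \<rho>" "0::complex"] \<rho> by (auto elim!: eventually_mono intro!: ode simp del: Theta_simps replicate.simps)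
  ultimately have "(\<lambda>t. t * Theta Q f t) has_fps_expansion Abs_fps (\<lambda>n. of_nat n ^ Suc r * fps_nth F n)"
    "(\<lambda>t. t * Theta Q f t) has_fps_expansion fps_X * Abs_fps (\<lambda>n. (\<Prod>a\<leftarrow>Q. a + of_nat n) * fps_nth F n)"
    using has_fps_expansion_cong[OF _ refl, of "Theta (replicate (Suc r) 0) f" "\<lambda>t. t * Theta Q f t"] by blast+
  then have eq: "Abs_fps (\<lambda>n. of_nat n ^ Suc r * fps_nth F n)
      = fps_X * Abs_fps (\<lambda>n. (\<Prod>a\<leftarrow>Q. a + of_nat n) * fps_nth F n)"
    by (rule fps_expansion_unique_complex)
  have rec: "of_nat (Suc n) ^ Suc r * fps_nth F (Suc n) = (\<Prod>a\<leftarrow>Q. a + of_nat n) * fps_nth F n" for n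
    using arg_cong[OF eq, of "\<lambda>G. fps_nth G (Suc n)"] by (simp only: fps_nth_Abs_fps fps_X_mult_nth) simp
  have "fps_nth F n = fps_nth F 0 * fps_nth H n" for n
  proof (induction n)
    case 0
    show ?case unfolding H_def fps_hypergeo_0 by simp
  next
    case (Suc n)
    \<comment> \<open>The \<open>r\<close> lower parameters \<open>1\<close> give \<open>r\<close>
      factors \<open>n + 1\<close>; the factorial in the hypergeometric series gives one
      more.\<close>
    have h: "fps_nth H (Suc n) = (\<Prod>a\<leftarrow>Q. a + of_nat n) / of_nat (Suc n) ^ Suc r * fps_nth H n"
      unfolding H_def fps_hypergeo_rec foldl_mult_prod_list prod_list_replicate by (simp add: add.commute)
    have "(of_nat (Suc n) :: complex) \<noteq> 0" by (simp only: of_nat_eq_0_iff)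
    then have "fps_nth F (Suc n) = (\<Prod>a\<leftarrow>Q. a + of_nat n) / of_nat (Suc n) ^ Suc r * fps_nth F n"
      using rec[of n] by (simp add: field_simps del: of_nat_Suc)
    then show ?case by (simp only: h Suc.IH mult.left_commute)
  qed
  then have FH: "F = fps_const (fps_nth F 0) * H"
    unfolding fps_eq_iff fps_mult_left_const_nth by blast
  have F0: "fps_nth F 0 = f 0" by (simp add: F_def fps_expansion_def)
  show ?thesis
  \<comment> \<open>If \<open>f 0\<close> is nonzero, convergence of the hypergeometric series is
    inherited from \<open>f / f 0\<close>; otherwise both sides vanish near
    \<open>0\<close>.\<close>
  proof (cases "f 0 = 0")
    case True
    then have "F = 0" using FH F0 by simp
    then have "\<forall>\<^sub>F t in nhds 0. eval_fps 0 t = f t"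
      using F by (simp add: has_fps_expansion_def)
    then show ?thesis by eventually_elim (simp add: True)
  next
    case False
    have "(\<lambda>t. 1 / f 0 * f t) has_fps_expansion fps_const (1 / f 0) * F"
      by (intro fps_expansion_intros F)
    also have "fps_const (1 / f 0) * F = H"
      by (subst FH) (use False in \<open>simp add: F0 fps_eq_iff\<close>)
    finally have "\<forall>\<^sub>F t in nhds 0. eval_fps H t = 1 / f 0 * f t"
      by (simp add: has_fps_expansion_def)
    then show ?thesis by eventually_elim (use False in \<open>simp add: H_def\<close>)
  qed
qed

section \<open>Twisting along a circle\<close>

definition circ :: "real \<Rightarrow> complex" where "circ = circlepath 0 (1 / 2)"

lemma circ_eq: "circ s = 1 / 2 * exp (2 * of_real pi * \<i> * of_real s)"
  by (simp add: circ_def circlepath)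

lemma circ_path: "valid_path circ" "circ 1 = circ 0"
  by (simp add: circ_def) (simp add: circ_eq)

lemma norm_circ: "norm (circ s) = 1 / 2"
  unfolding circ_eq norm_mult by (simp add: norm_exp_i_times mult.commute mult.left_commute)

lemma norm_half:
  assumes "norm (v::complex) = 1 / 2"
  shows "v \<noteq> 0" "Re (v + 1) > 0" "v + 1 \<noteq> 0" "norm (v + 1) \<ge> 1 / 2"
proof -
  show "v \<noteq> 0" using assms by auto
  show "Re (v + 1) > 0" using abs_Re_le_cmod[of v] assms by simp
  then show "v + 1 \<noteq> 0" by (metis less_irrefl zero_complex.simps(1))
  show "norm (v + 1) \<ge> 1 / 2"
    using norm_triangle_ineq2[of 1 "- v"] assms by (simp add: add.commute)
qed

text \<open>The principal branch is legitimate near the circle, where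
  \<open>Re (v + 1) > 0\<close>.\<close>

definition rad :: "complex \<Rightarrow> complex \<Rightarrow> complex" where
  "rad \<beta> v = (v + 1) powr (- \<beta>) / v"

lemma rad_deriv:
  assumes "v \<noteq> 0" "Re (v + 1) > 0"
  shows "(rad \<beta> has_field_derivative - (1 / v + \<beta> / (v + 1)) * rad \<beta> v) (at v)"
proof -
  have nz: "v + 1 \<noteq> 0" using assms(2) by (metis less_irrefl zero_complex.simps(1))
  have "((\<lambda>z. z powr (- \<beta>)) has_field_derivative - \<beta> * (v + 1) powr (- \<beta> - 1)) (at (v + 1))"
    by (rule has_field_derivative_powr) (use assms in \<open>auto simp: complex_nonpos_Reals_iff\<close>)
  then have "((\<lambda>v. (v + 1) powr (- \<beta>)) has_field_derivative - \<beta> * (v + 1) powr (- \<beta> - 1)) (at v)"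
    by (rule DERIV_chain2[where f = "\<lambda>z. z powr (- \<beta>)" and g = "\<lambda>v. v + 1" and Db = 1, THEN DERIV_cong])
      (auto intro!: derivative_eq_intros)
  from DERIV_divide[OF this DERIV_ident assms(1)]
  show ?thesis
    unfolding rad_def[abs_def]
    by (rule DERIV_cong) (use nz assms in \<open>simp add: powr_diff divide_simps; simp add: algebra_simps\<close>)
qed

lemma rad_1: "v + 1 \<noteq> 0 \<Longrightarrow> rad 1 v = 1 / (v * (v + 1))"
  by (simp add: rad_def powr_minus divide_simps)

lemma norm_wt_circ:
  assumes "norm (v::complex) = 1 / 2"
  shows "norm (wt k l v) \<le> 2 ^ (k + l)"
proof -
  have "(1 / 2) ^ k * (1 / 2) ^ l \<le> norm v ^ k * norm (v + 1) ^ l"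
    using assms norm_half(4)[OF assms] by (intro mult_mono power_mono) auto
  then have "1 / (norm v ^ k * norm (v + 1) ^ l) \<le> 1 / ((1 / 2) ^ k * (1 / 2) ^ l)"
    by (intro divide_left_mono) (auto simp: norm_half[OF assms] intro!: mult_pos_pos)
  then show ?thesis by (simp add: wt_def norm_divide norm_mult norm_power power_add power_one_over)
qed

text \<open>On the circle both \<open>v\<close> and \<open>v + 1\<close> have modulus at least
  \<open>1/2\<close>, hence the power of \<open>2\<close>. The added \<open>1\<close> keeps the
  denominator positive for every \<open>C\<close>.\<close>

lemma wt_circ_small:
  assumes "\<rho> > 0" "norm (v::complex) = 1 / 2" "t \<in> ball 0 (\<rho> / ((norm C + 1) * 2 ^ (k + l)))"
  shows "C * wt k l v * t \<in> ball 0 \<rho>"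
proof -
  have "norm (C * wt k l v * t) = norm C * norm (wt k l v) * norm t" by (simp add: norm_mult)
  also have "\<dots> \<le> (norm C + 1) * 2 ^ (k + l) * norm t"
    by (intro mult_right_mono mult_mono norm_wt_circ assms) auto
  also have "\<dots> < \<rho>"
  proof -
    define X where "X = (norm C + 1) * 2 ^ (k + l)"
    have "X > 0" by (simp add: X_def add_nonneg_pos)
    moreover have "norm t < \<rho> / X" using assms(3) by (simp add: X_def)
    ultimately show ?thesis unfolding X_def[symmetric] by (simp add: pos_less_divide_eq mult.commute)
  qed
  finally show ?thesis by simp
qed

lemma circle_twist_family:
  assumes \<rho>: "\<rho> > 0" and E: "E holomorphic_on ball 0 \<rho>"
    and ode: "\<forall>x\<in>ball 0 \<rho>. Theta (replicate (length Q) 0) E x = x * Theta Q E x"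
  shows "twist_family k l \<beta> C Q (ball 0 (\<rho> / ((norm C + 1) * 2 ^ (k + l)))) circ
    (\<lambda>t s. rad \<beta> (circ s) * E (C * wt k l (circ s) * t))"
  unfolding twist_family_def
proof (intro ballI)
  fix t0 :: complex and s0 :: real
  assume t0: "t0 \<in> ball 0 (\<rho> / ((norm C + 1) * 2 ^ (k + l)))" and s0: "s0 \<in> {0..1}"
  define v0 where "v0 = circ s0"
  have v0: "norm v0 = 1 / 2" by (simp add: v0_def norm_circ)
  note v0' = norm_half[OF v0]
  have "\<forall>\<^sub>F z in nhds (t0, v0). C * wt k l (snd z) * fst z \<in> ball 0 \<rho>"
  proof (rule eventually_nhds_isCont[where f = "\<lambda>z. C * wt k l (snd z) * fst z"])
    show "isCont (\<lambda>z. C * wt k l (snd z) * fst z) (t0, v0)"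
      unfolding wt_def using v0' by (intro continuous_intros) auto
    show "\<forall>\<^sub>F y in nhds (C * wt k l (snd (t0, v0)) * fst (t0, v0)). y \<in> ball 0 \<rho>"
      using wt_circ_small[OF \<rho> v0 t0] by (intro eventually_nhds_in_open) auto
  qed
  from eventually_nhds_prodD[OF this, unfolded fst_conv snd_conv]
  obtain A B where AB: "open A" "open B" "t0 \<in> A" "v0 \<in> B"
    "\<forall>t\<in>A. \<forall>v\<in>B. C * wt k l v * t \<in> ball 0 \<rho>"
    by (elim exE conjE)
  \<comment> \<open>Inside the unit disc \<open>v + 1\<close> has positive real part, as
    \<open>rad_deriv\<close> requires.\<close>
  define V where "V = B \<inter> (ball 0 1 - {0})"
  have V: "open V" "v0 \<in> V" "0 \<notin> V" "-1 \<notin> V"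
    using AB v0 v0' by (auto simp: V_def intro!: open_Diff)
  have Vre: "v \<noteq> 0" "Re (v + 1) > 0" if "v \<in> V" for v
    using that abs_Re_le_cmod[of v] by (auto simp: V_def)
  have "isCont circ s0" unfolding circ_eq[abs_def] by (intro continuous_intros)
  then have "\<forall>\<^sub>F s in nhds s0. circ s \<in> V"
    by (rule eventually_nhds_isCont) (use V in \<open>auto simp: v0_def intro!: eventually_nhds_in_open\<close>)
  then obtain \<delta> where \<delta>: "\<delta> > 0" "\<And>s. dist s s0 < \<delta> \<Longrightarrow> circ s \<in> V"
    unfolding eventually_nhds_metric by blast
  show "twist_at k l \<beta> C Q circ (\<lambda>t s. rad \<beta> (circ s) * E (C * wt k l (circ s) * t)) t0 s0"
    by (rule twist_at_chart[of A t0 \<delta> V circ s0 "rad \<beta>" \<beta> "ball 0 \<rho>" E])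
      (use V \<delta> AB rad_deriv[OF Vre] ode E in
        \<open>auto simp: v0_def[symmetric] dist_real_def V_def simp del: Theta_simps\<close>)
qed

text \<open>A closed circle with a period that returns to itself is a cycle with one path. At
  \<open>t = 0\<close> the fibre period is the constant \<open>E 0\<close>, and the residue of
  \<open>(v + 1)^(-\<beta>) / v\<close> at \<open>0\<close> is \<open>1\<close>; each circle thus
  contributes one factor \<open>2 \<pi> i\<close>.\<close>

theorem circle_twist:
  assumes \<rho>: "\<rho> > 0" and E: "E holomorphic_on ball 0 \<rho>"
    and ode: "\<forall>x\<in>ball 0 \<rho>. Theta (replicate (length Q) 0) E x = x * Theta Q E x"
    and red: "reduces k l \<beta> k l (1 # Q) Q'" and kl: "k > 0" "l > 0"
  defines "\<rho>' \<equiv> \<rho> / ((norm (c_kl k l) + 1) * 2 ^ (k + l))"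
    and "P \<equiv> \<lambda>t. integral {0..1} (\<lambda>s. rad \<beta> (circ s) * E (c_kl k l * wt k l (circ s) * t)
      * velocity circ s)"
  shows "\<rho>' > 0" "P holomorphic_on ball 0 \<rho>'"
    "\<And>t. t \<in> ball 0 \<rho>' \<Longrightarrow> Theta (replicate (Suc (length Q)) 0) P t = t * Theta Q' P t"
    "P 0 = 2 * of_real pi * \<i> * E 0"
proof -
  interpret twisted_cycle k l \<beta> "c_kl k l" Q "ball 0 \<rho>'" 1 "\<lambda>_. circ"
    "\<lambda>_ t s. rad \<beta> (circ s) * E (c_kl k l * wt k l (circ s) * t)"
    by unfold_locales
      (use circle_twist_family[OF \<rho> E ode] kl circ_path in \<open>auto simp: \<rho>'_def\<close>)
  have P: "P t = (\<Sum>j<(1::nat). integral {0..1} (\<lambda>s. rad \<beta> (circ s) * E (c_kl k l * wt k l (circ s) * t)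
      * velocity circ s))" for t
    by (simp add: P_def)
  have "norm (c_kl k l) + 1 > 0" by (simp add: add_nonneg_pos)
  then show "\<rho>' > 0" using \<rho> by (simp add: \<rho>'_def)
  show "P holomorphic_on ball 0 \<rho>'" by (rule twisted_ode(1)[OF red P])
  show "Theta (replicate (Suc (length Q)) 0) P t = t * Theta Q' P t" if "t \<in> ball 0 \<rho>'" for t
    using twisted_ode(2)[OF red P that] c_kl_nz[OF kl] by simp
  have "((\<lambda>v. (v + 1) powr (- \<beta>) / (v - 0)) has_contour_integral
      2 * of_real pi * \<i> * (0 + 1) powr (- \<beta>)) (circlepath 0 (1 / 2))"
  proof (rule Cauchy_integral_circlepath_simple)
    show "(\<lambda>v. (v + 1) powr (- \<beta>)) holomorphic_on cball 0 (1 / 2)"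
    proof (intro holomorphic_intros)
      fix v :: complex assume "v \<in> cball 0 (1 / 2)"
      then show "v + 1 \<notin> \<real>\<^sub>\<le>\<^sub>0"
        using abs_Re_le_cmod[of v] by (auto simp: complex_nonpos_Reals_iff)
    qed
  qed simp
  then have "((\<lambda>s. rad \<beta> (circ s) * velocity circ s) has_integral
      2 * of_real pi * \<i>) {0..1}"
    by (simp add: has_contour_integral_def rad_def circ_def)
  from integral_unique[OF has_integral_mult_left[OF this, of "E 0"]]
  have "integral {0..1} (\<lambda>s. rad \<beta> (circ s) * velocity circ s * E 0)
    = 2 * of_real pi * \<i> * E 0" .
  moreover have "P 0 = integral {0..1} (\<lambda>s. rad \<beta> (circ s) * velocity circ s * E 0)"
    unfolding P_def by (rule integral_cong) simp
  ultimately show "P 0 = 2 * of_real pi * \<i> * E 0" by (rule trans[rotated])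
qed

section \<open>The vanishing cycle of the elliptic curves\<close>

lemma node_nz: "node n \<noteq> 0"
  by (simp add: node_def)

lemma node_cubic: "4 * x ^ 3 - g2 n 0 * x - g3 n 0 = 4 * (x - node n) ^ 2 * (x + 2 * node n)"
  unfolding g2_def g3_def node_def
  by (simp add: power2_eq_square power3_eq_cube algebra_simps)

definition acirc :: "nat \<Rightarrow> real \<Rightarrow> complex" where
  "acirc n = circlepath (node n) (norm (node n) / 2)"

definition vanish_y :: "nat \<Rightarrow> real \<Rightarrow> complex \<Rightarrow> complex" where
  "vanish_y n c t = csqrt (12 * node n) * (acirc n c - node n)
     * csqrt ((4 * acirc n c ^ 3 - g2 n t * acirc n c - g3 n t) / (12 * node n * (acirc n c - node n) ^ 2))"

lemma Sigma1_eq: "Sigma1 n t c = (acirc n c, vanish_y n c t)"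
  by (simp add: Sigma1_def Let_def acirc_def vanish_y_def circlepath)

lemma acirc_diff: "norm (acirc n c - node n) = norm (node n) / 2"
proof -
  have "acirc n c - node n = of_real (norm (node n) / 2) * exp (\<i> * of_real (2 * pi * c))"
    by (simp add: acirc_def circlepath mult_ac)
  then show ?thesis by (simp only: norm_mult norm_exp_i_times) simp
qed

text \<open>At \<open>t = 0\<close> the radicand on the circle is
  \<open>1 + (x - e) / (3 e)\<close>, at distance \<open>1/6\<close> from \<open>1\<close>; by
  compactness it stays in the right half-plane for small \<open>t\<close>. For \<open>t = 0\<close>
  the form \<open>dx / y\<close> has a simple pole at the node, whose residue gives the
  value.\<close>

theorem vanishing_period:
  obtains \<rho> where "\<rho> > 0" "continuous_on ({0..1} \<times> ball 0 \<rho>) (\<lambda>(c, t). vanish_y n c t)"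
    "\<And>c t. \<lbrakk>c \<in> {0..1}; t \<in> ball 0 \<rho>\<rbrakk> \<Longrightarrow> vanish_y n c t \<noteq> 0"
    "(\<lambda>t. one_form_integral (Sigma1 n t)) holomorphic_on ball 0 \<rho>"
    "\<And>t. t \<in> ball 0 \<rho> \<Longrightarrow> Theta [0, 0] (\<lambda>t. one_form_integral (Sigma1 n t)) t
      = t * Theta [mu n, 1 - mu n] (\<lambda>t. one_form_integral (Sigma1 n t)) t"
    "one_form_integral (Sigma1 n 0) = 2 * of_real pi * \<i> / csqrt (12 * node n)"
proof -
  define e where "e = node n"
  have e: "e \<noteq> 0" by (simp add: e_def node_nz)
  define q where "q z = (4 * acirc n (snd z) ^ 3 - g2 n (fst z) * acirc n (snd z) - g3 n (fst z))
     / (12 * e * (acirc n (snd z) - e) ^ 2)" for z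
  have w: "acirc n c \<noteq> e" "norm (acirc n c - e) = norm e / 2" for c
    using acirc_diff[of n c] e by (auto simp: e_def)
  have ca: "continuous_on A (acirc n)" for A
    unfolding acirc_def circlepath by (intro continuous_intros)
  have cq: "continuous_on UNIV q"
    unfolding q_def
    by (intro continuous_intros continuous_on_compose2[OF ca[of UNIV]]
        continuous_on_compose2[OF g_continuous(1)[of UNIV]] continuous_on_compose2[OF g_continuous(2)[of UNIV]])
      (use e w in auto)
  have q0: "q (0, c) = 1 + (acirc n c - e) / (3 * e)" for c
  proof -
    have "q (0, c) = 4 * (acirc n c - e) ^ 2 * (acirc n c + 2 * e) / (12 * e * (acirc n c - e) ^ 2)"
      by (simp add: q_def node_cubic e_def)
    also have "\<dots> = (acirc n c + 2 * e) / (3 * e)"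
    proof -
      have "4 * W * (acirc n c + 2 * e) / (12 * e * W) = (acirc n c + 2 * e) / (3 * e)" if "W \<noteq> 0" for W
        using that e by (simp add: field_simps)
      moreover have "(acirc n c - e) ^ 2 \<noteq> 0" using w(1)[of c] by simp
      ultimately show ?thesis .
    qed
    also have "\<dots> = 1 + (acirc n c - e) / (3 * e)" using e by (simp add: field_simps)
    finally show ?thesis .
  qed
  have "\<forall>\<^sub>F t in nhds 0. \<forall>c\<in>{0..1}. Re (q (t, c)) > 0"
  proof (rule eventually_tube[OF compact_Icc])
    fix c :: real
    have "norm ((acirc n c - e) / (3 * e)) = 1 / 6"
      using w(2)[of c] e by (simp add: norm_divide norm_mult)
    then have "Re (q (0, c)) > 0"
      unfolding q0 using abs_Re_le_cmod[of "(acirc n c - e) / (3 * e)"] by simp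
    then show "\<forall>\<^sub>F z in nhds (0, c). Re (q z) > 0"
      using cq by (intro eventually_Re_pos) (simp_all add: continuous_on_eq_continuous_at)
  qed
  then obtain \<rho> where \<rho>: "\<rho> > 0" "\<And>t c. t \<in> ball 0 \<rho> \<Longrightarrow> c \<in> {0..1} \<Longrightarrow> Re (q (t, c)) > 0"
    unfolding eventually_nhds_metric by (auto simp: dist_commute)
  have y_eq: "vanish_y n c t = csqrt (12 * e) * (acirc n c - e) * csqrt (q (t, c))" for c t
    by (simp add: vanish_y_def q_def e_def)
  have cy: "continuous_on ({0..1} \<times> ball 0 \<rho>) (\<lambda>(c, t). vanish_y n c t)"
  proof -
    have "continuous_on ({0..1} \<times> ball 0 \<rho>) (\<lambda>p. csqrt (12 * e) * (acirc n (fst p) - e) * csqrt (q (snd p, fst p)))"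
      by (intro continuous_intros continuous_on_csqrt_Re continuous_on_compose2[OF cq]
          continuous_on_compose2[OF ca[of UNIV]]) (use \<rho> in auto)
    then show ?thesis by (simp add: y_eq case_prod_beta)
  qed
  have y_nz: "vanish_y n c t \<noteq> 0" if "c \<in> {0..1}" "t \<in> ball 0 \<rho>" for c t
    using \<rho>(2)[OF that(2,1)] w(1)[of c] e by (auto simp: y_eq)
  have ac: "acirc n 1 = acirc n 0"
    using pathstart_circlepath[of e "norm e / 2"] pathfinish_circlepath[of e "norm e / 2"]
    by (simp add: acirc_def e_def pathstart_def pathfinish_def)
  \<comment> \<open>The powers of \<open>1\<close> put the coefficients into the form required by
    \<open>picard_fuchs\<close> with scale \<open>L = 1\<close>.\<close>
  interpret elliptic_loop2 "ball 0 \<rho>" "acirc n" "vanish_y n" "\<lambda>x. 1 ^ 2 * g2 n x" "\<lambda>x. 1 ^ 2 * g2' n x"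
    "\<lambda>x. 1 ^ 3 * g3 n x" "\<lambda>x. 1 ^ 3 * g3' n x" "\<lambda>x. 1 ^ 2 * g2'' n" "\<lambda>x. 1 ^ 3 * g3'' n x"
  proof
    fix c :: real and t :: complex assume "c \<in> {0..1}" "t \<in> ball 0 \<rho>"
    have "12 * e * (acirc n c - e) ^ 2 \<noteq> 0" using e w(1)[of c] by simp
    then show "vanish_y n c t ^ 2 = 4 * acirc n c ^ 3 - 1 ^ 2 * g2 n t * acirc n c - 1 ^ 3 * g3 n t"
      by (simp add: y_eq power_mult_distrib q_def)
  qed (use cy y_nz ac in \<open>auto simp: acirc_def vanish_y_def intro!: DERIV_cmult g_deriv continuous_intros g_continuous\<close>)
  have vd: "vector_derivative (acirc n) (at c) = velocity (acirc n) c"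
    if "c \<in> {0..1}" for c
    using that unfolding acirc_def by (simp add: vector_derivative_circlepath01 vector_derivative_circlepath)
  have per: "one_form_integral (Sigma1 n t) = period t" for t
    unfolding one_form_integral_def period_def
    by (intro integral_cong) (simp add: vd Sigma1_eq)
  have per': "(\<lambda>t. one_form_integral (Sigma1 n t)) = period" by (simp add: fun_eq_iff per)
  \<comment> \<open>\<open>1 / y\<close> at \<open>t = 0\<close> is \<open>F x / (x - e)\<close>
    with \<open>F\<close> holomorphic on the disc.\<close>
  define F where "F x = 1 / (csqrt (12 * e) * csqrt (1 + (x - e) / (3 * e)))" for x
  have "((\<lambda>x. F x / (x - e)) has_contour_integral 2 * of_real pi * \<i> * F e) (circlepath e (norm e / 2))"
  proof (rule Cauchy_integral_circlepath_simple)
    have "Re (1 + (x - e) / (3 * e)) > 0" if "x \<in> cball e (norm e / 2)" for x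
    proof -
      have "norm ((x - e) / (3 * e)) \<le> 1 / 6"
        using that e by (simp add: norm_divide norm_mult dist_norm norm_minus_commute field_simps)
      then show ?thesis using abs_Re_le_cmod[of "(x - e) / (3 * e)"] by simp
    qed
    then have "1 + (x - e) / (3 * e) \<notin> \<real>\<^sub>\<le>\<^sub>0" "csqrt (1 + (x - e) / (3 * e)) \<noteq> 0"
      if "x \<in> cball e (norm e / 2)" for x
      using Re_pos_not_nonpos_Reals[of "1 + (x - e) / (3 * e)"] that by fastforce+
    then show "F holomorphic_on cball e (norm e / 2)"
      unfolding F_def by (intro holomorphic_intros) (use e in auto)
  qed (use e in simp)
  then have "((\<lambda>c. F (acirc n c) / (acirc n c - e) * velocity (acirc n) c)
      has_integral 2 * of_real pi * \<i> * F e) {0..1}"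
    by (simp add: has_contour_integral_def acirc_def e_def)
  moreover have "F (acirc n c) / (acirc n c - e) = 1 / vanish_y n c 0 ^ 1" for c
    by (simp add: F_def y_eq q0)
  ultimately have "period 0 = 2 * of_real pi * \<i> * F e"
    unfolding period_def by (simp add: integral_unique)
  then have p0: "one_form_integral (Sigma1 n 0) = 2 * of_real pi * \<i> / csqrt (12 * node n)"
    by (simp add: per F_def e_def)
  show ?thesis
    by (rule that[of \<rho>])
      (use \<rho> cy y_nz period_holomorphic picard_fuchs[where L = 1 and n = n] p0 in \<open>auto simp: per'\<close>)
qed

text \<open>The normalization exists by \<open>hypergeometric_unique\<close> with
  \<open>r = 1\<close> and is unique because the value at \<open>t = 0\<close> already determines
  it.\<close>

lemma form_const_eq: "form_const n = csqrt (12 * node n)"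
  unfolding form_const_def
proof (rule the_equality)
  let ?E = "\<lambda>t. one_form_integral (Sigma1 n t)" and ?c = "csqrt (12 * node n)"
  have c: "?c \<noteq> 0" using node_nz by simp
  obtain \<rho> where \<rho>: "\<rho> > 0" and E: "?E holomorphic_on ball 0 \<rho>"
    and ode: "\<And>t. t \<in> ball 0 \<rho> \<Longrightarrow> Theta [0, 0] ?E t = t * Theta [mu n, 1 - mu n] ?E t"
    and E0: "?E 0 = 2 * of_real pi * \<i> / ?c"
    using vanishing_period[of n] by metis
  have "\<forall>\<^sub>F t in nhds 0. ?E t = ?E 0 * eval_fps (fps_hypergeo [mu n, 1 - mu n] (replicate 1 1) 1) t"
    by (rule hypergeometric_unique[OF \<rho> E]) (use ode in \<open>simp add: numeral_2_eq_2\<close>)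
  then show "\<forall>\<^sub>F t in nhds 0. ?c * ?E t = 2 * of_real pi * \<i> * F21 (mu n) (1 - mu n) 1 t"
    by eventually_elim (use c E0 in \<open>simp add: F21_def\<close>)
  fix N assume "\<forall>\<^sub>F t in nhds 0. N * ?E t = 2 * of_real pi * \<i> * F21 (mu n) (1 - mu n) 1 t"
  then have "N * ?E 0 = 2 * of_real pi * \<i> * F21 (mu n) (1 - mu n) 1 0"
    by (rule eventually_nhds_x_imp_x)
  also have "F21 (mu n) (1 - mu n) 1 0 = 1"
    by (simp add: F21_def eval_fps_at_0)
  finally show "N = ?c" using c E0 by (simp add: field_simps)
qed

section \<open>The period over \<open>\<Sigma>\<^sub>3\<close>\<close>

lemma circ_derivative:
  "(circ has_vector_derivative 2 * of_real pi * \<i> * circ s) (at s)"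
  using has_vector_derivative_circlepath[of 0 "1/2" s UNIV]
  by (simp add: circ_def[symmetric] circ_eq mult_ac)

lemma circ_vector_derivative:
  "vector_derivative circ (at s) = 2 * of_real pi * \<i> * circ s"
  "s \<in> {0..1} \<Longrightarrow> velocity circ s = 2 * of_real pi * \<i> * circ s"
proof -
  show "vector_derivative circ (at s) = 2 * of_real pi * \<i> * circ s"
    using circ_derivative by (rule vector_derivative_at)
  show "velocity circ s = 2 * of_real pi * \<i> * circ s" if "s \<in> {0..1}"
    using that circ_derivative[of s]
    by (intro vector_derivative_at_within_ivl) auto
qed

lemma acirc_derivative:
  "(acirc n has_vector_derivative 2 * of_real pi * \<i> * (acirc n s - node n)) (at s)"
  using has_vector_derivative_circlepath[of "node n" "norm (node n) / 2" s UNIV]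
  by (simp add: acirc_def circlepath mult_ac)

lemma acirc_vector_derivative:
  "vector_derivative (acirc n) (at s) = 2 * of_real pi * \<i> * (acirc n s - node n)"
  using acirc_derivative by (rule vector_derivative_at)

lemma Sigma3_eq:
  assumes v_def: "v = circ a" and u_def: "u = circ b"
    and x_def: "x = c_kl 1 1 * wt 1 1 u * (c_kl k l * wt k l v * t)"
  shows "Sigma3 n k l \<beta> t (a, b, c) = (v, u, v^2 * (v + 1) powr (2 * \<beta>) * (u^2 * (u + 1)^2 * acirc n c),
     v^3 * (v + 1) powr (3 * \<beta>) * (u^3 * (u + 1)^3 * vanish_y n c x))"
proof -
  have "- K / (4 * u * (u + 1)) = c_kl 1 1 * wt 1 1 u * K" for K
    by (simp add: c_kl_1_1 wt_def)
  then show ?thesis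
    unfolding Sigma3_def Sigma2_def Let_def prod.case circ_eq[symmetric] Sigma1_eq K3_param_eq
      v_def[symmetric] u_def[symmetric] x_def by (simp only: prod.case)
qed

text \<open>\<open>v\<close> depends on \<open>a\<close> alone and \<open>u\<close> on
  \<open>b\<close> alone, so the Jacobian matrix is triangular and its determinant is the product of
  the diagonal. The integrand is then a nested product of three one-dimensional ones.\<close>

lemma Sigma3_integrand:
  fixes a b c :: real
  assumes v_def: "v = circ a" and u_def: "u = circ b" and S_def: "S = Sigma3 n k l \<beta> t"
    and p_def: "p = (a, b, c)" and X_def: "X = (\<lambda>p. fst (snd (snd (S p))))"
  shows "det (vector [vector [pd1 (\<lambda>p. fst (S p)) p, pd2 (\<lambda>p. fst (S p)) p, pd3 (\<lambda>p. fst (S p)) p],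
      vector [pd1 (\<lambda>p. fst (snd (S p))) p, pd2 (\<lambda>p. fst (snd (S p))) p, pd3 (\<lambda>p. fst (snd (S p))) p],
      vector [pd1 X p, pd2 X p, pd3 X p]] :: complex^3^3) / snd (snd (snd (S p)))
    = (rad \<beta> v * vector_derivative circ (at a)) * (rad 1 u * vector_derivative circ (at b))
      * (vector_derivative (acirc n) (at c)
          / vanish_y n c (c_kl 1 1 * wt 1 1 u * (c_kl k l * wt k l v * t)))"
proof -
  let ?x = "c_kl 1 1 * wt 1 1 u * (c_kl k l * wt k l v * t)"
  define m where "m = v^2 * (v + 1) powr (2 * \<beta>) * (u^2 * (u + 1)^2)"
  have pv: "pd1 (\<lambda>p. fst (S p)) p = vector_derivative circ (at a)" "pd2 (\<lambda>p. fst (S p)) p = 0"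
    "pd3 (\<lambda>p. fst (S p)) p = 0"
    unfolding pd1_def pd2_def pd3_def S_def p_def by (simp_all add: Sigma3_eq[OF refl refl refl])
  have pu: "pd2 (\<lambda>p. fst (snd (S p))) p = vector_derivative circ (at b)"
    "pd3 (\<lambda>p. fst (snd (S p))) p = 0"
    unfolding pd2_def pd3_def S_def p_def by (simp_all add: Sigma3_eq[OF refl refl refl])
  have "((\<lambda>c. m * acirc n c) has_vector_derivative m * vector_derivative (acirc n) (at c)) (at c)"
    unfolding acirc_vector_derivative by (intro has_vector_derivative_mult_right acirc_derivative)
  then have pX: "pd3 X p = m * vector_derivative (acirc n) (at c)"
    unfolding pd3_def X_def S_def p_def
    by (simp add: Sigma3_eq[OF refl refl refl] m_def u_def v_def vector_derivative_at mult.assoc)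
  have nz: "v \<noteq> 0" "v + 1 \<noteq> 0" "u \<noteq> 0" "u + 1 \<noteq> 0"
    using norm_half[OF norm_circ] by (simp_all add: v_def u_def)
  \<comment> \<open>\<open>X\<close> is rescaled by a square and \<open>Y\<close> by the matching
    cube; their quotient leaves the inverse scales \<open>rad\<close>. For the power of
    \<open>v + 1\<close> this is \<open>2 \<beta> - 3 \<beta> = - \<beta>\<close>.\<close>
  have "rad \<beta> v * rad 1 u = m / (v^3 * (v + 1) powr (3 * \<beta>) * (u^3 * (u + 1)^3))"
  proof -
    have "(v + 1) powr (2 * \<beta>) = (v + 1) powr (- \<beta>) * (v + 1) powr (3 * \<beta>)"
      by (simp flip: powr_add)
    moreover have "V^2 * (A * P) * (U^2 * W^2) / (V^3 * P * (U^3 * W^3)) = A / V * (1 / (U * W))"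
      if "V \<noteq> 0" "P \<noteq> 0" "U \<noteq> 0" "W \<noteq> 0" for V A P U W :: complex
      using that by (simp add: field_simps eval_nat_numeral)
    ultimately show ?thesis
      using nz by (simp add: m_def rad_1) (simp add: rad_def)
  qed
  moreover have "snd (snd (snd (S p))) = v^3 * (v + 1) powr (3 * \<beta>) * (u^3 * (u + 1)^3) * vanish_y n c ?x"
    unfolding S_def p_def by (simp add: Sigma3_eq[OF refl refl refl] u_def v_def mult.assoc del: One_nat_def)
  moreover have "r1 * d1 * (r2 * d2) * (d3 / y) = d1 * d2 * (m' * d3) / (M * y)"
    if "r1 * r2 = m' / M" for r1 r2 d1 d2 d3 m' M y :: complex
  proof -
    have "r1 * d1 * (r2 * d2) * (d3 / y) = r1 * r2 * (d1 * d2 * d3) / y" by simp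
    then show ?thesis by (simp add: that)
  qed
  ultimately show ?thesis
    unfolding det_3 by (simp add: pv pu pX del: One_nat_def)
qed

text \<open>Fubini turns the integral over the cube into two nested circle twists of the A-period.
  The constant \<open>csqrt (12 * node n)\<close> cancels the denominator in its value at
  \<open>0\<close>, leaving \<open>2 \<pi> i\<close> once from the curve and once from each
  circle.\<close>

theorem Sigma3_period_eq:
  assumes kl: "k > 0" "l > 0"
    and red: "reduces k l \<beta> k l [1, 1 / 2, mu n, 1 - mu n] Q"
  obtains \<rho> P where "\<rho> > 0" "P holomorphic_on ball 0 \<rho>"
    "\<And>t. t \<in> ball 0 \<rho> \<Longrightarrow> Theta [0, 0, 0, 0] P t = t * Theta Q P t"
    "P 0 = (2 * of_real pi * \<i>) ^ 3" "\<And>t. t \<in> ball 0 \<rho> \<Longrightarrow> Sigma3_period n k l \<beta> t = P t"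
proof -
  let ?E = "\<lambda>t. one_form_integral (Sigma1 n t)"
  let ?d = "\<lambda>s. velocity circ s"
  obtain \<rho>1 where \<rho>1: "\<rho>1 > 0" and cy: "continuous_on ({0..1} \<times> ball 0 \<rho>1) (\<lambda>(c, t). vanish_y n c t)"
    and y_nz: "\<And>c t. \<lbrakk>c \<in> {0..1}; t \<in> ball 0 \<rho>1\<rbrakk> \<Longrightarrow> vanish_y n c t \<noteq> 0"
    and E: "?E holomorphic_on ball 0 \<rho>1"
    and E_ode: "\<And>t. t \<in> ball 0 \<rho>1 \<Longrightarrow> Theta [0, 0] ?E t = t * Theta [mu n, 1 - mu n] ?E t"
    and E0: "?E 0 = 2 * of_real pi * \<i> / csqrt (12 * node n)"
    using vanishing_period[of n] by blast
  define \<psi> where "\<psi> = (\<lambda>K. integral {0..1} (\<lambda>s. rad 1 (circ s) * ?E (c_kl 1 1 * wt 1 1 (circ s) * K) * ?d s))"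
  define \<rho>2 where "\<rho>2 = \<rho>1 / ((norm (c_kl 1 1) + 1) * 2 ^ (1 + 1))"
  have red1: "reduces 1 1 1 1 1 (1 # [mu n, 1 - mu n]) [1 / 2, mu n, 1 - mu n]"
    unfolding One_nat_def
    by (rule reduces.left, simp, rule reduces.right, simp, rule reduces.stop, simp)
  have "\<forall>x\<in>ball 0 \<rho>1. Theta (replicate (length [mu n, 1 - mu n]) 0) ?E x = x * Theta [mu n, 1 - mu n] ?E x"
    using E_ode by (simp add: numeral_2_eq_2 del: Theta_simps)
  note tw1 = circle_twist[OF \<rho>1 E this red1 zero_less_one zero_less_one, folded \<rho>2_def \<psi>_def]
  define P where "P = (\<lambda>t. integral {0..1} (\<lambda>s. rad \<beta> (circ s) * \<psi> (c_kl k l * wt k l (circ s) * t) * ?d s))"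
  define \<rho>3 where "\<rho>3 = \<rho>2 / ((norm (c_kl k l) + 1) * 2 ^ (k + l))"
  have "\<forall>x\<in>ball 0 \<rho>2. Theta (replicate (length [1 / 2, mu n, 1 - mu n]) 0) \<psi> x
      = x * Theta [1 / 2, mu n, 1 - mu n] \<psi> x"
    using tw1(3) by (simp add: numeral_2_eq_2 del: Theta_simps)
  note tw2 = circle_twist[OF tw1(1,2) this red kl, folded \<rho>3_def P_def]
  let ?N = "csqrt (12 * node n)"
  have N: "?N \<noteq> 0" using node_nz by simp
  have key: "three_form_integral (Sigma3 n k l \<beta> t) = P t" if t: "t \<in> ball 0 \<rho>3" for t
  proof -
    define x where "x a b = c_kl 1 1 * wt 1 1 (circ b) * (c_kl k l * wt k l (circ a) * t)" for a b
    have K: "c_kl k l * wt k l (circ a) * t \<in> ball 0 \<rho>2" for a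
      using wt_circ_small[OF tw1(1) norm_circ] t unfolding \<rho>3_def by blast
    have x: "x a b \<in> ball 0 \<rho>1" for a b
      unfolding x_def by (rule wt_circ_small[OF \<rho>1 norm_circ]) (use K in \<open>simp add: \<rho>2_def\<close>)
    define A where "A a = rad \<beta> (circ a) * vector_derivative circ (at a)" for a
    define B where "B b = rad 1 (circ b) * vector_derivative circ (at b)" for b
    define Y where "Y c z = vector_derivative (acirc n) (at c) / vanish_y n c z" for c z
    let ?F = "\<lambda>p. A (fst p) * B (fst (snd p)) * Y (snd (snd p)) (x (fst p) (fst (snd p)))"
    \<comment> \<open>Joint continuity on the cube justifies iterated integration; the radii ensure
      that every modulus \<open>x a b\<close> stays where \<open>vanish_y\<close> is continuous and
      nonzero.\<close>
    have cF: "continuous_on (cbox (0, 0, 0) (1, 1, 1)) ?F"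
    proof -
      have 1: "continuous_on UNIV circ" unfolding circ_eq[abs_def] by (intro continuous_intros)
      have 2: "continuous_on UNIV (acirc n)" unfolding acirc_def circlepath by (intro continuous_intros)
      have nz: "circ a \<noteq> 0" "circ a + 1 \<noteq> 0" "0 \<le> Re (circ a) + 1" for a
        using norm_half[OF norm_circ[of a]] by auto
      have c1: "continuous_on UNIV (\<lambda>p. circ (fst p))" "continuous_on UNIV (\<lambda>p. circ (fst (snd p)))"
        for p :: "real \<times> real \<times> real"
        by (auto intro!: continuous_on_compose2[OF 1] continuous_intros)
      have cr: "continuous_on UNIV (\<lambda>a. rad \<gamma> (circ a))" for \<gamma>
        unfolding rad_def by (intro continuous_intros 1) (use nz in auto)
      have cA: "continuous_on UNIV A" "continuous_on UNIV B"
        unfolding A_def B_def circ_vector_derivative by (intro continuous_intros cr 1)+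
      have cw: "continuous_on UNIV (\<lambda>a. wt i j (circ a))" for i j
        unfolding wt_def by (intro continuous_intros 1) (use nz in auto)
      have cx: "continuous_on UNIV (\<lambda>p. x (fst p) (fst (snd p)))"
        unfolding x_def
        by (intro continuous_intros continuous_on_compose2[OF cw]) auto
      have cY: "continuous_on ({0..1} \<times> ball 0 \<rho>1) (\<lambda>(c, z). Y c z)"
        unfolding Y_def acirc_vector_derivative case_prod_beta
        using cy unfolding case_prod_beta
        by (intro continuous_intros continuous_on_compose2[OF 2]) (use y_nz in auto)
      have "continuous_on (cbox (0, 0, 0) (1, 1, 1)) (\<lambda>p. (\<lambda>(c, z). Y c z) (snd (snd p), x (fst p) (fst (snd p))))"
        by (rule continuous_on_compose2[OF cY])
          (use x in \<open>auto intro!: continuous_intros continuous_on_subset[OF cx]\<close>)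
      then show "continuous_on (cbox (0, 0, 0) (1, 1, 1)) ?F"
        by (intro continuous_intros continuous_on_compose2[OF cA(1)] continuous_on_compose2[OF cA(2)]) auto
    qed
    have "three_form_integral (Sigma3 n k l \<beta> t) = integral (cbox (0, 0, 0) (1, 1, 1)) ?F"
      unfolding three_form_integral_def Let_def
    proof (rule integral_cong)
      fix p :: "real \<times> real \<times> real"
      obtain a b c where "p = (a, b, c)" by (cases p)
      then show "det (vector [vector [pd1 (\<lambda>p. fst (Sigma3 n k l \<beta> t p)) p,
            pd2 (\<lambda>p. fst (Sigma3 n k l \<beta> t p)) p, pd3 (\<lambda>p. fst (Sigma3 n k l \<beta> t p)) p],
          vector [pd1 (\<lambda>p. fst (snd (Sigma3 n k l \<beta> t p))) p,
            pd2 (\<lambda>p. fst (snd (Sigma3 n k l \<beta> t p))) p, pd3 (\<lambda>p. fst (snd (Sigma3 n k l \<beta> t p))) p],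
          vector [pd1 (\<lambda>p. fst (snd (snd (Sigma3 n k l \<beta> t p)))) p,
            pd2 (\<lambda>p. fst (snd (snd (Sigma3 n k l \<beta> t p)))) p,
            pd3 (\<lambda>p. fst (snd (snd (Sigma3 n k l \<beta> t p)))) p]] :: complex^3^3)
          / snd (snd (snd (Sigma3 n k l \<beta> t p))) = ?F p"
        unfolding A_def B_def Y_def x_def
        by (simp only: Sigma3_integrand[OF refl refl refl refl refl] fst_conv snd_conv)
    qed
    also have "\<dots> = integral (cbox 0 1) (\<lambda>a. integral (cbox (0, 0) (1, 1)) (\<lambda>q. ?F (a, q)))"
      by (rule integral_prod_continuous[OF cF])
    also have "\<dots> = integral (cbox 0 1) (\<lambda>a. integral (cbox 0 1) (\<lambda>b. integral (cbox 0 1) (\<lambda>c. ?F (a, b, c))))"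
    proof (rule integral_cong)
      fix a :: real assume "a \<in> cbox 0 1"
      then have "continuous_on (cbox (0, 0) (1, 1)) (\<lambda>q. ?F (a, q))"
        by (intro continuous_on_compose2[OF cF, of _ "\<lambda>q. (a, q)"]) (auto intro!: continuous_intros)
      from integral_prod_continuous[OF this]
      show "integral (cbox (0, 0) (1, 1)) (\<lambda>q. ?F (a, q))
          = integral (cbox 0 1) (\<lambda>b. integral (cbox 0 1) (\<lambda>c. ?F (a, b, c)))" .
    qed
    also have "\<dots> = integral {0..1} (\<lambda>a. integral {0..1} (\<lambda>b. A a * B b * ?E (x a b)))"
    proof -
      have "?E z = integral {0..1} (\<lambda>c. Y c z)" for z
        by (simp add: one_form_integral_def Sigma1_eq Y_def)
      then show ?thesis by simp
    qed
    also have "\<dots> = integral {0..1} (\<lambda>a. A a * \<psi> (c_kl k l * wt k l (circ a) * t))"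
    proof (rule integral_cong)
      fix a :: real
      have "\<psi> (c_kl k l * wt k l (circ a) * t) = integral {0..1} (\<lambda>b. B b * ?E (x a b))"
        unfolding \<psi>_def x_def B_def
        by (rule integral_cong) (simp add: circ_vector_derivative)
      then show "integral {0..1} (\<lambda>b. A a * B b * ?E (x a b)) = A a * \<psi> (c_kl k l * wt k l (circ a) * t)"
        by (simp add: mult.assoc)
    qed
    also have "\<dots> = P t"
      unfolding P_def A_def by (rule integral_cong) (simp add: circ_vector_derivative)
    finally show ?thesis .
  qed
  show ?thesis
  proof (rule that[of \<rho>3 "\<lambda>t. ?N * P t"])
    show "(\<lambda>t. ?N * P t) holomorphic_on ball 0 \<rho>3" by (intro holomorphic_intros tw2)
    show "Theta [0, 0, 0, 0] (\<lambda>t. ?N * P t) t = t * Theta Q (\<lambda>t. ?N * P t) t" if "t \<in> ball 0 \<rho>3" for t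
    proof -
      have "Theta as (\<lambda>t. ?N * P t) t = ?N * Theta as P t" for as
        using Theta_rescale[OF open_ball tw2(2), of 1 t as ?N] that by simp
      then show ?thesis using tw2(3)[OF that] by (simp add: numeral_3_eq_3 del: Theta_simps)
    qed
    have "P 0 = 2 * of_real pi * \<i> * \<psi> 0" by (simp only: P_def tw2(4))
    also have "\<psi> 0 = 2 * of_real pi * \<i> * ?E 0" by (simp only: \<psi>_def tw1(4))
    finally show "?N * P 0 = (2 * of_real pi * \<i>) ^ 3"
      unfolding E0 using N by (simp add: power3_eq_cube)
  qed (use tw2(1) key in \<open>simp_all add: Sigma3_period_def form_const_eq\<close>)
qed

section \<open>The realizations\<close>

text \<open>Written with \<open>a - 1\<close> instead of \<open>Suc a\<close>, so that the rule can
  be applied to numerals.\<close>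

lemma reduces_leftI:
  assumes "a > 0" "of_nat a / of_nat k \<in> set M"
    "reduces k l \<beta> (a - 1) b ((of_nat (a - 1 + b) + \<beta>) / of_nat (k + l) # remove1 (of_nat a / of_nat k) M) M'"
  shows "reduces k l \<beta> a b M M'"
  using assms reduces.left[of "a - 1" k M l \<beta> b M'] by simp

lemma reduces_rightI:
  assumes "b > 0" "(of_nat (b - 1) + \<beta>) / of_nat l \<in> set M"
    "reduces k l \<beta> a (b - 1) ((of_nat (a + (b - 1)) + \<beta>) / of_nat (k + l)
      # remove1 ((of_nat (b - 1) + \<beta>) / of_nat l) M) M'"
  shows "reduces k l \<beta> a b M M'"
  using assms reduces.right[of "b - 1" \<beta> l M k a M'] by simp

lemma mset_eq_remove1I:
  assumes "x \<in> set ys" "mset xs = mset (remove1 x ys)"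
  shows "mset (x # xs) = mset ys"
  using assms by simp

text \<open>Performing all exchanges on the left before those on the right succeeds for every entry.\<close>

lemma realizations_reduce:
  assumes "((p, q), (n, k, l, \<beta>)) \<in> realizations"
  shows "(\<beta> = of_nat 1 / 2 \<or> \<beta> = of_nat 2 / 2) \<and> k > 0 \<and> l > 0 \<and>
    reduces k l \<beta> k l [1, 1 / 2, mu n, 1 - mu n] [p, q, 1 - q, 1 - p]"
  using assms unfolding realizations_def
  apply (simp only: Un_iff mem_Times_iff fst_conv snd_conv insert_iff empty_iff prod.inject simp_thms)
  apply (elim disjE conjE)
  apply (simp_all only: mu_def)
  apply (((rule conjI, (simp; fail))+, (rule reduces_leftI, (simp; fail), (simp; fail), simp)+,
     (rule reduces_rightI, (simp; fail), (simp; fail), simp)+,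
     rule reduces.stop, (rule mset_eq_remove1I, (simp; fail), simp)+)[1])+
  done

theorem corollary8p5:
  fixes n k l :: nat and p q \<beta> :: complex
  assumes "((p, q), (n, k, l, \<beta>)) \<in> realizations"
  shows "(\<forall>W P. open W \<longrightarrow> threefold_period n k l \<beta> W P \<longrightarrow>
            P holomorphic_on W \<and> (\<forall>t\<in>W. PF p q P t = 0))
       \<and> Sigma3_period n k l \<beta> analytic_on {0}
       \<and> (\<forall>\<^sub>F t in nhds 0. Sigma3_period n k l \<beta> t
            = (2 * of_real pi * \<i>)^3 * F43 p q (1 - q) (1 - p) 1 1 1 t)"
proof -
  \<comment> \<open>\<open>mb = 2 \<beta>\<close> is \<open>1\<close> or \<open>2\<close>.\<close>
  from realizations_reduce[OF assms] obtain mb :: nat where \<beta>: "\<beta> = of_nat mb / 2" "mb > 0"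
    and kl: "k > 0" "l > 0"
    and red: "reduces k l \<beta> k l [1, 1 / 2, mu n, 1 - mu n] [p, q, 1 - q, 1 - p]"
    by (metis zero_less_one zero_less_numeral)
  obtain \<rho> P where \<rho>: "\<rho> > 0" and P: "P holomorphic_on ball 0 \<rho>"
    and ode: "\<And>t. t \<in> ball 0 \<rho> \<Longrightarrow> Theta [0, 0, 0, 0] P t = t * Theta [p, q, 1 - q, 1 - p] P t"
    and P0: "P 0 = (2 * of_real pi * \<i>) ^ 3"
    and eq: "\<And>t. t \<in> ball 0 \<rho> \<Longrightarrow> Sigma3_period n k l \<beta> t = P t"
    by (rule Sigma3_period_eq[OF kl red]) blast
  have ev: "\<forall>\<^sub>F t in nhds 0. Sigma3_period n k l \<beta> t = P t"
    using eventually_nhds_in_open[of "ball 0 \<rho>" 0] \<rho> by (auto elim!: eventually_mono simp: eq)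
  have "P analytic_on {0}"
    using P \<rho> by (auto simp: analytic_at intro!: exI[of _ "ball 0 \<rho>"])
  then have "Sigma3_period n k l \<beta> analytic_on {0}"
    using analytic_at_cong[OF ev refl] by simp
  moreover have "\<forall>\<^sub>F t in nhds 0. P t = P 0 * eval_fps (fps_hypergeo [p, q, 1 - q, 1 - p] (replicate 3 1) 1) t"
    by (rule hypergeometric_unique[OF \<rho> P]) (use ode in \<open>simp add: numeral_3_eq_3\<close>)
  with ev have "\<forall>\<^sub>F t in nhds 0. Sigma3_period n k l \<beta> t
            = (2 * of_real pi * \<i>)^3 * F43 p q (1 - q) (1 - p) 1 1 1 t"
    by eventually_elim (simp add: P0 F43_def numeral_3_eq_3)
  ultimately show ?thesis
    using threefold_period_ode[OF \<beta> kl _ _ red] by (simp add: PF_eq_Theta del: Theta_simps)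
qed

end
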